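(* Let $N\in\mathbb N$, let $X(t)=\{X_i^j(t):1\le i\le j\le N\}$, $t=0,1,2,\dots$, be a family of $N(N+1)/2$ independent simple random walks, and let $\mathcal X(t)$, $t=0,1,2,\dots$, be the interlacing dynamics driven by $X$ (the particle dynamics related to the shuffling algorithm for the domino tilings of the Aztec diamond). Then, under the rescaling for which the driving random walks converge to standard Brownian motions, the interlacing dynamics $\mathcal X$ converges to the process $W$ of reflected interlacing Brownian motions started from $0$. Explicitly: let $a_n(\cdot)$ be continuous real-valued functions on $[0,\infty)$ and $b_n>0$, $b_n\to\infty$, be such that the laws of $(X(\lfloor nt\rfloor)-a_n(t))/b_n$, $t\ge0$, on $D([0,\infty),\mathbb R^{N(N+1)/2})$ converge as $n\to\infty$ to the law of a standard $N(N+1)/2$-dimensional Brownian motion, and let the initial condition $\mathcal X(0)\in\mathbb{GT}^{(N)}$ be independent of the increments of $X$ and such that $(\mathcal X(0)-a_n(0))/b_n$ converges in law to $0$. Then the laws of $(\mathcal X(\lfloor nt\rfloor)-a_n(t))/b_n$, $t\ge0$, on $D([0,\infty),\mathbb R^{N(N+1)/2})$ converge as $n\to\infty$ to the law of $W$ started from $0$. (Here $a_n$ is subtracted from every coordinate.)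
   Context: **Interlacing configurations.** $\mathbb{GT}^{(N)}$ is the set of integer arrays $(x_i^j)_{1\le i\le j\le N}$ with $x_{i-1}^j<x_{i-1}^{j-1}\le x_i^j$ for all $2\le i\le j\le N$. $\mathbb{GT}^{(N)}_c$ is the set of real arrays $(x_i^j)_{1\le i\le j\le N}$ with $x_{i-1}^j\le x_{i-1}^{j-1}\le x_i^j$ for all $2\le i\le j\le N$. **Interlacing dynamics.** Let $X$ be a $\mathbb Z^{N(N+1)/2}$-valued process with càdlàg paths and $|X_i^j(t)-X_i^j(t-)|\le1$ for all $t,i,j$ (so there are finitely many jump times on bounded intervals). The interlacing dynamics $\mathcal X(t)$, $t\ge0$, driven by $X$ has initial value $\mathcal X(0)$, a given $\mathbb{GT}^{(N)}$-valued random variable; $\mathcal X$ is constant on every time interval on which $X$ is constant; and at each discontinuity time $t$ of $X$, $\mathcal X(t)$ is determined by $\mathcal X(t-)$ and $X(t)-X(t-)$ by a sequential update. First $\mathcal X_1^1(t)=\mathcal X_1^1(t-)+X_1^1(t)-X_1^1(t-)$. Then for $k=2,\dots,N$ in order, once all $\mathcal X_i^j(t)$ with $j\le k-1$ are determined, for each $i=1,\dots,k$ apply the first of the following steps whose condition holds: 1. (push) If $i>1$ and $\mathcal X_i^k(t-)=\mathcal X_{i-1}^{k-1}(t)-1$, set $\mathcal X_i^k(t)=\mathcal X_i^k(t-)+1$. 2. (push) If $i<k$ and $\mathcal X_i^k(t-)=\mathcal X_i^{k-1}(t)$, set $\mathcal X_i^k(t)=\mathcal X_i^k(t-)-1$.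 3. If $X_i^k(t)-X_i^k(t-)=1$: if $i<k$ and $\mathcal X_i^{k-1}(t)=\mathcal X_i^k(t-)+1$ (blocked), set $\mathcal X_i^k(t)=\mathcal X_i^k(t-)$; otherwise set $\mathcal X_i^k(t)=\mathcal X_i^k(t-)+1$. 4. If $X_i^k(t)-X_i^k(t-)=-1$: if $i>1$ and $\mathcal X_{i-1}^{k-1}(t)=\mathcal X_i^k(t-)$ (blocked), set $\mathcal X_i^k(t)=\mathcal X_i^k(t-)$; otherwise set $\mathcal X_i^k(t)=\mathcal X_i^k(t-)-1$. 5. If $X_i^k(t)-X_i^k(t-)=0$, set $\mathcal X_i^k(t)=\mathcal X_i^k(t-)$. For a discrete-time process $X(t)$, $t=0,1,2,\dots$, set $\bar X(t)=X(\lfloor t\rfloor)$, $t\ge0$; the discrete-time interlacing dynamics driven by $X$ is the restriction to integer times of the interlacing dynamics driven by $\bar X$. **The process $W$ (Warren).** $W$ is a $\mathbb{GT}^{(N)}_c$-valued process defined level by level: $W_1^1$ is a standard Brownian motion; for $k\ge2$, $W_i^k$ is a standard Brownian motion (independent of those used in the previous steps) reflected on the trajectories of $W_{i-1}^{k-1}$ (if $i>1$, keeping $W_i^k\ge W_{i-1}^{k-1}$) and $W_i^{k-1}$ (if $i<k$, keeping $W_i^k\le W_i^{k-1}$). Started from $0$ means $W_i^j(0)=0$ for all $i,j$. **Function space.** $D([0,\infty),\mathbb R^d)$ is the space of right-continuous functions $[0,\infty)\to\mathbb R^d$ with left limits, with the topology of uniform convergence on compact sets. *)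

theory Defs
  imports "HOL-Probability.Probability"
begin

section \<open>Triangular arrays\<close>

text \<open>An array \<open>(x_i^j)\<close> with \<open>1 \<le> i \<le> j \<le> N\<close> is a function on pairs; \<open>x (i, j)\<close> stands
  for \<open>x_i^j\<close>, and only its values on \<open>tri N\<close> are relevant.\<close>

definition tri :: "nat \<Rightarrow> (nat \<times> nat) set" where
  "tri N = {(i, j). 1 \<le> i \<and> i \<le> j \<and> j \<le> N}"

definition GT :: "nat \<Rightarrow> (nat \<times> nat \<Rightarrow> int) set" where
  "GT N = {x. \<forall>i j. 2 \<le> i \<and> i \<le> j \<and> j \<le> N \<longrightarrow>
                x (i - 1, j) < x (i - 1, j - 1) \<and> x (i - 1, j - 1) \<le> x (i, j)}"

definition GTc :: "nat \<Rightarrow> (nat \<times> nat \<Rightarrow> real) set" where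
  "GTc N = {x. \<forall>i j. 2 \<le> i \<and> i \<le> j \<and> j \<le> N \<longrightarrow>
                x (i - 1, j) \<le> x (i - 1, j - 1) \<and> x (i - 1, j - 1) \<le> x (i, j)}"


section \<open>Interlacing dynamics\<close>

text \<open>\<open>gt_update N y dx y'\<close>: the configuration \<open>y'\<close> results from \<open>y\<close> when the driving process
  jumps by \<open>dx\<close>. The equations for level \<open>k\<close> involve \<open>y'\<close> only on level \<open>k - 1\<close>, so they
  determine \<open>y'\<close> on \<open>tri N\<close> level by level.\<close>

definition gt_update ::
  "nat \<Rightarrow> (nat \<times> nat \<Rightarrow> int) \<Rightarrow> (nat \<times> nat \<Rightarrow> int) \<Rightarrow> (nat \<times> nat \<Rightarrow> int) \<Rightarrow> bool" where
  "gt_update N y dx y' \<longleftrightarrow>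
     (1 \<le> N \<longrightarrow> y' (1, 1) = y (1, 1) + dx (1, 1)) \<and>
     (\<forall>k\<in>{2..N}. \<forall>i\<in>{1..k}. y' (i, k) =
       (if i > 1 \<and> y (i, k) = y' (i - 1, k - 1) - 1 then y (i, k) + 1
        else if i < k \<and> y (i, k) = y' (i, k - 1) then y (i, k) - 1
        else if dx (i, k) = 1 then
          (if i < k \<and> y' (i, k - 1) = y (i, k) + 1 then y (i, k) else y (i, k) + 1)
        else if dx (i, k) = - 1 then
          (if i > 1 \<and> y' (i - 1, k - 1) = y (i, k) then y (i, k) else y (i, k) - 1)
        else y (i, k)))"

definition left_limit :: "(real \<Rightarrow> int) \<Rightarrow> real \<Rightarrow> int" where
  "left_limit f t = Lim (at_left t) f"

text \<open>A pathwise notion: \<open>x\<close> is a path of the driving process and \<open>y\<close> the corresponding path of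
  the interlacing dynamics.\<close>

definition interlacing_dynamics ::
  "nat \<Rightarrow> (nat \<times> nat \<Rightarrow> real \<Rightarrow> int) \<Rightarrow> (nat \<times> nat \<Rightarrow> real \<Rightarrow> int) \<Rightarrow> bool" where
  "interlacing_dynamics N x y \<longleftrightarrow>
     (\<lambda>p. y p 0) \<in> GT N \<and>
     (\<forall>s t. 0 \<le> s \<and> s \<le> t \<and> (\<forall>p\<in>tri N. \<forall>r\<in>{s..t}. x p r = x p s) \<longrightarrow>
        (\<forall>p\<in>tri N. y p t = y p s)) \<and>
     (\<forall>t>0. (\<exists>p\<in>tri N. x p t \<noteq> left_limit (x p) t) \<longrightarrow>
        gt_update N (\<lambda>p. left_limit (y p) t) (\<lambda>p. x p t - left_limit (x p) t) (\<lambda>p. y p t))"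

definition discrete_interlacing_dynamics ::
  "nat \<Rightarrow> (nat \<times> nat \<Rightarrow> nat \<Rightarrow> int) \<Rightarrow> (nat \<times> nat \<Rightarrow> nat \<Rightarrow> int) \<Rightarrow> bool" where
  "discrete_interlacing_dynamics N x y \<longleftrightarrow>
     (\<exists>z. interlacing_dynamics N (\<lambda>p t. x p (nat \<lfloor>t\<rfloor>)) z \<and>
          (\<forall>p\<in>tri N. \<forall>m. y p m = z p (real m)))"


section \<open>Path space and convergence of laws\<close>

text \<open>Right-continuous paths with left limits, with values in the \<open>I\<close>-indexed real vectors.\<close>

definition cadlag_paths :: "'i set \<Rightarrow> (real \<Rightarrow> 'i \<Rightarrow> real) set" where
  "cadlag_paths I = {f \<in> {0..} \<rightarrow>\<^sub>E (I \<rightarrow>\<^sub>E UNIV). \<forall>p\<in>I.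
     (\<forall>t\<ge>0. continuous (at_right t) (\<lambda>s. f s p)) \<and>
     (\<forall>t>0. \<exists>l. ((\<lambda>s. f s p) \<longlongrightarrow> l) (at_left t))}"

text \<open>The topology of uniform convergence on compact sets (for finite \<open>I\<close>).\<close>

definition cadlag_topology :: "'i set \<Rightarrow> (real \<Rightarrow> 'i \<Rightarrow> real) topology" where
  "cadlag_topology I = topology (\<lambda>U. U \<subseteq> cadlag_paths I \<and>
     (\<forall>f\<in>U. \<exists>T. \<exists>e>0. \<forall>g\<in>cadlag_paths I.
        (\<forall>t\<in>{0..T}. \<forall>p\<in>I. \<bar>g t p - f t p\<bar> < e) \<longrightarrow> g \<in> U))"

lemma openin_cadlag_topology:
  "openin (cadlag_topology I) U \<longleftrightarrow> U \<subseteq> cadlag_paths I \<and>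
     (\<forall>f\<in>U. \<exists>T. \<exists>e>0. \<forall>g\<in>cadlag_paths I.
        (\<forall>t\<in>{0..T}. \<forall>p\<in>I. \<bar>g t p - f t p\<bar> < e) \<longrightarrow> g \<in> U)"
proof -
  have "istopology (\<lambda>U. U \<subseteq> cadlag_paths I \<and>
     (\<forall>f\<in>U. \<exists>T. \<exists>e>0. \<forall>g\<in>cadlag_paths I.
        (\<forall>t\<in>{0..T}. \<forall>p\<in>I. \<bar>g t p - f t p\<bar> < e) \<longrightarrow> g \<in> U))" (is "istopology ?P")
    unfolding istopology_def
  proof (intro conjI allI impI)
    fix S T assume S: "?P S" and T: "?P T"
    show "S \<inter> T \<subseteq> cadlag_paths I" using S by blast
    show "\<forall>f\<in>S \<inter> T. \<exists>r. \<exists>e>0. \<forall>g\<in>cadlag_paths I.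
        (\<forall>t\<in>{0..r}. \<forall>p\<in>I. \<bar>g t p - f t p\<bar> < e) \<longrightarrow> g \<in> S \<inter> T"
    proof
      fix f assume f: "f \<in> S \<inter> T"
      obtain r1 e1 where 1: "e1 > 0" "\<forall>g\<in>cadlag_paths I.
          (\<forall>t\<in>{0..r1}. \<forall>p\<in>I. \<bar>g t p - f t p\<bar> < e1) \<longrightarrow> g \<in> S" using S f by blast
      obtain r2 e2 where 2: "e2 > 0" "\<forall>g\<in>cadlag_paths I.
          (\<forall>t\<in>{0..r2}. \<forall>p\<in>I. \<bar>g t p - f t p\<bar> < e2) \<longrightarrow> g \<in> T" using T f by blast
      have "g \<in> S \<inter> T" if g: "g \<in> cadlag_paths I"
        and c: "\<forall>t\<in>{0..max r1 r2}. \<forall>p\<in>I. \<bar>g t p - f t p\<bar> < min e1 e2" for g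
      proof
        have "\<forall>t\<in>{0..r1}. \<forall>p\<in>I. \<bar>g t p - f t p\<bar> < e1" using c by (simp add: le_max_iff_disj)
        then show "g \<in> S" using 1 g by blast
        have "\<forall>t\<in>{0..r2}. \<forall>p\<in>I. \<bar>g t p - f t p\<bar> < e2" using c by (simp add: le_max_iff_disj)
        then show "g \<in> T" using 2 g by blast
      qed
      moreover have "min e1 e2 > 0" using 1 2 by simp
      ultimately show "\<exists>r. \<exists>e>0. \<forall>g\<in>cadlag_paths I.
          (\<forall>t\<in>{0..r}. \<forall>p\<in>I. \<bar>g t p - f t p\<bar> < e) \<longrightarrow> g \<in> S \<inter> T" by blast
    qed
  next
    fix K assume K: "\<forall>S\<in>K. ?P S"
    show "\<Union>K \<subseteq> cadlag_paths I" using K by blast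
    show "\<forall>f\<in>\<Union>K. \<exists>r. \<exists>e>0. \<forall>g\<in>cadlag_paths I.
        (\<forall>t\<in>{0..r}. \<forall>p\<in>I. \<bar>g t p - f t p\<bar> < e) \<longrightarrow> g \<in> \<Union>K"
    proof
      fix f assume "f \<in> \<Union>K"
      then obtain S where S: "S \<in> K" "f \<in> S" by blast
      then obtain r e where "e > 0" "\<forall>g\<in>cadlag_paths I.
          (\<forall>t\<in>{0..r}. \<forall>p\<in>I. \<bar>g t p - f t p\<bar> < e) \<longrightarrow> g \<in> S" using K by blast
      with S show "\<exists>r. \<exists>e>0. \<forall>g\<in>cadlag_paths I.
          (\<forall>t\<in>{0..r}. \<forall>p\<in>I. \<bar>g t p - f t p\<bar> < e) \<longrightarrow> g \<in> \<Union>K" by blast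
    qed
  qed
  then show ?thesis
    unfolding cadlag_topology_def by (simp add: topology_inverse')
qed

lemma topspace_cadlag_topology: "topspace (cadlag_topology I) = cadlag_paths I"
proof (rule antisym)
  show "topspace (cadlag_topology I) \<subseteq> cadlag_paths I"
    using openin_topspace[of "cadlag_topology I"] unfolding openin_cadlag_topology by (rule conjunct1)
  have "openin (cadlag_topology I) (cadlag_paths I)"
    unfolding openin_cadlag_topology using zero_less_one by blast
  then show "cadlag_paths I \<subseteq> topspace (cadlag_topology I)" by (rule openin_subset)
qed

text \<open>Laws of cadlag processes live on the \<open>\<sigma>\<close>-algebra generated by the coordinate maps. (The
  uniform topology is not separable, so its Borel \<open>\<sigma>\<close>-algebra is strictly larger.)\<close>

definition cadlag_space :: "'i set \<Rightarrow> (real \<Rightarrow> 'i \<Rightarrow> real) measure" where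
  "cadlag_space I = restrict_space (\<Pi>\<^sub>M t\<in>{0..}. \<Pi>\<^sub>M p\<in>I. borel) (cadlag_paths I)"

definition path_law ::
  "'w measure \<Rightarrow> 'i set \<Rightarrow> ('i \<Rightarrow> real \<Rightarrow> 'w \<Rightarrow> real) \<Rightarrow> (real \<Rightarrow> 'i \<Rightarrow> real) measure" where
  "path_law M I Z = distr M (cadlag_space I) (\<lambda>\<omega>. \<lambda>t\<in>{0..}. \<lambda>p\<in>I. Z p t \<omega>)"

text \<open>Weak convergence with respect to a topology \<open>T\<close>. Test functions are required to be
  measurable as well, because the \<open>\<sigma>\<close>-algebra may be smaller than the Borel \<open>\<sigma>\<close>-algebra of
  \<open>T\<close>.\<close>

definition weak_convergence ::
  "'x topology \<Rightarrow> (nat \<Rightarrow> 'x measure) \<Rightarrow> 'x measure \<Rightarrow> bool" where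
  "weak_convergence T \<mu> \<nu> \<longleftrightarrow>
     (\<forall>F. continuous_map T euclideanreal F \<and> F \<in> borel_measurable \<nu> \<and>
          (\<exists>c. \<forall>x\<in>topspace T. \<bar>F x\<bar> \<le> c) \<longrightarrow>
        (\<lambda>n. \<integral>x. F x \<partial>\<mu> n) \<longlonglongrightarrow> (\<integral>x. F x \<partial>\<nu>))"


section \<open>Simple random walks\<close>

text \<open>Steps are \<open>1\<close> with probability \<open>p\<close> and \<open>d\<close> otherwise. Both usual conventions are of
  interest: \<open>d = - 1\<close>, and \<open>d = 0\<close> (the one occurring in the shuffling algorithm).\<close>

definition simple_random_walk ::
  "'w measure \<Rightarrow> int \<Rightarrow> real \<Rightarrow> (nat \<Rightarrow> 'w \<Rightarrow> int) \<Rightarrow> bool" where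
  "simple_random_walk M d p S \<longleftrightarrow>
     prob_space.indep_vars M (\<lambda>_. count_space UNIV)
       (\<lambda>t \<omega>. case t of 0 \<Rightarrow> S 0 \<omega> | Suc m \<Rightarrow> S (Suc m) \<omega> - S m \<omega>) UNIV \<and>
     (\<forall>m. distr M (count_space UNIV) (\<lambda>\<omega>. S (Suc m) \<omega> - S m \<omega>) =
        measure_pmf (map_pmf (\<lambda>h. if h then 1 else d) (bernoulli_pmf p)))"

definition independent_simple_random_walks ::
  "'w measure \<Rightarrow> int \<Rightarrow> real \<Rightarrow> 'i set \<Rightarrow> ('i \<Rightarrow> nat \<Rightarrow> 'w \<Rightarrow> int) \<Rightarrow> bool" where
  "independent_simple_random_walks M d p I X \<longleftrightarrow>
     (\<forall>q\<in>I. simple_random_walk M d p (X q)) \<and>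
     prob_space.indep_vars M (\<lambda>_. \<Pi>\<^sub>M t\<in>UNIV. count_space UNIV) (\<lambda>q \<omega> t. X q t \<omega>) I"


text \<open>The library's \<open>indep_var\<close> needs both random variables to have the same type.\<close>

definition independent_rvs ::
  "'w measure \<Rightarrow> 'x measure \<Rightarrow> ('w \<Rightarrow> 'x) \<Rightarrow> 'y measure \<Rightarrow> ('w \<Rightarrow> 'y) \<Rightarrow> bool" where
  "independent_rvs M S f T g \<longleftrightarrow> f \<in> measurable M S \<and> g \<in> measurable M T \<and>
     prob_space.indep_set M {f -` A \<inter> space M | A. A \<in> sets S} {g -` A \<inter> space M | A. A \<in> sets T}"


section \<open>Brownian motion\<close>

definition standard_brownian_motion :: "'w measure \<Rightarrow> (real \<Rightarrow> 'w \<Rightarrow> real) \<Rightarrow> bool" where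
  "standard_brownian_motion M B \<longleftrightarrow>
     (\<forall>t\<ge>0. B t \<in> borel_measurable M) \<and>
     (\<forall>\<omega>\<in>space M. continuous_on {0..} (\<lambda>t. B t \<omega>)) \<and>
     (AE \<omega> in M. B 0 \<omega> = 0) \<and>
     (\<forall>s t. 0 \<le> s \<and> s < t \<longrightarrow>
        distributed M lborel (\<lambda>\<omega>. B t \<omega> - B s \<omega>) (normal_density 0 (sqrt (t - s)))) \<and>
     (\<forall>m (\<tau>::nat \<Rightarrow> real). 0 \<le> \<tau> 0 \<and> mono \<tau> \<longrightarrow>
        prob_space.indep_vars M (\<lambda>_. borel) (\<lambda>k \<omega>. B (\<tau> (Suc k)) \<omega> - B (\<tau> k) \<omega>) {..<m})"

definition multidim_brownian_motion ::
  "'w measure \<Rightarrow> 'i set \<Rightarrow> ('i \<Rightarrow> real \<Rightarrow> 'w \<Rightarrow> real) \<Rightarrow> bool" where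
  "multidim_brownian_motion M I B \<longleftrightarrow>
     (\<forall>p\<in>I. standard_brownian_motion M (B p)) \<and>
     prob_space.indep_vars M (\<lambda>_. \<Pi>\<^sub>M t\<in>{0..}. borel) (\<lambda>p \<omega>. \<lambda>t\<in>{0..}. B p t \<omega>) I"


section \<open>Reflected interlacing Brownian motions\<close>

text \<open>Skorokhod reflection of the continuous path \<open>b\<close> in the time-dependent interval
  \<open>[l t, u t]\<close>, in the extended sense of Burdzy, Kang and Ramanan: the regulator \<open>w - b\<close> is
  nondecreasing as long as \<open>w\<close> avoids the upper barrier and nonincreasing as long as it avoids
  the lower one. The regulator is not required to have bounded variation, so that
  barriers may meet, as they do here at time \<open>0\<close>. For continuous paths the jump conditions of
  the extended Skorokhod problem are vacuous; the starting point \<open>w 0\<close> is prescribed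
  separately.\<close>

definition reflected_path ::
  "(real \<Rightarrow> real) \<Rightarrow> (real \<Rightarrow> ereal) \<Rightarrow> (real \<Rightarrow> ereal) \<Rightarrow> (real \<Rightarrow> real) \<Rightarrow> bool" where
  "reflected_path b l u w \<longleftrightarrow>
     continuous_on {0..} w \<and>
     (\<forall>t\<ge>0. l t \<le> ereal (w t) \<and> ereal (w t) \<le> u t) \<and>
     (\<forall>s t. 0 \<le> s \<and> s \<le> t \<and> (\<forall>r\<in>{s<..t}. ereal (w r) < u r) \<longrightarrow> w s - b s \<le> w t - b t) \<and>
     (\<forall>s t. 0 \<le> s \<and> s \<le> t \<and> (\<forall>r\<in>{s<..t}. l r < ereal (w r)) \<longrightarrow> w t - b t \<le> w s - b s)"

text \<open>An absent barrier is infinite; in particular the case \<open>i = k = 1\<close> says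
  \<open>W_1^1 (t) = W_1^1 (0) + B_1^1 (t)\<close>.\<close>

definition warren_process ::
  "'w measure \<Rightarrow> nat \<Rightarrow> (nat \<times> nat \<Rightarrow> real \<Rightarrow> 'w \<Rightarrow> real) \<Rightarrow> bool" where
  "warren_process M N W \<longleftrightarrow>
     (\<forall>p\<in>tri N. \<forall>t\<ge>0. W p t \<in> borel_measurable M) \<and>
     (\<forall>p\<in>tri N. \<forall>\<omega>\<in>space M. continuous_on {0..} (\<lambda>t. W p t \<omega>)) \<and>
     (AE \<omega> in M. \<forall>t\<ge>0. (\<lambda>p. W p t \<omega>) \<in> GTc N) \<and>
     (\<exists>B. multidim_brownian_motion M (tri N) B \<and>
        (AE \<omega> in M. \<forall>k\<in>{1..N}. \<forall>i\<in>{1..k}.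
           reflected_path (\<lambda>t. B (i, k) t \<omega>)
             (\<lambda>t. if i > 1 then ereal (W (i - 1, k - 1) t \<omega>) else - \<infinity>)
             (\<lambda>t. if i < k then ereal (W (i, k - 1) t \<omega>) else \<infinity>)
             (\<lambda>t. W (i, k) t \<omega>)))"

definition started_from_zero ::
  "'w measure \<Rightarrow> nat \<Rightarrow> (nat \<times> nat \<Rightarrow> real \<Rightarrow> 'w \<Rightarrow> real) \<Rightarrow> bool" where
  "started_from_zero M N W \<longleftrightarrow> (AE \<omega> in M. \<forall>p\<in>tri N. W p 0 \<omega> = 0)"

end

theory Submission
  imports Defs
begin

text \<open>Off its barriers a particle moves with its driver, and up to a distance \<open>1 / b n\<close> a barrier acts
  on it in one direction only: the rescaled dynamics solve the extended Skorokhod problem approximately.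
  Two approximate solutions stay close if their drivers do: while their difference exceeds the difference
  of the barriers, the upper path is off its lower barrier and the lower path is off its upper barrier,
  so that both regulators diminish the difference. Hence the rescaled dynamics and \<open>W\<close> are both
  close to one discretized reflection (a continuous function of finitely many increments of the driver),
  with an error given by the oscillation of the driver on the grid. This function passes to the limit by
  the convergence of the driving walks, and the law of its limit is determined by that of
  Brownian increments. It suffices to test with Lipschitz functionals because the limit has
  continuous paths.\<close>

section \<open>Stability of approximately reflected paths\<close>

text \<open>The barriers of a particle meet, all of them at time 0, so a regulator need not have
  bounded variation; only the direction in which it acts is ever used. Uniqueness in law of
  \<open>W\<close> is not presupposed: \<open>W\<close> brings its own Brownian motion, on a space
  unrelated to those of the walks and of \<open>B\<close>, and its law is pinned down by the
  comparison itself. Walks and Brownian motion are never coupled pathwise; only expectations are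
  compared. This works because the error bound \<open>osc\<close> is a bounded continuous functional
  of the driver, so its expectation also passes to the limit. The order of limits matters:
  \<open>n\<close> tends to infinity with the mesh \<open>1 / m\<close> fixed, where constants may
  grow with \<open>m\<close>, and the mesh is refined afterwards. The centring is the same for
  drivers and particles and cancels everywhere except in the size of jumps. The initial value of a
  driver cancels as well, since only its increments enter the discretization, which always starts
  from 0.\<close>

lemma finite_tri: "finite (tri N)"
  by (rule finite_subset[of _ "{..N} \<times> {..N}"]) (auto simp: tri_def)

text \<open>The bound holds because \<open>D\<close> is at most \<open>K + J\<close> at the last time before \<open>t\<close> at which it leaves
  \<open>{..K}\<close>.\<close>

lemma excursion_bound:
  fixes D :: "real \<Rightarrow> real"
  assumes "D 0 \<le> K" "0 \<le> J"
    and incr: "\<And>s t. 0 \<le> s \<Longrightarrow> s \<le> t \<Longrightarrow> t \<le> T \<Longrightarrow> (\<forall>r\<in>{s<..t}. K < D r) \<Longrightarrow> D t \<le> D s + c"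
    and jump: "\<And>t. 0 < t \<Longrightarrow> t \<le> T \<Longrightarrow> \<forall>\<^sub>F s in at_left t. D t \<le> D s + J"
    and "0 \<le> t" "t \<le> T"
  shows "D t \<le> K + J + c"
proof -
  define S where "S = {r\<in>{0..t}. D r \<le> K}"
  have S: "0 \<in> S" "bdd_above S" "S \<noteq> {}" using assms by (auto simp: S_def intro!: bdd_aboveI[of _ t])
  define s where "s = Sup S"
  have s: "0 \<le> s" "s \<le> t" unfolding s_def using S cSup_upper[OF S(1,2)]
    by (auto intro!: cSup_least simp: S_def)
  have above: "K < D r" if "s < r" "r \<le> t" for r
  proof (rule ccontr)
    assume "\<not> K < D r"
    with that s have "r \<in> S" by (auto simp: S_def)
    then have "r \<le> s" unfolding s_def by (rule cSup_upper) fact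
    with that show False by simp
  qed
  then have t: "D t \<le> D s + c" using s \<open>t \<le> T\<close> by (intro incr) auto
  \<comment> \<open>If \<open>D\<close> jumps at \<open>s\<close>, the supremum may lie outside
    \<open>S\<close>; it is then a limit of points of \<open>S\<close> from the left, and
    \<open>J\<close> pays for the jump.\<close>
  have "D s \<le> K + J"
  proof (cases "s \<in> S")
    case True then show ?thesis using assms by (auto simp: S_def)
  next
    case False
    with S s have s0: "0 < s" by (cases "s = 0") auto
    have "\<forall>\<^sub>F r in at_left s. D s \<le> D r + J" using s0 s \<open>t \<le> T\<close> by (intro jump) auto
    then obtain b where b: "b < s" "\<And>r. b < r \<Longrightarrow> r < s \<Longrightarrow> D s \<le> D r + J"
      unfolding eventually_at_left_field by blast
    obtain r where r: "r \<in> S" "b < r" using b(1) less_cSup_iff[OF S(3,2)] by (auto simp: s_def)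
    have "r \<le> s" unfolding s_def by (rule cSup_upper) fact+
    with False r have "r < s" by (cases "r = s") auto
    then have "D s \<le> D r + J" using b r by blast
    then show ?thesis using r by (auto simp: S_def)
  qed
  with t show ?thesis by simp
qed

text \<open>Paths \<open>w\<close> reflected as in \<open>reflected_path\<close>, except that the regulator may act within distance
  \<open>\<eta>\<close> of a barrier and that \<open>w\<close> may have jumps of size at most \<open>\<delta>\<close>.\<close>

definition near_reflected ::
  "nat \<Rightarrow> real \<Rightarrow> real \<Rightarrow> real \<Rightarrow> (real \<Rightarrow> nat \<times> nat \<Rightarrow> real) \<Rightarrow> (real \<Rightarrow> nat \<times> nat \<Rightarrow> real) \<Rightarrow> bool"
where
  "near_reflected N T \<eta> \<delta> f w \<longleftrightarrow> (\<forall>k\<in>{1..N}. \<forall>i\<in>{1..k}.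
     (1 < i \<longrightarrow> (\<forall>t\<in>{0..T}. w t (i - 1, k - 1) \<le> w t (i, k))) \<and>
     (i < k \<longrightarrow> (\<forall>t\<in>{0..T}. w t (i, k) \<le> w t (i, k - 1))) \<and>
     (\<forall>s t. 0 \<le> s \<and> s \<le> t \<and> t \<le> T \<and>
        (i < k \<longrightarrow> (\<forall>r\<in>{s<..t}. w r (i, k) + \<eta> < w r (i, k - 1))) \<longrightarrow>
        w s (i, k) - f s (i, k) \<le> w t (i, k) - f t (i, k)) \<and>
     (\<forall>s t. 0 \<le> s \<and> s \<le> t \<and> t \<le> T \<and>
        (1 < i \<longrightarrow> (\<forall>r\<in>{s<..t}. w r (i - 1, k - 1) + \<eta> < w r (i, k))) \<longrightarrow>
        w t (i, k) - f t (i, k) \<le> w s (i, k) - f s (i, k)) \<and>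
     (\<forall>t\<in>{0<..T}. \<forall>\<^sub>F s in at_left t. \<bar>w t (i, k) - w s (i, k)\<bar> \<le> \<delta>))"

lemma near_reflected_mono:
  assumes "near_reflected N T \<eta> \<delta> f w" "\<delta> \<le> \<delta>'"
  shows "near_reflected N T \<eta> \<delta>' f w"
proof -
  have "\<forall>\<^sub>F s in at_left t. \<bar>w t q - w s q\<bar> \<le> \<delta>'" if "\<forall>\<^sub>F s in at_left t. \<bar>w t q - w s q\<bar> \<le> \<delta>" for t q
    using that by (rule eventually_mono) (use assms(2) in simp)
  note jump = this
  show ?thesis
    unfolding near_reflected_def
  proof (intro ballI)
    fix k i assume "k \<in> {1..N}" "i \<in> {1..k}"
    from assms(1)[unfolded near_reflected_def, THEN bspec, OF this(1), THEN bspec, OF this(2)]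
    show "(1 < i \<longrightarrow> (\<forall>t\<in>{0..T}. w t (i - 1, k - 1) \<le> w t (i, k))) \<and>
     (i < k \<longrightarrow> (\<forall>t\<in>{0..T}. w t (i, k) \<le> w t (i, k - 1))) \<and>
     (\<forall>s t. 0 \<le> s \<and> s \<le> t \<and> t \<le> T \<and>
        (i < k \<longrightarrow> (\<forall>r\<in>{s<..t}. w r (i, k) + \<eta> < w r (i, k - 1))) \<longrightarrow>
        w s (i, k) - f s (i, k) \<le> w t (i, k) - f t (i, k)) \<and>
     (\<forall>s t. 0 \<le> s \<and> s \<le> t \<and> t \<le> T \<and>
        (1 < i \<longrightarrow> (\<forall>r\<in>{s<..t}. w r (i - 1, k - 1) + \<eta> < w r (i, k))) \<longrightarrow>
        w t (i, k) - f t (i, k) \<le> w s (i, k) - f s (i, k)) \<and>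
     (\<forall>t\<in>{0<..T}. \<forall>\<^sub>F s in at_left t. \<bar>w t (i, k) - w s (i, k)\<bar> \<le> \<delta>')"
      by (elim conjE, intro conjI) (assumption | intro ballI jump, drule bspec, assumption+)+
  qed
qed

text \<open>During an excursion of \<open>w - w'\<close> above \<open>e + \<eta>\<close>,
  \<open>w\<close> lies below its upper barrier, which is within \<open>e\<close> of that of
  \<open>w'\<close>; so \<open>w'\<close> is more than \<open>\<eta>\<close> below its upper barrier
  and its regulator cannot decrease. Dually the regulator of \<open>w\<close> cannot increase. The
  excursion thus adds only the driver errors at its two ends, \<open>2 * \<epsilon>\<close>, and
  \<open>2 * \<delta>\<close> pays for a jump of both paths at its start.\<close>

lemma near_reflected_diff_le:
  assumes w: "near_reflected N T \<eta> \<delta> f w" and w': "near_reflected N T \<eta> \<delta> f' w'"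
    and k: "k \<in> {1..N}" "i \<in> {1..k}"
    and f: "\<And>t. t \<in> {0..T} \<Longrightarrow> \<bar>f t (i, k) - f' t (i, k)\<bar> \<le> \<epsilon>"
    and init: "w 0 (i, k) - w' 0 (i, k) \<le> e"
    and lev: "\<And>t j. t \<in> {0..T} \<Longrightarrow> j \<in> {1..k - 1} \<Longrightarrow> \<bar>w t (j, k - 1) - w' t (j, k - 1)\<bar> \<le> e"
    and nn: "0 \<le> \<eta>" "0 \<le> \<delta>" "0 \<le> \<epsilon>" and t: "t \<in> {0..T}"
  shows "w t (i, k) - w' t (i, k) \<le> e + (\<eta> + 2 * \<delta> + 2 * \<epsilon>)"
proof -
  note W = w[unfolded near_reflected_def, rule_format, OF k]
  note W' = w'[unfolded near_reflected_def, rule_format, OF k]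
  define D where "D t = w t (i, k) - w' t (i, k)" for t
  have "D t \<le> (e + \<eta>) + 2 * \<delta> + 2 * \<epsilon>"
  proof (rule excursion_bound[where T = T and D = D])
    show "D 0 \<le> e + \<eta>" using init nn by (simp add: D_def)
    show "0 \<le> 2 * \<delta>" "0 \<le> t" "t \<le> T" using nn t by auto
  next
    fix s t assume st: "0 \<le> s" "s \<le> t" "t \<le> T" and D: "\<forall>r\<in>{s<..t}. e + \<eta> < D r"
    have up: "w' r (i, k) + \<eta> < w' r (i, k - 1)" if "i < k" "r \<in> {s<..t}" for r
    proof -
      have r: "r \<in> {0..T}" "i \<in> {1..k-1}" using that st k by auto
      from W r that have "w r (i, k) \<le> w r (i, k - 1)" by blast
      with lev[OF r] D[rule_format, OF that(2)] show ?thesis by (auto simp: D_def)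
    qed
    have lo: "w r (i - 1, k - 1) + \<eta> < w r (i, k)" if "1 < i" "r \<in> {s<..t}" for r
    proof -
      have r: "r \<in> {0..T}" "i - 1 \<in> {1..k-1}" using that st k by auto
      from W' r that have "w' r (i - 1, k - 1) \<le> w' r (i, k)" by blast
      with lev[OF r] D[rule_format, OF that(2)] show ?thesis by (auto simp: D_def)
    qed
    from W lo st have 1: "w t (i, k) - f t (i, k) \<le> w s (i, k) - f s (i, k)" by blast
    from W' up st have 2: "w' s (i, k) - f' s (i, k) \<le> w' t (i, k) - f' t (i, k)" by blast
    have "\<bar>f t (i, k) - f' t (i, k)\<bar> \<le> \<epsilon>" "\<bar>f s (i, k) - f' s (i, k)\<bar> \<le> \<epsilon>" using st by (auto intro!: f)
    with 1 2 show "D t \<le> D s + 2 * \<epsilon>" unfolding D_def by linarith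
  next
    fix t assume t: "0 < t" "t \<le> T"
    from W t have "\<forall>\<^sub>F s in at_left t. \<bar>w t (i, k) - w s (i, k)\<bar> \<le> \<delta>" by auto
    moreover from W' t have "\<forall>\<^sub>F s in at_left t. \<bar>w' t (i, k) - w' s (i, k)\<bar> \<le> \<delta>" by auto
    ultimately show "\<forall>\<^sub>F s in at_left t. D t \<le> D s + 2 * \<delta>"
      by eventually_elim (unfold D_def, linarith)
  qed
  then show ?thesis by (simp add: D_def)
qed

text \<open>The bound reached on one level is the barrier discrepancy of the next, so every level
  costs one more \<open>\<eta> + 2 * \<delta> + 2 * \<epsilon>\<close>. Exchanging the two paths
  gives the other sign.\<close>

lemma near_reflected_stability:
  assumes w: "near_reflected N T \<eta> \<delta> f w" and w': "near_reflected N T \<eta> \<delta> f' w'"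
    and f: "\<And>t q. t \<in> {0..T} \<Longrightarrow> q \<in> tri N \<Longrightarrow> \<bar>f t q - f' t q\<bar> \<le> \<epsilon>"
    and init: "\<And>q. q \<in> tri N \<Longrightarrow> \<bar>w 0 q - w' 0 q\<bar> \<le> e"
    and nn: "0 \<le> \<eta>" "0 \<le> \<delta>" "0 \<le> \<epsilon>"
  shows "k \<le> N \<Longrightarrow> t \<in> {0..T} \<Longrightarrow> i \<in> {1..k} \<Longrightarrow>
    \<bar>w t (i, k) - w' t (i, k)\<bar> \<le> e + real k * (\<eta> + 2 * \<delta> + 2 * \<epsilon>)"
proof (induction k arbitrary: t i)
  case 0 then show ?case by simp
next
  case (Suc k)
  let ?c = "\<eta> + 2 * \<delta> + 2 * \<epsilon>"
  have k: "Suc k \<in> {1..N}" and q: "(i, Suc k) \<in> tri N" using Suc.prems by (auto simp: tri_def)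
  have e: "\<bar>w 0 (i, Suc k) - w' 0 (i, Suc k)\<bar> \<le> e + real k * ?c"
    using init[OF q] nn by (smt (verit) mult_nonneg_nonneg of_nat_0_le_iff)
  have lev: "\<bar>w t (j, k) - w' t (j, k)\<bar> \<le> e + real k * ?c" if "t \<in> {0..T}" "j \<in> {1..k}" for t j
    using Suc.IH[of t j] that Suc.prems by auto
  have 1: "w t (i, Suc k) - w' t (i, Suc k) \<le> (e + real k * ?c) + ?c"
    using e lev f[OF _ q] nn Suc.prems by (intro near_reflected_diff_le[OF w w' k]) auto
  have 2: "w' t (i, Suc k) - w t (i, Suc k) \<le> (e + real k * ?c) + ?c"
    using e lev f[OF _ q] nn Suc.prems
    by (intro near_reflected_diff_le[OF w' w k]) (auto simp: abs_minus_commute)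
  from 1 2 show ?case by (simp add: algebra_simps)
qed

section \<open>Piecewise constant paths on a grid\<close>

text \<open>The index passes exactly the grid points in \<open>{s<..t}\<close>, which are the times
  about which the half-open conditions of \<open>near_reflected\<close> give information.\<close>

lemma step_mono:
  fixes c :: "nat \<Rightarrow> real"
  assumes n: "0 < n" and st: "0 \<le> s" "s \<le> t"
    and c: "\<And>j. s < real (Suc j) / real n \<Longrightarrow> real (Suc j) / real n \<le> t \<Longrightarrow> c j \<le> c (Suc j)"
  shows "c (nat \<lfloor>real n * s\<rfloor>) \<le> c (nat \<lfloor>real n * t\<rfloor>)"
proof -
  have le: "nat \<lfloor>real n * s\<rfloor> \<le> nat \<lfloor>real n * t\<rfloor>"
    using n st by (intro nat_mono floor_mono mult_left_mono) auto
  have step: "c j \<le> c (Suc j)" if "nat \<lfloor>real n * s\<rfloor> \<le> j" "j < nat \<lfloor>real n * t\<rfloor>" for j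
  proof (rule c)
    have "real n * s < real (Suc j)" using that(1) st n
      by linarith
    then show "s < real (Suc j) / real n" using n by (simp add: field_simps)
    have "real (Suc j) \<le> real n * t" using that(2) by linarith
    then show "real (Suc j) / real n \<le> t" using n by (simp add: field_simps)
  qed
  show ?thesis
    using le step by (induction rule: dec_induct) (auto intro: order_trans)
qed

lemma floor_grid: "0 < n \<Longrightarrow> nat \<lfloor>real n * (real j / real n)\<rfloor> = j" by simp

text \<open>On a stretch shorter than one cell at most one grid point is passed. That it lies at or
  before \<open>t\<close> keeps it inside the horizon on which increments are controlled.\<close>

lemma eventually_left_floor:
  assumes "0 < n" "0 < t"
  shows "\<forall>\<^sub>F s in at_left t. 0 \<le> s \<and> (nat \<lfloor>real n * s\<rfloor> = nat \<lfloor>real n * t\<rfloor> \<or>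
    Suc (nat \<lfloor>real n * s\<rfloor>) = nat \<lfloor>real n * t\<rfloor> \<and> real (Suc (nat \<lfloor>real n * s\<rfloor>)) / real n \<le> t)"
proof -
  have "\<forall>\<^sub>F s in at_left t. max 0 (t - 1 / real n) < s \<and> s < t"
    unfolding eventually_at_left_field using assms by (intro exI[of _ "max 0 (t - 1 / real n)"]) auto
  then show ?thesis
  proof eventually_elim
    case (elim s)
    then have a: "0 < s" "real n * t - 1 < real n * s" "real n * s < real n * t"
      using assms by (auto simp: field_simps)
    then have "nat \<lfloor>real n * s\<rfloor> = nat \<lfloor>real n * t\<rfloor> \<or> Suc (nat \<lfloor>real n * s\<rfloor>) = nat \<lfloor>real n * t\<rfloor>"
      using assms by (smt (verit, ccfv_SIG) Suc_nat_eq_nat_zadd1 floor_less_iff le_floor_iff mult_nonneg_nonneg of_int_1 of_int_add of_nat_0_le_iff floor_correct zero_le_floor)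
    moreover have "real (nat \<lfloor>real n * t\<rfloor>) / real n \<le> t"
      using assms by (simp add: field_simps) 
    ultimately show ?case using a by (metis less_imp_le)
  qed
qed

text \<open>Shared by the particle dynamics and the discretized reflection; \<open>c\<close> is the
  configuration and \<open>e\<close> the driver at grid times. The common \<open>\<alpha>\<close>
  cancels from regulators and from comparisons with barriers. It enters the jump bound alone, where
  its continuity is absorbed by the gap between \<open>\<delta>\<close> and
  \<open>\<delta>'\<close>. The conditions in \<open>incr\<close> and \<open>decr\<close> look at
  the configuration after the jump.\<close>

lemma near_reflected_step:
  fixes c e :: "nat \<Rightarrow> nat \<times> nat \<Rightarrow> real" and \<alpha> :: "real \<Rightarrow> real"
  assumes n: "0 < n" and \<alpha>: "continuous_on {0..} \<alpha>" and "\<delta> < \<delta>'"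
    and w: "\<And>t q. 0 \<le> t \<Longrightarrow> q \<in> tri N \<Longrightarrow> w t q = c (nat \<lfloor>real n * t\<rfloor>) q - \<alpha> t"
    and f: "\<And>t q. 0 \<le> t \<Longrightarrow> q \<in> tri N \<Longrightarrow> f t q = e (nat \<lfloor>real n * t\<rfloor>) q - \<alpha> t"
    and lo: "\<And>j i k. i \<in> {1..k} \<Longrightarrow> k \<le> N \<Longrightarrow> 1 < i \<Longrightarrow> c j (i - 1, k - 1) \<le> c j (i, k)"
    and up: "\<And>j i k. i \<in> {1..k} \<Longrightarrow> k \<le> N \<Longrightarrow> i < k \<Longrightarrow> c j (i, k) \<le> c j (i, k - 1)"
    and incr: "\<And>j i k. i \<in> {1..k} \<Longrightarrow> k \<le> N \<Longrightarrow> real (Suc j) / real n \<le> T \<Longrightarrow>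
        (i < k \<Longrightarrow> c (Suc j) (i, k) + \<eta> < c (Suc j) (i, k - 1)) \<Longrightarrow>
        e (Suc j) (i, k) - e j (i, k) \<le> c (Suc j) (i, k) - c j (i, k)"
    and decr: "\<And>j i k. i \<in> {1..k} \<Longrightarrow> k \<le> N \<Longrightarrow> real (Suc j) / real n \<le> T \<Longrightarrow>
        (1 < i \<Longrightarrow> c (Suc j) (i - 1, k - 1) + \<eta> < c (Suc j) (i, k)) \<Longrightarrow>
        c (Suc j) (i, k) - c j (i, k) \<le> e (Suc j) (i, k) - e j (i, k)"
    and jump: "\<And>j i k. i \<in> {1..k} \<Longrightarrow> k \<le> N \<Longrightarrow> real (Suc j) / real n \<le> T \<Longrightarrow>
        \<bar>c (Suc j) (i, k) - c j (i, k)\<bar> \<le> \<delta>"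
    and "0 \<le> \<delta>"
  shows "near_reflected N T \<eta> \<delta>' f w"
  unfolding near_reflected_def
proof (intro ballI conjI impI allI)
  fix k i assume k: "k \<in> {1..N}" "i \<in> {1..k}"
  then have q: "(i, k) \<in> tri N" by (auto simp: tri_def)
  have ql: "1 < i \<Longrightarrow> (i - 1, k - 1) \<in> tri N" using k by (auto simp: tri_def)
  have qu: "i < k \<Longrightarrow> (i, k - 1) \<in> tri N" using k by (auto simp: tri_def)
  show "w t (i - 1, k - 1) \<le> w t (i, k)" if "1 < i" "t \<in> {0..T}" for t
    using lo[of i k] k that w[OF _ q] w[OF _ ql] by auto
  show "w t (i, k) \<le> w t (i, k - 1)" if "i < k" "t \<in> {0..T}" for t
    using up[of i k] k that w[OF _ q] w[OF _ qu] by auto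
  have grid: "0 \<le> real (Suc j) / real n" "nat \<lfloor>real n * (real (Suc j) / real n)\<rfloor> = Suc j" for j
    using floor_grid[OF n, of "Suc j"] by auto
  show "w s (i, k) - f s (i, k) \<le> w t (i, k) - f t (i, k)"
    if st: "0 \<le> s \<and> s \<le> t \<and> t \<le> T \<and> (i < k \<longrightarrow> (\<forall>r\<in>{s<..t}. w r (i, k) + \<eta> < w r (i, k - 1)))" for s t
  proof -
    have "c (nat \<lfloor>real n * s\<rfloor>) (i, k) - e (nat \<lfloor>real n * s\<rfloor>) (i, k)
        \<le> c (nat \<lfloor>real n * t\<rfloor>) (i, k) - e (nat \<lfloor>real n * t\<rfloor>) (i, k)"
    proof (rule step_mono[OF n])
      fix j assume j: "s < real (Suc j) / real n" "real (Suc j) / real n \<le> t"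
      have "e (Suc j) (i, k) - e j (i, k) \<le> c (Suc j) (i, k) - c j (i, k)"
      proof (rule incr)
        assume "i < k"
        with st j have "w (real (Suc j) / real n) (i, k) + \<eta> < w (real (Suc j) / real n) (i, k - 1)"
          by auto
        then show "c (Suc j) (i, k) + \<eta> < c (Suc j) (i, k - 1)"
          using w[OF grid(1) q] w[OF grid(1) qu[OF \<open>i < k\<close>]] grid(2) by simp
      qed (use j st k in auto)
      then show "c j (i, k) - e j (i, k) \<le> c (Suc j) (i, k) - e (Suc j) (i, k)" by simp
    qed (use st in auto)
    then show ?thesis using w[OF _ q] f[OF _ q] st by simp
  qed
  show "w t (i, k) - f t (i, k) \<le> w s (i, k) - f s (i, k)"
    if st: "0 \<le> s \<and> s \<le> t \<and> t \<le> T \<and> (1 < i \<longrightarrow> (\<forall>r\<in>{s<..t}. w r (i - 1, k - 1) + \<eta> < w r (i, k)))" for s t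
  proof -
    have "e (nat \<lfloor>real n * s\<rfloor>) (i, k) - c (nat \<lfloor>real n * s\<rfloor>) (i, k)
        \<le> e (nat \<lfloor>real n * t\<rfloor>) (i, k) - c (nat \<lfloor>real n * t\<rfloor>) (i, k)"
    proof (rule step_mono[OF n])
      fix j assume j: "s < real (Suc j) / real n" "real (Suc j) / real n \<le> t"
      have "c (Suc j) (i, k) - c j (i, k) \<le> e (Suc j) (i, k) - e j (i, k)"
      proof (rule decr)
        assume "1 < i"
        with st j have "w (real (Suc j) / real n) (i - 1, k - 1) + \<eta> < w (real (Suc j) / real n) (i, k)"
          by auto
        then show "c (Suc j) (i - 1, k - 1) + \<eta> < c (Suc j) (i, k)"
          using w[OF grid(1) q] w[OF grid(1) ql[OF \<open>1 < i\<close>]] grid(2) by simp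
      qed (use j st k in auto)
      then show "e j (i, k) - c j (i, k) \<le> e (Suc j) (i, k) - c (Suc j) (i, k)" by simp
    qed (use st in auto)
    then show ?thesis using w[OF _ q] f[OF _ q] st by simp
  qed
  show "\<forall>\<^sub>F s in at_left t. \<bar>w t (i, k) - w s (i, k)\<bar> \<le> \<delta>'" if t: "t \<in> {0<..T}" for t
  proof -
    have "continuous (at t) \<alpha>"
      using \<alpha> t by (intro continuous_on_interior[of "{0..}"]) (auto simp: interior_real_atLeast)
    then have "(\<alpha> \<longlongrightarrow> \<alpha> t) (at_left t)"
      using continuous_at_imp_continuous_at_within continuous_within by blast
    then have "\<forall>\<^sub>F s in at_left t. dist (\<alpha> s) (\<alpha> t) < \<delta>' - \<delta>"
      using \<open>\<delta> < \<delta>'\<close> by (intro tendstoD) auto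
    with eventually_left_floor[OF n, of t] t
    have "\<forall>\<^sub>F s in at_left t. dist (\<alpha> s) (\<alpha> t) < \<delta>' - \<delta> \<and> 0 \<le> s \<and> (nat \<lfloor>real n * s\<rfloor> = nat \<lfloor>real n * t\<rfloor> \<or>
      Suc (nat \<lfloor>real n * s\<rfloor>) = nat \<lfloor>real n * t\<rfloor> \<and> real (Suc (nat \<lfloor>real n * s\<rfloor>)) / real n \<le> t)"
      by (auto elim: eventually_elim2)
    then show ?thesis
    proof eventually_elim
      case (elim s)
      let ?j = "nat \<lfloor>real n * s\<rfloor>"
      have "\<bar>c (nat \<lfloor>real n * t\<rfloor>) (i, k) - c ?j (i, k)\<bar> \<le> \<delta>"
        using elim jump[of i k ?j] k t \<open>0 \<le> \<delta>\<close> by fastforce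
      moreover have "w t (i, k) = c (nat \<lfloor>real n * t\<rfloor>) (i, k) - \<alpha> t" "w s (i, k) = c ?j (i, k) - \<alpha> s"
        using elim w[OF _ q] t by auto
      moreover have "\<bar>\<alpha> s - \<alpha> t\<bar> < \<delta>' - \<delta>" using elim by (simp add: dist_real_def)
      ultimately show ?case by linarith
    qed
  qed
qed

text \<open>Time-discretized reflection: first add the increment of the driver, then project onto the
  interval between the already updated neighbours on the level below.\<close>

fun clip :: "(nat \<Rightarrow> nat \<times> nat \<Rightarrow> real) \<Rightarrow> nat \<Rightarrow> nat \<Rightarrow> nat \<Rightarrow> real" where
  "clip D k 0 i = 0"
| "clip D 0 (Suc j) i = 0"
| "clip D (Suc k) (Suc j) i =
     (let y = min (if i < Suc k then clip D k (Suc j) i else clip D (Suc k) j i + D j (i, Suc k))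
         (clip D (Suc k) j i + D j (i, Suc k))
      in if 1 < i then max (clip D k (Suc j) (i - 1)) y else y)"

text \<open>The outer \<open>max\<close> preserves the upper bound only if the lower barrier does
  not exceed the upper one. Both barriers lie on the level below, where they are ordered because an
  entry one level further down separates them; hence the induction on the level at a fixed
  time.\<close>

lemma clip_bounds:
  "i \<in> {1..Suc k} \<Longrightarrow> (1 < i \<longrightarrow> clip D k j (i - 1) \<le> clip D (Suc k) j i) \<and>
     (i < Suc k \<longrightarrow> clip D (Suc k) j i \<le> clip D k j i)"
proof (induction k arbitrary: i j)
  case 0 then show ?case by auto
next
  case (Suc k)
  show ?case
  proof (cases j)
    case 0 then show ?thesis by simp
  next
    case (Suc j')
    have "clip D (Suc k) j (i - 1) \<le> clip D (Suc k) j i" if "1 < i" "i < Suc (Suc k)"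
    proof -
      have i: "i - 1 \<in> {1..Suc k}" using that by auto
      have "clip D (Suc k) j (i - 1) \<le> clip D k j (i - 1)"
        using Suc.IH[OF i, of j] that by simp
      also have "\<dots> \<le> clip D (Suc k) j i" using Suc.IH[of i j] that by auto
      finally show ?thesis .
    qed
    then show ?thesis unfolding Suc clip.simps(3)[of D "Suc k" j' i] Let_def
      by (auto simp del: clip.simps)
  qed
qed

text \<open>The old position lies between the old barriers by \<open>clip_bounds\<close>, and these
  move by at most \<open>\<delta>\<close> by induction. So projecting a free value that is within
  \<open>\<delta>\<close> of the old position leaves it within \<open>\<delta>\<close>.\<close>

lemma clip_incr_le:
  assumes "\<And>i k. i \<in> {1..k} \<Longrightarrow> k \<le> N \<Longrightarrow> \<bar>D j (i, k)\<bar> \<le> \<delta>"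
  shows "k \<le> N \<Longrightarrow> i \<in> {1..k} \<Longrightarrow> \<bar>clip D k (Suc j) i - clip D k j i\<bar> \<le> \<delta>"
proof (induction k arbitrary: i)
  case 0 then show ?case by simp
next
  case (Suc k)
  have D: "\<bar>D j (i, Suc k)\<bar> \<le> \<delta>" using assms Suc.prems by auto
  have l: "\<bar>clip D k (Suc j) (i - 1) - clip D k j (i - 1)\<bar> \<le> \<delta>" if "1 < i"
  proof -
    have "i - 1 \<in> {1..k}" using that Suc.prems by auto
    then show ?thesis using Suc.IH Suc.prems by auto
  qed
  have u: "\<bar>clip D k (Suc j) i - clip D k j i\<bar> \<le> \<delta>" if "i < Suc k"
    using Suc.IH[of i] Suc.prems that by auto
  have "\<bar>min b (w + x) - w\<bar> \<le> \<delta>" "\<bar>max a (min b (w + x)) - w\<bar> \<le> \<delta>"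
    if "\<bar>x\<bar> \<le> \<delta>" "a \<le> w + \<delta>" "w - \<delta> \<le> b" for a b w x :: real
    using that by (auto simp: max_def min_def)
  note * = this[OF D, of "if 1 < i then clip D k (Suc j) (i - 1) else clip D (Suc k) j i" "clip D (Suc k) j i"
      "if i < Suc k then clip D k (Suc j) i else clip D (Suc k) j i + D j (i, Suc k)"]
  show ?case unfolding clip.simps Let_def
    using D * l u clip_bounds[of i k D j] Suc.prems by (auto simp: abs_le_iff)
qed

text \<open>A result strictly below the upper barrier shows that the \<open>min\<close> has not
  acted, and the \<open>max\<close> can only raise the free value. Dually, a result strictly above
  the lower barrier shows that the \<open>max\<close> has not acted.\<close>

lemma clip_regulator:
  assumes "0 < k"
  shows "(i < k \<Longrightarrow> clip D k (Suc j) i < clip D (k - 1) (Suc j) i) \<Longrightarrow>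
      D j (i, k) \<le> clip D k (Suc j) i - clip D k j i"
    and "(1 < i \<Longrightarrow> clip D (k - 1) (Suc j) (i - 1) < clip D k (Suc j) i) \<Longrightarrow>
      clip D k (Suc j) i - clip D k j i \<le> D j (i, k)"
proof -
  obtain k' where k: "k = Suc k'" using assms by (cases k) auto
  define v where "v = clip D k j i + D j (i, k)"
  \<comment> \<open>An absent barrier gets the value that makes its operation idle:
    \<open>b = v\<close> for the \<open>min\<close>, \<open>a = min b v\<close> for the
    \<open>max\<close>.\<close>
  define b where "b = (if i < k then clip D k' (Suc j) i else v)"
  define a where "a = (if 1 < i then clip D k' (Suc j) (i - 1) else min b v)"
  have c: "clip D k (Suc j) i = max a (min b v)" unfolding a_def b_def v_def k by (simp add: Let_def)
  have 1: "max a (min b v) < b \<or> b = v \<Longrightarrow> v \<le> max a (min b v)"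
    and 2: "a < max a (min b v) \<or> a = min b v \<Longrightarrow> max a (min b v) \<le> v"
    by (auto simp: max_def min_def split: if_splits)
  show "D j (i, k) \<le> clip D k (Suc j) i - clip D k j i"
    if "i < k \<Longrightarrow> clip D k (Suc j) i < clip D (k - 1) (Suc j) i"
  proof -
    have "clip D k (Suc j) i < b \<or> b = v" using that by (auto simp: b_def k simp del: clip.simps)
    from 1[OF this[unfolded c]] show ?thesis unfolding c v_def by linarith
  qed
  show "clip D k (Suc j) i - clip D k j i \<le> D j (i, k)"
    if "1 < i \<Longrightarrow> clip D (k - 1) (Suc j) (i - 1) < clip D k (Suc j) i"
  proof -
    have "a < clip D k (Suc j) i \<or> a = min b v" using that by (auto simp: a_def k simp del: clip.simps)
    from 2[OF this[unfolded c]] show ?thesis unfolding c v_def by linarith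
  qed
qed

text \<open>\<open>min\<close> and \<open>max\<close> are nonexpansive for the maximum norm, so
  passing to a higher level within one time step costs nothing, and the bound grows only with the
  number of steps. This growth is harmless, as it serves continuity at a fixed mesh.\<close>

lemma clip_Lipschitz:
  assumes "\<And>j i k. j < J \<Longrightarrow> i \<in> {1..k} \<Longrightarrow> k \<le> N \<Longrightarrow> \<bar>D j (i, k) - D' j (i, k)\<bar> \<le> \<delta>" "0 \<le> \<delta>"
  shows "j \<le> J \<Longrightarrow> k \<le> N \<Longrightarrow> i \<in> {1..k} \<Longrightarrow> \<bar>clip D k j i - clip D' k j i\<bar> \<le> real j * \<delta>"
proof (induction j arbitrary: k i)
  case (Suc j)
  have IH: "\<bar>clip D k j i - clip D' k j i\<bar> \<le> real j * \<delta>" if "k \<le> N" "i \<in> {1..k}" for k i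
    using Suc.IH Suc.prems(1) that by simp
  have D: "\<bar>D j (i, k) - D' j (i, k)\<bar> \<le> \<delta>" if "k \<le> N" "i \<in> {1..k}" for k i
    using assms(1) Suc.prems(1) that by simp
  show ?case using Suc.prems(2,3)
  proof (induction k arbitrary: i)
    case (Suc k)
    have v: "\<bar>(clip D (Suc k) j i + D j (i, Suc k)) - (clip D' (Suc k) j i + D' j (i, Suc k))\<bar>
        \<le> real (Suc j) * \<delta>"
      using IH[OF Suc.prems] D[OF Suc.prems] by (simp add: algebra_simps abs_le_iff)
    have l: "\<bar>clip D k (Suc j) (i - 1) - clip D' k (Suc j) (i - 1)\<bar> \<le> real (Suc j) * \<delta>" if "1 < i"
      using Suc.prems that by (intro Suc.IH) auto
    have u: "\<bar>clip D k (Suc j) i - clip D' k (Suc j) i\<bar> \<le> real (Suc j) * \<delta>" if "i < Suc k"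
      using Suc.prems that by (intro Suc.IH) auto
    have nonexp: "\<bar>(let y = min b c in if P then max a y else y) - (let y = min b' c' in if P then max a' y else y)\<bar> \<le> e"
      if "P \<Longrightarrow> \<bar>a - a'\<bar> \<le> e" "\<bar>b - b'\<bar> \<le> e" "\<bar>c - c'\<bar> \<le> e" for P and a b c a' b' c' e :: real
      using that by (auto simp: max_def min_def)
    show ?case unfolding clip.simps
      using l u v by (intro nonexp) auto
  qed simp
qed auto

text \<open>\<open>D j\<close> is the increment of the driver over the \<open>j\<close>-th cell of the grid of mesh \<open>1/m\<close>. Increments from
  \<open>J\<close> on are dropped, so that the path is a function of finitely many of them.\<close>

definition clip_path ::
  "nat \<Rightarrow> nat \<Rightarrow> nat \<Rightarrow> (nat \<Rightarrow> nat \<times> nat \<Rightarrow> real) \<Rightarrow> real \<Rightarrow> nat \<times> nat \<Rightarrow> real" where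
  "clip_path N m J D = (\<lambda>t\<in>{0..}. \<lambda>(i, k)\<in>tri N.
     clip (\<lambda>j q. if j < J then D j q else 0) k (nat \<lfloor>real m * t\<rfloor>) i)"

definition grid_incr :: "nat \<Rightarrow> (real \<Rightarrow> 'i \<Rightarrow> real) \<Rightarrow> nat \<Rightarrow> 'i \<Rightarrow> real" where
  "grid_incr m f j q = f (real (Suc j) / real m) q - f (real j / real m) q"

text \<open>The discretized path is driven by \<open>f\<close> sampled at the left ends of the
  cells, and by \<open>clip_regulator\<close> it obeys the clauses for every tolerance. The free
  \<open>\<eta>\<close> lets it be compared with a path that has a positive one. By the choice of
  \<open>J\<close> no dropped increment is met before time \<open>T\<close>.\<close>

lemma near_reflected_clip_path:
  assumes m: "0 < m" and T: "T * real m \<le> real J" and \<delta>: "0 \<le> \<delta>" "\<delta> < \<delta>'" and "0 \<le> \<eta>"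
    and D: "\<And>j q. j < J \<Longrightarrow> q \<in> tri N \<Longrightarrow> \<bar>grid_incr m f j q\<bar> \<le> \<delta>"
  shows "near_reflected N T \<eta> \<delta>' (\<lambda>t. f (real (nat \<lfloor>real m * t\<rfloor>) / real m))
    (clip_path N m J (grid_incr m f))"
proof -
  define E where "E = (\<lambda>j q. if j < J then grid_incr m f j q else 0)"
  have J: "j < J" if "real (Suc j) / real m \<le> T" for j
  proof -
    have "real (Suc j) \<le> T * real m" using that m by (simp add: field_simps)
    with T show ?thesis by linarith
  qed
  have bnd: "i \<in> {1..k} \<Longrightarrow> (1 < i \<longrightarrow> clip E (k - 1) j (i - 1) \<le> clip E k j i) \<and>
     (i < k \<longrightarrow> clip E k j i \<le> clip E (k - 1) j i)" for i k j
    using clip_bounds[of i "k - 1" E j] by auto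
  show ?thesis
  proof (rule near_reflected_step[where n = m and \<alpha> = "\<lambda>_. 0" and \<delta> = \<delta> and
        c = "\<lambda>j q. clip E (snd q) j (fst q)" and e = "\<lambda>j. f (real j / real m)"], unfold fst_conv snd_conv)
    fix j i k assume ik: "i \<in> {1..k}" "k \<le> N" and j: "real (Suc j) / real m \<le> T"
    have k0: "0 < k" using ik by simp
    have E: "E j (i, k) = f (real (Suc j) / real m) (i, k) - f (real j / real m) (i, k)"
      using J[OF j] by (simp add: E_def grid_incr_def)
    show "f (real (Suc j) / real m) (i, k) - f (real j / real m) (i, k) \<le> clip E k (Suc j) i - clip E k j i"
      if "i < k \<Longrightarrow> clip E k (Suc j) i + \<eta> < clip E (k - 1) (Suc j) i"
      unfolding E[symmetric] by (rule clip_regulator(1)[OF k0]) (use that \<open>0 \<le> \<eta>\<close> in fastforce)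
    show "clip E k (Suc j) i - clip E k j i \<le> f (real (Suc j) / real m) (i, k) - f (real j / real m) (i, k)"
      if "1 < i \<Longrightarrow> clip E (k - 1) (Suc j) (i - 1) + \<eta> < clip E k (Suc j) i"
      unfolding E[symmetric] by (rule clip_regulator(2)[OF k0]) (use that \<open>0 \<le> \<eta>\<close> in fastforce)
    have "\<bar>E j (i, k)\<bar> \<le> \<delta>" if "i \<in> {1..k}" "k \<le> N" for i k
      using D[OF J[OF j]] J[OF j] that by (simp add: E_def tri_def)
    then show "\<bar>clip E k (Suc j) i - clip E k j i\<bar> \<le> \<delta>"
      by (rule clip_incr_le[where N = N]) (use ik in auto)
  next
    fix t :: real and q assume "0 \<le> t" "q \<in> tri N"
    then show "clip_path N m J (grid_incr m f) t q = clip E (snd q) (nat \<lfloor>real m * t\<rfloor>) (fst q) - 0"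
      by (simp add: clip_path_def E_def split_beta)
  qed (use bnd m \<delta> in simp_all)
qed

section \<open>Interlacing dynamics as approximately reflected paths\<close>

lemma gt_update_cong:
  assumes "\<And>q. q \<in> tri N \<Longrightarrow> y q = y2 q" "\<And>q. q \<in> tri N \<Longrightarrow> dx q = dx2 q"
    "\<And>q. q \<in> tri N \<Longrightarrow> y' q = y2' q"
  shows "gt_update N y dx y' \<longleftrightarrow> gt_update N y2 dx2 y2'"
proof -
  have 1: "y (1, 1) = y2 (1, 1)" "dx (1, 1) = dx2 (1, 1)" "y' (1, 1) = y2' (1, 1)" if "1 \<le> N"
    using assms[of "(1, 1)"] that by (auto simp: tri_def)
  have eq: "y (i, k) = y2 (i, k)" "dx (i, k) = dx2 (i, k)" "y' (i, k) = y2' (i, k)"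
    if "k \<in> {2..N}" "i \<in> {1..k}" for i k
    using assms[of "(i, k)"] that by (auto simp: tri_def)
  have l: "y' (i - 1, k - 1) = y2' (i - 1, k - 1)" if "k \<in> {2..N}" "i \<in> {1..k}" "1 < i" for i k
    by (rule assms) (use that in \<open>auto simp: tri_def\<close>)
  have u: "y' (i, k - 1) = y2' (i, k - 1)" if "k \<in> {2..N}" "i \<in> {1..k}" "i < k" for i k
    by (rule assms) (use that in \<open>auto simp: tri_def\<close>)
  show ?thesis
    unfolding gt_update_def
  proof (intro arg_cong2[where f = "(\<and>)"] ball_cong imp_cong refl, goal_cases)
    case 1 then show ?case using \<open>1 \<le> N \<Longrightarrow> y (1, 1) = y2 (1, 1)\<close> 
      \<open>1 \<le> N \<Longrightarrow> dx (1, 1) = dx2 (1, 1)\<close> \<open>1 \<le> N \<Longrightarrow> y' (1, 1) = y2' (1, 1)\<close> by simp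
  next
    case (2 k i)
    show ?case
      unfolding eq[OF 2] by (cases "1 < i"; cases "i < k"; simp only: l[OF 2] u[OF 2] simp_thms if_False)
  qed
qed

lemma left_limit_step:
  assumes "\<And>t. real m \<le> t \<Longrightarrow> t < real (Suc m) \<Longrightarrow> f t = v"
  shows "left_limit f (real (Suc m)) = v"
  unfolding left_limit_def
proof (rule tendsto_Lim)
  show "(f \<longlongrightarrow> v) (at_left (real (Suc m)))"
  proof (rule tendsto_eventually)
    show "\<forall>\<^sub>F t in at_left (real (Suc m)). f t = v"
      unfolding eventually_at_left_field using assms by (intro exI[of _ "real m"]) auto
  qed
qed simp

text \<open>The driver is constant between integers, hence so is \<open>z\<close>, and the left
  limits at \<open>m + 1\<close> are the values at \<open>m\<close>. If no walk moves at
  \<open>m + 1\<close>, that time is not a discontinuity and the update rule is silent; the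
  constancy clause then applies on the closed interval from \<open>m\<close> to
  \<open>m + 1\<close>.\<close>

lemma discrete_interlacing_dynamicsD:
  assumes "discrete_interlacing_dynamics N x y"
  shows "(\<lambda>q. y q 0) \<in> GT N"
    and "if \<forall>q\<in>tri N. x q (Suc m) = x q m then \<forall>q\<in>tri N. y q (Suc m) = y q m
      else gt_update N (\<lambda>q. y q m) (\<lambda>q. x q (Suc m) - x q m) (\<lambda>q. y q (Suc m))"
proof -
  define xc where "xc q t = x q (nat \<lfloor>t\<rfloor>)" for q and t :: real
  obtain z where z: "interlacing_dynamics N xc z" and y: "\<And>q m. q \<in> tri N \<Longrightarrow> y q m = z q (real m)"
    using assms unfolding discrete_interlacing_dynamics_def xc_def by blast
  note Z = z[unfolded interlacing_dynamics_def]
  have const: "z q t = z q s" if "0 \<le> s" "s \<le> t" "\<forall>q\<in>tri N. \<forall>r\<in>{s..t}. xc q r = xc q s" "q \<in> tri N" for q s t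
    using Z that by blast
  have "(\<lambda>q. z q 0) \<in> GT N" using Z by blast
  moreover have "y q 0 = z q 0" if "q \<in> tri N" for q using y[OF that, of 0] by simp
  moreover have "(i - 1, j) \<in> tri N" "(i - 1, j - 1) \<in> tri N" "(i, j) \<in> tri N"
    if "2 \<le> i \<and> i \<le> j \<and> j \<le> N" for i j using that by (auto simp: tri_def)
  ultimately show "(\<lambda>q. y q 0) \<in> GT N" unfolding GT_def by simp
  have xc: "xc q t = x q m" if "real m \<le> t" "t < real (Suc m)" for q t m
  proof -
    have "\<lfloor>t\<rfloor> = int m" using that by (intro floor_unique) auto
    then show ?thesis by (simp add: xc_def)
  qed
  have zc: "z q t = y q m" if "real m \<le> t" "t < real (Suc m)" "q \<in> tri N" for q t m
  proof -
    have "z q t = z q (real m)"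
    proof (rule const)
      show "\<forall>q\<in>tri N. \<forall>r\<in>{real m..t}. xc q r = xc q (real m)"
        using that(2) xc[of m] by (auto intro: order_le_less_trans)
    qed (use that in auto)
    then show ?thesis using y[OF that(3)] by simp
  qed
  have lx: "left_limit (xc q) (real (Suc m)) = x q m" for q by (rule left_limit_step) (rule xc)
  have lz: "left_limit (z q) (real (Suc m)) = y q m" if "q \<in> tri N" for q
    using zc[OF _ _ that] by (rule left_limit_step)
  have xS: "xc q (real (Suc m)) = x q (Suc m)" for q by (rule xc) auto
  show "if \<forall>q\<in>tri N. x q (Suc m) = x q m then \<forall>q\<in>tri N. y q (Suc m) = y q m
      else gt_update N (\<lambda>q. y q m) (\<lambda>q. x q (Suc m) - x q m) (\<lambda>q. y q (Suc m))"
  proof (cases "\<forall>q\<in>tri N. x q (Suc m) = x q m")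
    case True
    have "xc q r = xc q (real m)" if "q \<in> tri N" "r \<in> {real m..real (Suc m)}" for q r
    proof -
      have "xc q (real m) = x q m" by (rule xc) auto
      moreover have "xc q r = x q m"
      proof (cases "r = real (Suc m)")
        case True
        then show ?thesis using xS[of q] \<open>\<forall>q\<in>tri N. x q (Suc m) = x q m\<close> that by simp
      next
        case False
        then show ?thesis using that by (intro xc) auto
      qed
      ultimately show ?thesis by simp
    qed
    then have *: "\<forall>q\<in>tri N. \<forall>r\<in>{real m..real (Suc m)}. xc q r = xc q (real m)" by blast
    have "z q (real (Suc m)) = z q (real m)" if "q \<in> tri N" for q
      by (rule const[OF _ _ * that]) simp_all
    then have "\<forall>q\<in>tri N. y q (Suc m) = y q m" using y by metis
    then show ?thesis unfolding if_P[OF True] .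
  next
    case False
    then have "\<exists>q\<in>tri N. xc q (real (Suc m)) \<noteq> left_limit (xc q) (real (Suc m))"
      unfolding lx xS by blast
    moreover have "(0::real) < real (Suc m)" by simp
    ultimately have "gt_update N (\<lambda>q. left_limit (z q) (real (Suc m)))
        (\<lambda>q. xc q (real (Suc m)) - left_limit (xc q) (real (Suc m))) (\<lambda>q. z q (real (Suc m)))"
      using Z by blast
    then have "gt_update N (\<lambda>q. y q m) (\<lambda>q. x q (Suc m) - x q m) (\<lambda>q. y q (Suc m))"
      by (rule gt_update_cong[THEN iffD1, rotated 3]) (use lz y in \<open>simp_all only: lx xS\<close>)
    then show ?thesis unfolding if_not_P[OF False] .
  qed
qed

section \<open>One update, level by level\<close>

text \<open>The conditions of \<open>GT\<close> are grouped by level because an update fills the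
  levels in turn: while one level is treated, the new configuration is known to be interlaced only
  below it.\<close>

definition interlaced :: "nat \<Rightarrow> (nat \<times> nat \<Rightarrow> int) \<Rightarrow> bool" where
  "interlaced k y \<longleftrightarrow> (\<forall>i\<in>{1..k}. (1 < i \<longrightarrow> y (i - 1, k - 1) \<le> y (i, k)) \<and> (i < k \<longrightarrow> y (i, k) < y (i, k - 1)))"

lemma interlaced_cong:
  assumes "interlaced k y" "k \<le> N" "\<forall>q\<in>tri N. y' q = y q"
  shows "interlaced k y'"
  unfolding interlaced_def
proof
  fix i assume i: "i \<in> {1..k}"
  have "y' (i, k) = y (i, k)" "1 < i \<Longrightarrow> y' (i - 1, k - 1) = y (i - 1, k - 1)"
    "i < k \<Longrightarrow> y' (i, k - 1) = y (i, k - 1)"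
    using i assms(2) by (auto intro!: assms(3)[rule_format] simp: tri_def)
  then show "(1 < i \<longrightarrow> y' (i - 1, k - 1) \<le> y' (i, k)) \<and> (i < k \<longrightarrow> y' (i, k) < y' (i, k - 1))"
    using assms(1) i unfolding interlaced_def by simp
qed

lemma GT_imp_interlaced: "y \<in> GT N \<Longrightarrow> k \<le> N \<Longrightarrow> interlaced k y"
  unfolding interlaced_def GT_def
  apply (intro ballI conjI impI)
  subgoal for i by auto
  subgoal for i by (drule CollectD, drule spec[of _ "Suc i"], drule spec[of _ k]) auto
  done

text \<open>This strict order of the two neighbours keeps both push rules from applying at once, and
  leaves a particle pushed up to its lower barrier strictly below the upper one.\<close>

lemma interlaced_lt:
  assumes "interlaced k y" "1 < i" "i \<le> k"
  shows "y (i - 1, k) < y (i, k)"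
proof -
  have "i - 1 \<in> {1..k}" "i - 1 < k" "i \<in> {1..k}" using assms by auto
  then have "y (i - 1, k) < y (i - 1, k - 1)" "y (i - 1, k - 1) \<le> y (i, k)"
    using assms(1,2) unfolding interlaced_def by blast+
  then show ?thesis by simp
qed

text \<open>\<open>P\<close> and \<open>Q\<close> say that the lower and the upper neighbour exist;
  primes mark values after the update. Barriers move by at most 1, so
  \<open>l' - 1 \<le> y \<le> u'\<close>, and a push occurs exactly when an interlacing inequality
  has just failed. After a push up or a blocked step down \<open>y' = l'\<close>; after a push down
  or a blocked step up \<open>y' + 1 = u'\<close>. These are the situations that the premises of the
  last two conjuncts exclude.\<close>

lemma particle_step:
  fixes y y' l l' u u' x :: int
  assumes "y' = (if P \<and> y = l' - 1 then y + 1 else if Q \<and> y = u' then y - 1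
        else if x = 1 then (if Q \<and> u' = y + 1 then y else y + 1)
        else if x = - 1 then (if P \<and> l' = y then y else y - 1) else y)"
    and "x = - 1 \<or> x = 0 \<or> x = 1" "P \<Longrightarrow> l \<le> y" "Q \<Longrightarrow> y < u"
    and "P \<Longrightarrow> \<bar>l' - l\<bar> \<le> 1" "Q \<Longrightarrow> \<bar>u' - u\<bar> \<le> 1" "P \<Longrightarrow> Q \<Longrightarrow> l' < u'"
  shows "(P \<longrightarrow> l' \<le> y') \<and> (Q \<longrightarrow> y' < u') \<and> \<bar>y' - y\<bar> \<le> 1 \<and>
    ((Q \<longrightarrow> y' + 1 < u') \<longrightarrow> x \<le> y' - y) \<and> ((P \<longrightarrow> l' < y') \<longrightarrow> y' - y \<le> x)"
proof -
  have "P \<Longrightarrow> l' - 1 \<le> y" "Q \<Longrightarrow> y \<le> u'" using assms(3-6) by linarith+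
  with assms(1,2,7) show ?thesis by (cases P; cases Q; auto)
qed

text \<open>Interlacing is strict only at the upper barrier, hence the asymmetric \<open>+ 1\<close>.\<close>

lemma gt_update_level:
  assumes upd: "gt_update N y dx y'" and il: "\<And>k. k \<le> N \<Longrightarrow> interlaced k y"
    and dx: "\<And>q. q \<in> tri N \<Longrightarrow> dx q \<in> {- 1, 0, 1}"
  shows "k \<in> {1..N} \<Longrightarrow> interlaced k y' \<and> (\<forall>i\<in>{1..k}. \<bar>y' (i, k) - y (i, k)\<bar> \<le> 1 \<and>
    ((i < k \<longrightarrow> y' (i, k) + 1 < y' (i, k - 1)) \<longrightarrow> dx (i, k) \<le> y' (i, k) - y (i, k)) \<and>
    ((1 < i \<longrightarrow> y' (i - 1, k - 1) < y' (i, k)) \<longrightarrow> y' (i, k) - y (i, k) \<le> dx (i, k)))"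
proof (induction k)
  case 0 then show ?case by simp
next
  case (Suc k)
  show ?case
  proof (cases "k = 0")
    case True
    have "(1, 1) \<in> tri N" using Suc.prems by (auto simp: tri_def)
    then have "\<bar>dx (1, 1)\<bar> \<le> 1" using dx[of "(1, 1)"] by auto
    moreover have "y' (1, 1) = y (1, 1) + dx (1, 1)" using upd Suc.prems by (simp add: gt_update_def)
    moreover have "i = 1" if "i \<in> {1..Suc k}" for i using that True by simp
    ultimately show ?thesis unfolding interlaced_def using True by force
  next
    case False
    with Suc have IH: "interlaced k y'" "\<And>i. i \<in> {1..k} \<Longrightarrow> \<bar>y' (i, k) - y (i, k)\<bar> \<le> 1" by auto
    have *: "(1 < i \<longrightarrow> y' (i - 1, k) \<le> y' (i, Suc k)) \<and> (i < Suc k \<longrightarrow> y' (i, Suc k) < y' (i, k)) \<and>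
      \<bar>y' (i, Suc k) - y (i, Suc k)\<bar> \<le> 1 \<and>
      ((i < Suc k \<longrightarrow> y' (i, Suc k) + 1 < y' (i, k)) \<longrightarrow> dx (i, Suc k) \<le> y' (i, Suc k) - y (i, Suc k)) \<and>
      ((1 < i \<longrightarrow> y' (i - 1, k) < y' (i, Suc k)) \<longrightarrow> y' (i, Suc k) - y (i, Suc k) \<le> dx (i, Suc k))"
      if i: "i \<in> {1..Suc k}" for i
    proof -
      have q: "(i, Suc k) \<in> tri N" using i Suc.prems by (auto simp: tri_def)
      have y: "1 < i \<Longrightarrow> y (i - 1, k) \<le> y (i, Suc k)" "i < Suc k \<Longrightarrow> y (i, Suc k) < y (i, k)"
        using il[of "Suc k"] Suc.prems i by (auto simp: interlaced_def)
      have l: "1 < i \<Longrightarrow> \<bar>y' (i - 1, k) - y (i - 1, k)\<bar> \<le> 1" using i by (intro IH(2)) auto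
      have u: "i < Suc k \<Longrightarrow> \<bar>y' (i, k) - y (i, k)\<bar> \<le> 1" using i by (intro IH(2)) auto
      have lu: "1 < i \<Longrightarrow> i < Suc k \<Longrightarrow> y' (i - 1, k) < y' (i, k)" using interlaced_lt[OF IH(1), of i] by auto
      have "y' (i, Suc k) =
       (if i > 1 \<and> y (i, Suc k) = y' (i - 1, k) - 1 then y (i, Suc k) + 1
        else if i < Suc k \<and> y (i, Suc k) = y' (i, k) then y (i, Suc k) - 1
        else if dx (i, Suc k) = 1 then
          (if i < Suc k \<and> y' (i, k) = y (i, Suc k) + 1 then y (i, Suc k) else y (i, Suc k) + 1)
        else if dx (i, Suc k) = - 1 then
          (if i > 1 \<and> y' (i - 1, k) = y (i, Suc k) then y (i, Suc k) else y (i, Suc k) - 1)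
        else y (i, Suc k))"
      proof -
        have "Suc k \<in> {2..N}" using False Suc.prems by auto
        from upd[unfolded gt_update_def, THEN conjunct2, THEN bspec, OF this, THEN bspec, OF i]
        show ?thesis unfolding diff_Suc_1 .
      qed
      moreover have "dx (i, Suc k) = - 1 \<or> dx (i, Suc k) = 0 \<or> dx (i, Suc k) = 1" using dx[OF q] by auto
      ultimately show ?thesis using y l u lu by (rule particle_step)
    qed
    then show ?thesis by (auto simp: interlaced_def)
  qed
qed

text \<open>In lattice units a barrier acts within distance 1 and a particle moves by at most 1,
  whence \<open>\<eta> = 1 / b\<close>. The jump bound is doubled because
  \<open>near_reflected_step\<close> needs a strict gap to absorb the continuous centring.\<close>

lemma interlacing_near_reflected:
  assumes dyn: "discrete_interlacing_dynamics N x y"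
    and dx: "\<And>q m. q \<in> tri N \<Longrightarrow> x q (Suc m) - x q m \<in> {- 1, 0, 1}"
    and n: "0 < n" and \<alpha>: "continuous_on {0..} \<alpha>" and b: "0 < b"
  shows "near_reflected N T (1 / b) (2 * (1 / b))
    (\<lambda>t\<in>{0..}. \<lambda>q\<in>tri N. (real_of_int (x q (nat \<lfloor>real n * t\<rfloor>)) - \<alpha> t) / b)
    (\<lambda>t\<in>{0..}. \<lambda>q\<in>tri N. (real_of_int (y q (nat \<lfloor>real n * t\<rfloor>)) - \<alpha> t) / b)"
proof -
  have il: "interlaced k (\<lambda>q. y q m)" if "k \<le> N" for m k
    using that
  proof (induction m arbitrary: k)
    case 0 with GT_imp_interlaced[OF discrete_interlacing_dynamicsD(1)[OF dyn]] show ?case by simp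
  next
    case (Suc m)
    show ?case
    proof (cases "\<forall>q\<in>tri N. x q (Suc m) = x q m")
      case True
      then have "\<forall>q\<in>tri N. y q (Suc m) = y q m" using discrete_interlacing_dynamicsD(2)[OF dyn, of m] by simp
      then show ?thesis by (intro interlaced_cong[OF Suc.IH[OF Suc.prems] Suc.prems]) simp
    next
      case False
      then have "gt_update N (\<lambda>q. y q m) (\<lambda>q. x q (Suc m) - x q m) (\<lambda>q. y q (Suc m))"
        using discrete_interlacing_dynamicsD(2)[OF dyn, of m] by simp
      from gt_update_level[OF this Suc.IH dx, of k] Suc.prems show ?thesis
        by (cases "k = 0") (auto simp: interlaced_def)
    qed
  qed
  have step: "\<bar>y (i, k) (Suc j) - y (i, k) j\<bar> \<le> 1 \<and>
    ((i < k \<longrightarrow> y (i, k) (Suc j) + 1 < y (i, k - 1) (Suc j)) \<longrightarrow>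
       x (i, k) (Suc j) - x (i, k) j \<le> y (i, k) (Suc j) - y (i, k) j) \<and>
    ((1 < i \<longrightarrow> y (i - 1, k - 1) (Suc j) < y (i, k) (Suc j)) \<longrightarrow>
       y (i, k) (Suc j) - y (i, k) j \<le> x (i, k) (Suc j) - x (i, k) j)"
    if ik: "i \<in> {1..k}" "k \<le> N" for i k j
  proof (cases "\<forall>q\<in>tri N. x q (Suc j) = x q j")
    case True
    then have "\<forall>q\<in>tri N. y q (Suc j) = y q j" using discrete_interlacing_dynamicsD(2)[OF dyn, of j] by simp
    with True ik show ?thesis by (auto simp: tri_def)
  next
    case False
    then have "gt_update N (\<lambda>q. y q j) (\<lambda>q. x q (Suc j) - x q j) (\<lambda>q. y q (Suc j))"
      using discrete_interlacing_dynamicsD(2)[OF dyn, of j] by simp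
    from gt_update_level[OF this il dx, of k] ik show ?thesis by auto
  qed
  show ?thesis
  proof (rule near_reflected_step[where n = n and \<alpha> = "\<lambda>t. \<alpha> t / b" and \<delta> = "1 / b" and
        c = "\<lambda>j q. real_of_int (y q j) / b" and e = "\<lambda>j q. real_of_int (x q j) / b"])
    show "continuous_on {0..} (\<lambda>t. \<alpha> t / b)" using \<alpha> b by (intro continuous_intros) auto
  next
    fix j i k assume ik: "i \<in> {1..k}" "k \<le> N"
    show "1 < i \<Longrightarrow> real_of_int (y (i - 1, k - 1) j) / b \<le> real_of_int (y (i, k) j) / b"
      using il[OF ik(2), of j] ik b by (auto simp: interlaced_def divide_right_mono)
    show "i < k \<Longrightarrow> real_of_int (y (i, k) j) / b \<le> real_of_int (y (i, k - 1) j) / b"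
      using il[OF ik(2), of j] ik b by (auto simp: interlaced_def less_imp_le intro!: divide_right_mono)
    have "\<bar>real_of_int (y (i, k) (Suc j)) - real_of_int (y (i, k) j)\<bar> \<le> 1"
      using step[OF ik, of j] by linarith
    then show "\<bar>real_of_int (y (i, k) (Suc j)) / b - real_of_int (y (i, k) j) / b\<bar> \<le> 1 / b"
      using b by (simp add: diff_divide_distrib[symmetric] divide_right_mono)
    show "real_of_int (x (i, k) (Suc j)) / b - real_of_int (x (i, k) j) / b
        \<le> real_of_int (y (i, k) (Suc j)) / b - real_of_int (y (i, k) j) / b"
      if "i < k \<Longrightarrow> real_of_int (y (i, k) (Suc j)) / b + 1 / b < real_of_int (y (i, k - 1) (Suc j)) / b"
    proof -
      have "i < k \<Longrightarrow> y (i, k) (Suc j) + 1 < y (i, k - 1) (Suc j)"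
        using that b by (simp add: add_divide_distrib[symmetric] divide_less_cancel)
      then have "x (i, k) (Suc j) - x (i, k) j \<le> y (i, k) (Suc j) - y (i, k) j" using step[OF ik, of j] by blast
      then have "real_of_int (x (i, k) (Suc j)) - x (i, k) j \<le> real_of_int (y (i, k) (Suc j)) - y (i, k) j" by linarith
      then show ?thesis using b by (simp add: diff_divide_distrib[symmetric] divide_right_mono)
    qed
    show "real_of_int (y (i, k) (Suc j)) / b - real_of_int (y (i, k) j) / b
        \<le> real_of_int (x (i, k) (Suc j)) / b - real_of_int (x (i, k) j) / b"
      if "1 < i \<Longrightarrow> real_of_int (y (i - 1, k - 1) (Suc j)) / b + 1 / b < real_of_int (y (i, k) (Suc j)) / b"
    proof -
      have "1 < i \<Longrightarrow> y (i - 1, k - 1) (Suc j) + 1 < y (i, k) (Suc j)"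
        using that b by (simp add: add_divide_distrib[symmetric] divide_less_cancel)
      then have "y (i, k) (Suc j) - y (i, k) j \<le> x (i, k) (Suc j) - x (i, k) j" using step[OF ik, of j] by auto
      then have "real_of_int (y (i, k) (Suc j)) - y (i, k) j \<le> real_of_int (x (i, k) (Suc j)) - x (i, k) j" by linarith
      then show ?thesis using b by (simp add: diff_divide_distrib[symmetric] divide_right_mono)
    qed
  qed (use n b in \<open>auto simp: diff_divide_distrib divide_strict_right_mono\<close>)
qed

section \<open>Path space\<close>

text \<open>Truncation at 1 makes the supremum finite for all paths.\<close>

definition cdist :: "'i set \<Rightarrow> real \<Rightarrow> (real \<Rightarrow> 'i \<Rightarrow> real) \<Rightarrow> (real \<Rightarrow> 'i \<Rightarrow> real) \<Rightarrow> real" where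
  "cdist I T f g = (SUP t\<in>{0..T}. min 1 (\<Sum>p\<in>I. \<bar>f t p - g t p\<bar>))"

lemma cdist_upper: "t \<in> {0..T} \<Longrightarrow> min 1 (\<Sum>p\<in>I. \<bar>f t p - g t p\<bar>) \<le> cdist I T f g"
  unfolding cdist_def by (rule cSUP_upper) (auto intro!: bdd_aboveI[of _ 1])

lemma cdist_least:
  "0 \<le> T \<Longrightarrow> (\<And>t. t \<in> {0..T} \<Longrightarrow> min 1 (\<Sum>p\<in>I. \<bar>f t p - g t p\<bar>) \<le> c) \<Longrightarrow> cdist I T f g \<le> c"
  unfolding cdist_def by (rule cSUP_least) auto

lemma cdist_le_1: "0 \<le> T \<Longrightarrow> cdist I T f g \<le> 1"
  by (rule cdist_least) auto

lemma cdist_nonneg: "0 \<le> T \<Longrightarrow> 0 \<le> cdist I T f g"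
  by (rule order_trans[OF _ cdist_upper[of 0]]) (auto intro!: sum_nonneg)

lemma cdist_commute: "cdist I T f g = cdist I T g f"
  unfolding cdist_def by (simp add: abs_minus_commute)

lemma cdist_triangle:
  assumes "0 \<le> T"
  shows "cdist I T f h \<le> cdist I T f g + cdist I T g h"
proof (rule cdist_least[OF assms])
  fix t assume t: "t \<in> {0..T}"
  have "(\<Sum>p\<in>I. \<bar>f t p - h t p\<bar>) \<le> (\<Sum>p\<in>I. \<bar>f t p - g t p\<bar> + \<bar>g t p - h t p\<bar>)"
    by (rule sum_mono) linarith
  moreover have "min 1 x \<le> min 1 y + min 1 z" if "x \<le> y + z" "0 \<le> y" "0 \<le> z" for x y z :: real
    using that by (auto simp: min_def)
  ultimately have "min 1 (\<Sum>p\<in>I. \<bar>f t p - h t p\<bar>)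
      \<le> min 1 (\<Sum>p\<in>I. \<bar>f t p - g t p\<bar>) + min 1 (\<Sum>p\<in>I. \<bar>g t p - h t p\<bar>)"
    unfolding sum.distrib by (auto intro!: sum_nonneg)
  also have "\<dots> \<le> cdist I T f g + cdist I T g h"
    by (intro add_mono cdist_upper t)
  finally show "min 1 (\<Sum>p\<in>I. \<bar>f t p - h t p\<bar>) \<le> cdist I T f g + cdist I T g h" .
qed

lemma cdist_mono: "0 \<le> S \<Longrightarrow> S \<le> T \<Longrightarrow> cdist I S f g \<le> cdist I T f g"
  by (rule cdist_least) (auto intro!: cdist_upper)

lemma cdist_bound:
  assumes "finite I" "cdist I T f g < 1" "t \<in> {0..T}" "p \<in> I"
  shows "\<bar>f t p - g t p\<bar> \<le> cdist I T f g"
proof -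
  have "\<bar>f t p - g t p\<bar> \<le> (\<Sum>p\<in>I. \<bar>f t p - g t p\<bar>)"
    using assms by (intro member_le_sum) auto
  with cdist_upper[OF assms(3), where I = I and f = f and g = g] assms(2) show ?thesis by (simp add: min_def split: if_splits)
qed

lemma cdist_le_card:
  assumes "0 \<le> T" "\<And>t p. t \<in> {0..T} \<Longrightarrow> p \<in> I \<Longrightarrow> \<bar>f t p - g t p\<bar> \<le> c"
  shows "cdist I T f g \<le> real (card I) * c"
proof (rule cdist_least[OF assms(1)])
  fix t assume "t \<in> {0..T}"
  then have "(\<Sum>p\<in>I. \<bar>f t p - g t p\<bar>) \<le> real (card I) * c"
    using assms(2) by (intro sum_bounded_above) auto
  then show "min 1 (\<Sum>p\<in>I. \<bar>f t p - g t p\<bar>) \<le> real (card I) * c" by simp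
qed

section \<open>Membership in the path space\<close>

lemma cadlag_pathsI:
  assumes "\<And>t p. 0 \<le> t \<Longrightarrow> p \<in> I \<Longrightarrow> ((\<lambda>s. f s p) \<longlongrightarrow> f t p) (at_right t)"
    and "\<And>t p. 0 < t \<Longrightarrow> p \<in> I \<Longrightarrow> \<exists>l. ((\<lambda>s. f s p) \<longlongrightarrow> l) (at_left t)"
  shows "(\<lambda>t\<in>{0..}. \<lambda>p\<in>I. f t p) \<in> cadlag_paths I"
  unfolding cadlag_paths_def
proof (intro CollectI conjI ballI allI impI)
  fix p t assume p: "p \<in> I"
  let ?f = "\<lambda>s. (\<lambda>t\<in>{0..}. \<lambda>p\<in>I. f t p) s p"
  show "continuous (at_right t) ?f" if t: "0 \<le> t"
  proof -
    have "\<forall>\<^sub>F s in at_right t. f s p = ?f s"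
      unfolding eventually_at_right_field using t p by (intro exI[of _ "t + 1"]) auto
    from Lim_transform_eventually[OF assms(1)[OF t p] this]
    show ?thesis unfolding continuous_within using t p by simp
  qed
  show "\<exists>l. (?f \<longlongrightarrow> l) (at_left t)" if t: "0 < t"
  proof -
    obtain l where l: "((\<lambda>s. f s p) \<longlongrightarrow> l) (at_left t)" using assms(2)[OF t p] by blast
    have "\<forall>\<^sub>F s in at_left t. f s p = ?f s"
      unfolding eventually_at_left_field using t p by (intro exI[of _ 0]) auto
    from Lim_transform_eventually[OF l this] show ?thesis by blast
  qed
qed auto

lemma cadlag_right_tendsto:
  assumes "f \<in> cadlag_paths I" "0 \<le> t" "p \<in> I"
  shows "((\<lambda>s. f s p) \<longlongrightarrow> f t p) (at_right t)"
  using assms unfolding cadlag_paths_def continuous_within by auto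

lemma step_right_tendsto:
  assumes "0 \<le> t"
  shows "((\<lambda>s. c (nat \<lfloor>real m * s\<rfloor>)) \<longlongrightarrow> (c (nat \<lfloor>real m * t\<rfloor>) :: real)) (at_right t)"
proof (cases "m = 0")
  case m: False
  show ?thesis
  proof (rule tendsto_eventually)
    have "c (nat \<lfloor>real m * s\<rfloor>) = c (nat \<lfloor>real m * t\<rfloor>)"
      if "t < s" "s < (real_of_int \<lfloor>real m * t\<rfloor> + 1) / real m" for s
    proof -
      have "real m * t < real m * s" "real m * s < real_of_int \<lfloor>real m * t\<rfloor> + 1"
        using that assms m by (auto simp: field_simps)
      then have "\<lfloor>real m * s\<rfloor> = \<lfloor>real m * t\<rfloor>" by linarith
      then show ?thesis by simp
    qed
    moreover have "t < (real_of_int \<lfloor>real m * t\<rfloor> + 1) / real m"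
      using assms m by (simp add: pos_less_divide_eq mult.commute)
    ultimately show "\<forall>\<^sub>F s in at_right t. c (nat \<lfloor>real m * s\<rfloor>) = c (nat \<lfloor>real m * t\<rfloor>)"
      unfolding eventually_at_right_field by blast
  qed
qed simp

lemma step_left_tendsto:
  assumes "0 < t"
  shows "\<exists>l. ((\<lambda>s. c (nat \<lfloor>real m * s\<rfloor>)) \<longlongrightarrow> (l :: real)) (at_left t)"
proof (cases "m = 0")
  case m: False
  show ?thesis
  proof (rule exI, rule tendsto_eventually)
    \<comment> \<open>The index just to the left of \<open>t\<close>: one less than the floor when
      \<open>t\<close> is a grid point, equal to it otherwise.\<close>
    define k where "k = \<lceil>real m * t\<rceil> - 1"
    have "c (nat \<lfloor>real m * s\<rfloor>) = c (nat k)" if "real_of_int k / real m < s" "s < t" for s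
    proof -
      have "real_of_int k < real m * s" "real m * s < real m * t"
        using that assms m by (auto simp: field_simps)
      then have "\<lfloor>real m * s\<rfloor> = k" unfolding k_def by linarith
      then show ?thesis by simp
    qed
    moreover have "real_of_int k / real m < t"
      using assms m unfolding k_def by (simp add: pos_divide_less_eq mult.commute) linarith
    ultimately show "\<forall>\<^sub>F s in at_left t. c (nat \<lfloor>real m * s\<rfloor>) = c (nat k)"
      unfolding eventually_at_left_field by blast
  qed
qed auto

lemma step_cadlag:
  "(\<lambda>t\<in>{0..}. \<lambda>p\<in>I. c (nat \<lfloor>real m * t\<rfloor>) p) \<in> cadlag_paths I"
  by (rule cadlag_pathsI) (auto intro: step_right_tendsto step_left_tendsto)

lemma step_minus_continuous_cadlag:
  assumes \<alpha>: "continuous_on {0..} \<alpha>"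
  shows "(\<lambda>t\<in>{0..}. \<lambda>p\<in>I. (c p (nat \<lfloor>real m * t\<rfloor>) - \<alpha> t) / b) \<in> cadlag_paths I"
proof (rule cadlag_pathsI)
  fix p and t :: real
  have \<alpha>t: "(\<alpha> \<longlongrightarrow> \<alpha> t) (at t within {0..})" if "0 \<le> t"
    using \<alpha> that by (auto simp: continuous_on_def)
  show "((\<lambda>s. (c p (nat \<lfloor>real m * s\<rfloor>) - \<alpha> s) / b) \<longlongrightarrow> (c p (nat \<lfloor>real m * t\<rfloor>) - \<alpha> t) / b) (at_right t)"
    if t: "0 \<le> t"
  proof -
    have "(\<alpha> \<longlongrightarrow> \<alpha> t) (at_right t)"
      by (rule tendsto_within_subset[OF \<alpha>t[OF t]]) (use t in auto)
    from tendsto_mult_right[OF tendsto_diff[OF step_right_tendsto[OF t, where c = "c p" and m = m] this], of "1 / b"]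
    show ?thesis by simp
  qed
  show "\<exists>l. ((\<lambda>s. (c p (nat \<lfloor>real m * s\<rfloor>) - \<alpha> s) / b) \<longlongrightarrow> l) (at_left t)" if t: "0 < t"
  proof -
    have "continuous (at t) \<alpha>"
      using \<alpha> t by (intro continuous_on_interior[of "{0..}"]) (auto simp: interior_real_atLeast)
    then have *: "(\<alpha> \<longlongrightarrow> \<alpha> t) (at_left t)"
      using continuous_at_imp_continuous_at_within continuous_within by blast
    obtain l where "((\<lambda>s. c p (nat \<lfloor>real m * s\<rfloor>)) \<longlongrightarrow> l) (at_left t)"
      using step_left_tendsto[OF t] by blast
    from tendsto_mult_right[OF tendsto_diff[OF this *], of "1 / b"] show ?thesis by auto
  qed
qed

section \<open>Measurability for the coordinate maps\<close>

lemma space_cadlag_space: "space (cadlag_space I) = cadlag_paths I"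
  unfolding cadlag_space_def space_restrict_space space_PiM
  by (auto simp: cadlag_paths_def)

lemma measurable_cadlag_coord:
  assumes "0 \<le> t" "p \<in> I"
  shows "(\<lambda>f. f t p) \<in> borel_measurable (cadlag_space I)"
  unfolding cadlag_space_def
  by (rule measurable_restrict_space1)
    (rule measurable_compose[where g = "\<lambda>x. x p", OF measurable_component_singleton[of t] measurable_component_singleton],
      use assms in auto)

lemma measurable_cadlagI:
  assumes "\<And>\<omega>. \<omega> \<in> space M \<Longrightarrow> Z \<omega> \<in> cadlag_paths I"
    and "\<And>t p. 0 \<le> t \<Longrightarrow> p \<in> I \<Longrightarrow> (\<lambda>\<omega>. Z \<omega> t p) \<in> borel_measurable M"
  shows "Z \<in> measurable M (cadlag_space I)"
  unfolding cadlag_space_def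
proof (rule measurable_restrict_space2)
  have *: "Z \<omega> \<in> {0..} \<rightarrow>\<^sub>E (I \<rightarrow>\<^sub>E UNIV)" if "\<omega> \<in> space M" for \<omega>
    using assms(1)[OF that] by (auto simp: cadlag_paths_def)
  show "Z \<in> measurable M (\<Pi>\<^sub>M t\<in>{0..}. \<Pi>\<^sub>M p\<in>I. borel)"
  proof (rule measurable_PiM_single')
    fix t :: real assume t: "t \<in> {0..}"
    show "(\<lambda>\<omega>. Z \<omega> t) \<in> measurable M (\<Pi>\<^sub>M p\<in>I. borel)"
    proof (rule measurable_PiM_single')
      show "(\<lambda>\<omega>. Z \<omega> t p) \<in> borel_measurable M" if "p \<in> I" for p using assms(2) t that by auto
      show "(\<lambda>\<omega> i. Z \<omega> t i) \<in> space M \<rightarrow> (\<Pi>\<^sub>E i\<in>I. space borel)"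
      proof -
        have "Z \<omega> t \<in> I \<rightarrow>\<^sub>E UNIV" if "\<omega> \<in> space M" for \<omega>
          using PiE_mem[OF *[OF that] t] .
        then show ?thesis by simp
      qed
    qed
  qed (use * in \<open>auto simp: space_PiM\<close>)
qed (use assms in auto)

text \<open>By right-continuity the supremum over \<open>{0..T}\<close> is attained along the
  rationals, a countable set. The endpoint \<open>T\<close> is added by hand, since nothing to its
  right belongs to the interval.\<close>

lemma cdist_measurable:
  fixes T :: real
  assumes I: "finite I" and T: "0 \<le> T"
    and f: "\<phi> \<in> measurable M (cadlag_space I)" and g: "\<psi> \<in> measurable M (cadlag_space I)"
  shows "(\<lambda>\<omega>. cdist I T (\<phi> \<omega>) (\<psi> \<omega>)) \<in> borel_measurable M"
proof -
  define A where "A = insert T (\<rat> \<inter> {0..T})"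
  have A: "countable A" "A \<noteq> {}" "A \<subseteq> {0..T}" using T by (auto simp: A_def countable_rat)
  define h where "h \<omega> t = min 1 (\<Sum>p\<in>I. \<bar>\<phi> \<omega> t p - \<psi> \<omega> t p\<bar>)" for \<omega> t
  have bdd: "bdd_above (h \<omega> ` B)" for \<omega> B by (auto simp: h_def intro!: bdd_aboveI[of _ 1])
  have eq: "cdist I T (\<phi> \<omega>) (\<psi> \<omega>) = (SUP t\<in>A. h \<omega> t)" if \<omega>: "\<omega> \<in> space M" for \<omega>
  proof (rule antisym)
    have paths: "\<phi> \<omega> \<in> cadlag_paths I" "\<psi> \<omega> \<in> cadlag_paths I"
      using measurable_space[OF f \<omega>] measurable_space[OF g \<omega>] by (auto simp: space_cadlag_space)
    show "(SUP t\<in>A. h \<omega> t) \<le> cdist I T (\<phi> \<omega>) (\<psi> \<omega>)"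
      using A by (intro cSUP_least) (auto simp: h_def intro!: cdist_upper)
    show "cdist I T (\<phi> \<omega>) (\<psi> \<omega>) \<le> (SUP t\<in>A. h \<omega> t)"
    proof (rule cdist_least[OF T], fold h_def)
      fix t assume t: "t \<in> {0..T}"
      show "h \<omega> t \<le> (SUP t\<in>A. h \<omega> t)"
      proof (cases "t = T")
        case True
        then show ?thesis using bdd by (intro cSUP_upper) (auto simp: A_def)
      next
        case False
        show ?thesis
        proof (rule ccontr)
          assume "\<not> ?thesis"
          then have less: "(SUP t\<in>A. h \<omega> t) < h \<omega> t" by simp
          have "(h \<omega> \<longlongrightarrow> h \<omega> t) (at_right t)"
            unfolding h_def using t
            by (intro tendsto_intros cadlag_right_tendsto[where I = I] paths) auto
          from order_tendstoD(1)[OF this less]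
          obtain b where b: "t < b" "\<And>s. t < s \<Longrightarrow> s < b \<Longrightarrow> (SUP t\<in>A. h \<omega> t) < h \<omega> s"
            unfolding eventually_at_right_field by blast
          have "t < min b T" using b t False by auto
          then obtain r where r: "r \<in> \<rat>" "t < r" "r < min b T" using Rats_dense_in_real by blast
          then have "h \<omega> r \<le> (SUP t\<in>A. h \<omega> t)" using t bdd by (intro cSUP_upper) (auto simp: A_def)
          with b(2)[of r] r show False by auto
        qed
      qed
    qed
  qed
  have "(\<lambda>\<omega>. SUP t\<in>A. h \<omega> t) \<in> borel_measurable M"
  proof (rule borel_measurable_cSUP)
    fix t assume "t \<in> A"
    then have "0 \<le> t" using A by auto
    then show "(\<lambda>\<omega>. h \<omega> t) \<in> borel_measurable M"
      unfolding h_def using measurable_compose[OF f measurable_cadlag_coord] measurable_compose[OF g measurable_cadlag_coord]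
      by (intro borel_measurable_min borel_measurable_sum borel_measurable_abs borel_measurable_diff) auto
  qed (use A bdd in auto)
  then show ?thesis using eq by (subst measurable_cong[OF eq])
qed

section \<open>Continuity in terms of uniform closeness on compacts\<close>

lemma cadlag_continuousI:
  assumes "\<And>f e. f \<in> cadlag_paths I \<Longrightarrow> 0 < e \<Longrightarrow> \<exists>T. \<exists>\<delta>>0. \<forall>g\<in>cadlag_paths I.
      (\<forall>t\<in>{0..T}. \<forall>p\<in>I. \<bar>g t p - f t p\<bar> < \<delta>) \<longrightarrow> \<bar>G g - G f\<bar> < e"
  shows "continuous_map (cadlag_topology I) euclideanreal G"
  unfolding continuous_map_def
proof (intro conjI allI impI)
  fix U :: "real set" assume U: "openin euclideanreal U"
  show "openin (cadlag_topology I) {x \<in> topspace (cadlag_topology I). G x \<in> U}"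
    unfolding openin_cadlag_topology topspace_cadlag_topology
  proof (intro conjI ballI)
    fix f assume f: "f \<in> {x \<in> cadlag_paths I. G x \<in> U}"
    then obtain e where e: "0 < e" "ball (G f) e \<subseteq> U" using U open_contains_ball by (metis (no_types, lifting) mem_Collect_eq open_openin)
    obtain T \<delta> where "0 < \<delta>" "\<forall>g\<in>cadlag_paths I. (\<forall>t\<in>{0..T}. \<forall>p\<in>I. \<bar>g t p - f t p\<bar> < \<delta>) \<longrightarrow> \<bar>G g - G f\<bar> < e"
      using assms f e(1) by blast
    then show "\<exists>T. \<exists>e>0. \<forall>g\<in>cadlag_paths I.
        (\<forall>t\<in>{0..T}. \<forall>p\<in>I. \<bar>g t p - f t p\<bar> < e) \<longrightarrow> g \<in> {x \<in> cadlag_paths I. G x \<in> U}"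
      using e(2) by (intro exI[of _ T] exI[of _ \<delta>]) (auto simp: subset_iff dist_real_def abs_minus_commute)
  qed auto
qed simp

lemma cadlag_continuousD:
  assumes "continuous_map (cadlag_topology I) euclideanreal G" "f \<in> cadlag_paths I" "0 < e"
  shows "\<exists>T. \<exists>\<delta>>0. \<forall>g\<in>cadlag_paths I.
      (\<forall>t\<in>{0..T}. \<forall>p\<in>I. \<bar>g t p - f t p\<bar> < \<delta>) \<longrightarrow> \<bar>G g - G f\<bar> < e"
proof -
  have "openin (cadlag_topology I) {x \<in> topspace (cadlag_topology I). G x \<in> ball (G f) e}"
    using assms(1) by (rule openin_continuous_map_preimage) auto
  moreover have "f \<in> {x \<in> topspace (cadlag_topology I). G x \<in> ball (G f) e}"
    using assms by (auto simp: topspace_cadlag_topology)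
  ultimately obtain T \<delta> where "0 < \<delta>" "\<forall>g\<in>cadlag_paths I.
      (\<forall>t\<in>{0..T}. \<forall>p\<in>I. \<bar>g t p - f t p\<bar> < \<delta>) \<longrightarrow> g \<in> {x \<in> topspace (cadlag_topology I). G x \<in> ball (G f) e}"
    unfolding openin_cadlag_topology by meson
  then show ?thesis
    by (intro exI[of _ T] exI[of _ \<delta>]) (auto simp: dist_real_def abs_minus_commute)
qed

section \<open>Weak convergence to a process with continuous paths\<close>

text \<open>The whole path space is not separable, but the paths that the limit process takes are:
  uniform continuity on compacts makes rational step functions on finite grids approximate every
  continuous path.\<close>

lemma dense_steps:
  assumes I: "finite I"
  obtains Q where "countable Q" "Q \<subseteq> cadlag_paths I" "Q \<noteq> {}"
    "\<And>f T e. f \<in> cadlag_paths I \<Longrightarrow> (\<And>p. p \<in> I \<Longrightarrow> continuous_on {0..} (\<lambda>t. f t p)) \<Longrightarrow> 0 \<le> T \<Longrightarrow> 0 < e \<Longrightarrow>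
      \<exists>q\<in>Q. cdist I T f q < e"
proof
  define \<Phi> where "\<Phi> m x = (\<lambda>t\<in>{0..}. \<lambda>p\<in>I. (\<lambda>j p. if j \<le> m * m then x (j, p) else 0) (nat \<lfloor>real m * t\<rfloor>) p)"
    for m and x :: "nat \<times> 'a \<Rightarrow> real"
  define Q where "Q = (\<Union>m\<in>{0<..}. \<Phi> m ` (({..m * m} \<times> I) \<rightarrow>\<^sub>E \<rat>))"
  show "countable Q" unfolding Q_def using I
    by (intro countable_UN countable_image countable_PiE) (auto simp: countable_rat)
  show "Q \<subseteq> cadlag_paths I" unfolding Q_def \<Phi>_def by (auto intro: step_cadlag)
  have "(\<lambda>_\<in>{..1 * 1} \<times> I. 0) \<in> ({..1 * 1 :: nat} \<times> I) \<rightarrow>\<^sub>E (\<rat> :: real set)" by auto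
  then show "Q \<noteq> {}" unfolding Q_def by blast
  fix f :: "real \<Rightarrow> 'a \<Rightarrow> real" and T e :: real
  assume f: "f \<in> cadlag_paths I" "\<And>p. p \<in> I \<Longrightarrow> continuous_on {0..} (\<lambda>t. f t p)" and T: "0 \<le> T" and e: "0 < e"
  define \<epsilon> where "\<epsilon> = e / (real (card I) + 1)"
  have \<epsilon>: "0 < \<epsilon>" using e by (simp add: \<epsilon>_def)
  have "\<exists>\<delta>>0. \<forall>s\<in>{0..T + 1}. \<forall>t\<in>{0..T + 1}. \<bar>t - s\<bar> < \<delta> \<longrightarrow> \<bar>f t p - f s p\<bar> < \<epsilon> / 2" if "p \<in> I" for p
  proof -
    have "uniformly_continuous_on {0..T + 1} (\<lambda>t. f t p)"
      by (intro compact_uniformly_continuous continuous_on_subset[OF f(2)[OF that]]) auto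
    then show ?thesis unfolding uniformly_continuous_on_def dist_real_def using \<epsilon> by (meson half_gt_zero)
  qed
  then obtain \<delta> where \<delta>: "\<And>p. p \<in> I \<Longrightarrow> 0 < \<delta> p"
    "\<And>p s t. p \<in> I \<Longrightarrow> s \<in> {0..T + 1} \<Longrightarrow> t \<in> {0..T + 1} \<Longrightarrow> \<bar>t - s\<bar> < \<delta> p \<Longrightarrow> \<bar>f t p - f s p\<bar> < \<epsilon> / 2"
    by metis
  define \<delta>0 where "\<delta>0 = Min (insert 1 (\<delta> ` I))"
  have \<delta>0: "0 < \<delta>0" "\<And>p. p \<in> I \<Longrightarrow> \<delta>0 \<le> \<delta> p" unfolding \<delta>0_def using I \<delta>(1) by auto
  \<comment> \<open>\<open>T < real m\<close> lets the table of \<open>m * m + 1\<close> values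
    reach time \<open>T\<close>; \<open>1 / \<delta>0 < real m\<close> makes the cells short enough
    for uniform continuity.\<close>
  obtain m :: nat where m: "max T (1 / \<delta>0) < real m" using reals_Archimedean2 by blast
  have m0: "0 < m" using m T by (cases m) auto
  have m\<delta>: "1 / real m < \<delta>0" using m \<delta>0 m0 by (simp add: field_simps)
  have "\<exists>r\<in>\<rat>. \<bar>f (real j / real m) p - r\<bar> < \<epsilon> / 2" for j p
  proof -
    obtain r where "r \<in> \<rat>" "f (real j / real m) p < r" "r < f (real j / real m) p + \<epsilon> / 2"
      using Rats_dense_in_real[of "f (real j / real m) p" "f (real j / real m) p + \<epsilon> / 2"] \<epsilon> by auto
    then show ?thesis by (intro bexI[of _ r]) auto
  qed
  then obtain r where r: "\<And>j p. r j p \<in> \<rat>" "\<And>j p. \<bar>f (real j / real m) p - r j p\<bar> < \<epsilon> / 2" by metis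
  define x where "x = (\<lambda>(j, p)\<in>{..m * m} \<times> I. r j p)"
  have "x \<in> ({..m * m} \<times> I) \<rightarrow>\<^sub>E \<rat>" unfolding x_def using r(1) by auto
  then have "\<Phi> m x \<in> Q" unfolding Q_def using m0 by blast
  moreover have "cdist I T f (\<Phi> m x) \<le> real (card I) * \<epsilon>"
  proof (rule cdist_le_card[OF T])
    fix t p assume t: "t \<in> {0..T}" and p: "p \<in> I"
    let ?j = "nat \<lfloor>real m * t\<rfloor>"
    have "real m * t \<le> real m * real m" using t m by (intro mult_left_mono) auto
    then have "real m * t \<le> real_of_int (int (m * m))" by simp
    then have "\<lfloor>real m * t\<rfloor> \<le> int (m * m)" by linarith
    then have "?j \<le> m * m" by (simp only: nat_le_iff)
    then have eq: "\<Phi> m x t p = r ?j p" using t p by (simp add: \<Phi>_def x_def)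
    have j: "real ?j \<le> real m * t" "real m * t < real ?j + 1" using t by auto
    then have j': "real ?j / real m \<le> t" "t < real ?j / real m + 1 / real m"
      using m0 by (auto simp: field_simps)
    have "\<bar>f (real ?j / real m) p - f t p\<bar> < \<epsilon> / 2"
      using j' t m\<delta> \<delta>0(2)[OF p] by (intro \<delta>(2)[OF p]) auto
    with r(2)[of ?j p] show "\<bar>f t p - \<Phi> m x t p\<bar> \<le> \<epsilon>" unfolding eq by linarith
  qed
  moreover have "real (card I) * \<epsilon> < e" unfolding \<epsilon>_def using e by (simp add: field_simps)
  ultimately show "\<exists>q\<in>Q. cdist I T f q < e" by force
qed

text \<open>Natural horizons suffice to recover continuous functionals by countably many tests, and
  they make \<open>m * T\<close> a number of cells of the grid with mesh
  \<open>1 / m\<close>.\<close>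

definition lipschitz_test :: "'i set \<Rightarrow> ((real \<Rightarrow> 'i \<Rightarrow> real) \<Rightarrow> real) \<Rightarrow> bool" where
  "lipschitz_test I H \<longleftrightarrow> H \<in> borel_measurable (cadlag_space I) \<and>
     (\<exists>c. \<forall>f\<in>cadlag_paths I. \<bar>H f\<bar> \<le> c) \<and>
     (\<exists>T::nat. \<exists>L\<ge>0. \<forall>f\<in>cadlag_paths I. \<forall>g\<in>cadlag_paths I. \<bar>H f - H g\<bar> \<le> L * cdist I (real T) f g)"

lemma lipschitz_test_max:
  assumes "lipschitz_test I G" "lipschitz_test I H"
  shows "lipschitz_test I (\<lambda>f. max (G f) (H f))"
proof -
  obtain c S K where G: "G \<in> borel_measurable (cadlag_space I)" "\<forall>f\<in>cadlag_paths I. \<bar>G f\<bar> \<le> c" "0 \<le> K"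
    "\<forall>f\<in>cadlag_paths I. \<forall>g\<in>cadlag_paths I. \<bar>G f - G g\<bar> \<le> K * cdist I (real S) f g"
    using assms(1) unfolding lipschitz_test_def by blast
  obtain d T L where H: "H \<in> borel_measurable (cadlag_space I)" "\<forall>f\<in>cadlag_paths I. \<bar>H f\<bar> \<le> d" "0 \<le> L"
    "\<forall>f\<in>cadlag_paths I. \<forall>g\<in>cadlag_paths I. \<bar>H f - H g\<bar> \<le> L * cdist I (real T) f g"
    using assms(2) unfolding lipschitz_test_def by blast
  have "\<bar>max (G f) (H f) - max (G g) (H g)\<bar> \<le> (K + L) * cdist I (real (max S T)) f g"
    if fg: "f \<in> cadlag_paths I" "g \<in> cadlag_paths I" for f g
  proof -
    let ?C = "cdist I (real (max S T)) f g"
    have C: "cdist I (real S) f g \<le> ?C" "cdist I (real T) f g \<le> ?C" "0 \<le> ?C"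
      by (auto intro: cdist_mono cdist_nonneg)
    have "\<bar>G f - G g\<bar> \<le> K * ?C" "\<bar>H f - H g\<bar> \<le> L * ?C"
      using G(4) H(4) fg mult_left_mono[OF C(1) G(3)] mult_left_mono[OF C(2) H(3)] by (meson order_trans)+
    moreover have "0 \<le> K * ?C" "0 \<le> L * ?C" using C G(3) H(3) by auto
    ultimately show ?thesis unfolding distrib_right by linarith
  qed
  moreover have "\<forall>f\<in>cadlag_paths I. \<bar>max (G f) (H f)\<bar> \<le> max c d" using G(2) H(2) by fastforce
  ultimately show ?thesis unfolding lipschitz_test_def using G(1,3) H(1,3)
    by (intro conjI exI[of _ "max c d"] exI[of _ "max S T"] exI[of _ "K + L"]) auto
qed

text \<open>\<open>\<phi>\<close> equals the infimum of \<open>F\<close> over the \<open>\<delta>\<close>-ball around \<open>q\<close> close to \<open>q\<close> and \<open>- c\<close> off the ball.\<close>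

lemma lipschitz_minorant:
  assumes I: "finite I" and F: "\<forall>f\<in>cadlag_paths I. \<bar>F f\<bar> \<le> c" and q: "q \<in> cadlag_paths I" and \<delta>: "0 < \<delta>"
  shows "\<exists>\<phi>. lipschitz_test I \<phi> \<and> (\<forall>f\<in>cadlag_paths I. - c \<le> \<phi> f \<and> \<phi> f \<le> F f) \<and>
    (\<forall>f\<in>cadlag_paths I. \<forall>r. cdist I (real T) f q \<le> \<delta> / 2 \<longrightarrow>
       (\<forall>h\<in>cadlag_paths I. cdist I (real T) h q < \<delta> \<longrightarrow> r \<le> F h) \<longrightarrow> r \<le> \<phi> f)"
proof -
  define B where "B = {h\<in>cadlag_paths I. cdist I (real T) h q < \<delta>}"
  define m where "m = Inf (F ` B)"
  \<comment> \<open>It is 1 up to distance \<open>\<delta> / 2\<close> and 0 from distance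
    \<open>\<delta>\<close> on, with slope \<open>2 / \<delta>\<close> in between.\<close>
  define bump where "bump f = min 1 (max 0 (2 - 2 * cdist I (real T) f q / \<delta>))" for f
  define \<phi> where "\<phi> f = - c + (m + c) * bump f" for f
  have "cdist I (real T) q q = 0" unfolding cdist_def by simp
  then have B: "q \<in> B" using q \<delta> by (auto simp: B_def)
  have "bdd_below (F ` B)" using F by (intro bdd_belowI[of _ "- c"]) (auto simp: B_def abs_le_iff)
  then have m_le: "m \<le> F h" if "h \<in> B" for h unfolding m_def using that by (intro cINF_lower) auto
  have le_m: "r \<le> m" if "\<And>h. h \<in> B \<Longrightarrow> r \<le> F h" for r unfolding m_def using B that by (intro cINF_greatest) auto
  have "- c \<le> m" by (rule le_m) (use F in \<open>auto simp: B_def abs_le_iff minus_le_iff\<close>)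
  then have mc: "0 \<le> m + c" by simp
  have bump: "0 \<le> bump f" "bump f \<le> 1" for f by (auto simp: bump_def)
  have cF: "- c \<le> F f" "F f \<le> c" if "f \<in> cadlag_paths I" for f using F that by (auto simp: abs_le_iff minus_le_iff)
  have lo: "- c \<le> \<phi> f" for f unfolding \<phi>_def using mc bump by simp
  have up: "\<phi> f \<le> F f" if f: "f \<in> cadlag_paths I" for f
  proof (cases "f \<in> B")
    case True
    have "(m + c) * bump f \<le> (m + c) * 1" using mc bump by (intro mult_left_mono) auto
    with m_le[OF True] show ?thesis unfolding \<phi>_def by simp
  next
    case False
    then have "\<delta> \<le> cdist I (real T) f q" using f by (auto simp: B_def)
    then have "bump f = 0" using \<delta> by (simp add: bump_def field_simps)
    then show ?thesis using cF[OF f] by (simp add: \<phi>_def)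
  qed
  have "cdist I (real T) f q \<le> \<delta> / 2 \<Longrightarrow> \<phi> f = m" for f
    unfolding \<phi>_def bump_def using \<delta> by (simp add: field_simps min_def)
  then have opt: "r \<le> \<phi> f" if "cdist I (real T) f q \<le> \<delta> / 2" "\<forall>h\<in>cadlag_paths I. cdist I (real T) h q < \<delta> \<longrightarrow> r \<le> F h" for f r
    using le_m[of r] that by (auto simp: B_def)
  have "lipschitz_test I \<phi>"
    unfolding lipschitz_test_def
  proof (intro conjI)
    have "(\<lambda>f. q) \<in> measurable (cadlag_space I) (cadlag_space I)"
      using q by (intro measurable_const) (simp add: space_cadlag_space)
    then have "(\<lambda>f. cdist I (real T) f q) \<in> borel_measurable (cadlag_space I)"
      using I by (intro cdist_measurable[where \<phi> = "\<lambda>f. f"]) auto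
    then show "\<phi> \<in> borel_measurable (cadlag_space I)" unfolding \<phi>_def bump_def by measurable
    show "\<exists>c. \<forall>f\<in>cadlag_paths I. \<bar>\<phi> f\<bar> \<le> c"
    proof (intro exI ballI)
      fix f assume f: "f \<in> cadlag_paths I"
      show "\<bar>\<phi> f\<bar> \<le> c" using lo[of f] up[OF f] cF[OF f] by linarith
    qed
    have "\<bar>\<phi> f - \<phi> g\<bar> \<le> ((m + c) * (2 / \<delta>)) * cdist I (real T) f g" for f g
    proof -
      have tri: "\<bar>cdist I (real T) f q - cdist I (real T) g q\<bar> \<le> cdist I (real T) f g"
        using cdist_triangle[of "real T" I f q g] cdist_triangle[of "real T" I g q f]
        by (simp add: cdist_commute[of I _ g f] abs_le_iff)
      have "\<bar>bump f - bump g\<bar> \<le> \<bar>2 * cdist I (real T) f q / \<delta> - 2 * cdist I (real T) g q / \<delta>\<bar>"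
        unfolding bump_def by linarith
      also have "\<dots> = (2 / \<delta>) * \<bar>cdist I (real T) f q - cdist I (real T) g q\<bar>"
      proof -
        have *: "2 * x / \<delta> - 2 * y / \<delta> = (2 / \<delta>) * (x - y)" for x y by (simp add: diff_divide_distrib right_diff_distrib)
        show ?thesis unfolding * abs_mult using \<delta> by simp
      qed
      also have "\<dots> \<le> (2 / \<delta>) * cdist I (real T) f g" using tri \<delta> by (intro mult_left_mono) auto
      finally have "(m + c) * \<bar>bump f - bump g\<bar> \<le> (m + c) * ((2 / \<delta>) * cdist I (real T) f g)"
        using mc by (intro mult_left_mono)
      moreover have "\<phi> f - \<phi> g = (m + c) * (bump f - bump g)" by (simp add: \<phi>_def algebra_simps)
      ultimately show ?thesis using mc unfolding mult.assoc by (simp only: abs_mult abs_of_nonneg)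
    qed
    moreover have "0 \<le> (m + c) * (2 / \<delta>)" using mc \<delta> by simp
    ultimately show "\<exists>T::nat. \<exists>L\<ge>0. \<forall>f\<in>cadlag_paths I. \<forall>g\<in>cadlag_paths I. \<bar>\<phi> f - \<phi> g\<bar> \<le> L * cdist I (real T) f g"
      by blast
  qed
  with lo up opt show ?thesis by blast
qed

text \<open>The supremum of countably many minorants recovers \<open>F\<close> on continuous paths. No measurability of
  infima over balls, which are not separable, is involved.\<close>

lemma lipschitz_minorants:
  assumes I: "finite I" and F: "continuous_map (cadlag_topology I) euclideanreal F"
    and bdd: "\<forall>f\<in>cadlag_paths I. \<bar>F f\<bar> \<le> c"
  obtains H where "\<And>k::nat. lipschitz_test I (H k)"
    "\<And>k f. f \<in> cadlag_paths I \<Longrightarrow> - c \<le> H k f \<and> H k f \<le> F f"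
    "\<And>f. f \<in> cadlag_paths I \<Longrightarrow> (\<And>p. p \<in> I \<Longrightarrow> continuous_on {0..} (\<lambda>t. f t p)) \<Longrightarrow> (\<lambda>k. H k f) \<longlonglongrightarrow> F f"
proof -
  obtain Q where Q: "countable Q" "Q \<subseteq> cadlag_paths I" "Q \<noteq> {}"
    "\<And>f T e. f \<in> cadlag_paths I \<Longrightarrow> (\<And>p. p \<in> I \<Longrightarrow> continuous_on {0..} (\<lambda>t. f t p)) \<Longrightarrow> 0 \<le> T \<Longrightarrow> 0 < e \<Longrightarrow>
      \<exists>q\<in>Q. cdist I T f q < e"
    using dense_steps[OF I] by metis
  define \<delta> where "\<delta> j = 1 / (real j + 1)" for j :: nat
  have \<delta>: "0 < \<delta> j" for j by (simp add: \<delta>_def)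
  define P where "P = (\<lambda>(q, T, j) \<phi>. lipschitz_test I \<phi> \<and> (\<forall>f\<in>cadlag_paths I. - c \<le> \<phi> f \<and> \<phi> f \<le> F f) \<and>
    (\<forall>f\<in>cadlag_paths I. \<forall>r. cdist I (real (T::nat)) f q \<le> \<delta> j / 2 \<longrightarrow>
       (\<forall>h\<in>cadlag_paths I. cdist I (real T) h q < \<delta> j \<longrightarrow> r \<le> F h) \<longrightarrow> r \<le> \<phi> f))"
  define X where "X = Q \<times> (UNIV :: nat set) \<times> (UNIV :: nat set)"
  have "\<forall>x\<in>X. \<exists>\<phi>. P x \<phi>"
  proof
    fix x assume "x \<in> X"
    then obtain q T j where x: "x = (q, T, j)" "q \<in> cadlag_paths I" using Q(2) by (auto simp: X_def)
    from lipschitz_minorant[OF I bdd x(2) \<delta>[of j], of T] show "\<exists>\<phi>. P x \<phi>" unfolding P_def x(1) prod.case .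
  qed
  then obtain \<phi> where \<phi>: "\<And>x. x \<in> X \<Longrightarrow> P x (\<phi> x)" by metis
  have X: "countable X" "X \<noteq> {}" using Q(1,3) by (auto simp: X_def)
  define e where "e = from_nat_into X"
  have e: "e k \<in> X" for k unfolding e_def using X by (simp add: from_nat_into)
  \<comment> \<open>Running maxima of the enumerated minorants: each is a maximum of finitely many
    tests, hence a test itself, and it retains every earlier minorant.\<close>
  define H where "H = rec_nat (\<phi> (e 0)) (\<lambda>k h f. max (h f) (\<phi> (e (Suc k)) f))"
  have H_simps: "H 0 = \<phi> (e 0)" "H (Suc k) = (\<lambda>f. max (H k f) (\<phi> (e (Suc k)) f))" for k
    by (simp_all add: H_def)
  have Pe: "lipschitz_test I (\<phi> (e k))" "f \<in> cadlag_paths I \<Longrightarrow> - c \<le> \<phi> (e k) f \<and> \<phi> (e k) f \<le> F f" for k f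
    using \<phi>[OF e[of k]] unfolding P_def by (auto split: prod.splits)
  have H1: "lipschitz_test I (H k)" for k
    by (induction k) (auto simp: H_simps Pe intro: lipschitz_test_max)
  have H2: "- c \<le> H k f \<and> H k f \<le> F f" if "f \<in> cadlag_paths I" for k f
    by (induction k) (use Pe(2)[OF that] in \<open>auto simp: H_simps le_max_iff_disj\<close>)
  have H3: "\<phi> (e j) f \<le> H k f" if "j \<le> k" for j k f
    using that
  proof (induction k)
    case (Suc k)
    then show ?case by (cases "j = Suc k") (auto simp: H_simps le_max_iff_disj)
  qed (simp add: H_simps)
  show thesis
  proof (rule that[OF H1 H2])
    fix f assume f: "f \<in> cadlag_paths I" and cont: "\<And>p. p \<in> I \<Longrightarrow> continuous_on {0..} (\<lambda>t. f t p)"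
    show "(\<lambda>k. H k f) \<longlonglongrightarrow> F f"
    proof (rule LIMSEQ_I)
      fix \<epsilon> :: real assume \<epsilon>: "0 < \<epsilon>"
      obtain T d where d: "0 < d" "\<forall>g\<in>cadlag_paths I. (\<forall>t\<in>{0..T}. \<forall>p\<in>I. \<bar>g t p - f t p\<bar> < d) \<longrightarrow> \<bar>F g - F f\<bar> < \<epsilon> / 2"
        using cadlag_continuousD[OF F f, of "\<epsilon> / 2"] \<epsilon> by auto
      obtain S :: nat where S: "T \<le> real S" using real_arch_simple by blast
      \<comment> \<open>The radius \<open>\<delta> j\<close> is such that every \<open>h\<close> in
        the ball around \<open>q\<close> has distance less than \<open>2 * \<delta> j\<close> from
        \<open>f\<close>. Being below 1 makes the truncation in \<open>cdist\<close> inactive; being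
        below \<open>d\<close> puts \<open>h\<close> into the neighbourhood given by continuity of
        \<open>F\<close> at \<open>f\<close>.\<close>
      obtain j :: nat where j: "2 / min 1 d < real j" using reals_Archimedean2 by blast
      have \<delta>j: "2 * \<delta> j < min 1 d"
      proof -
        have "2 < real j * min 1 d" using j d(1) by (simp add: pos_divide_less_eq)
        also have "\<dots> \<le> (real j + 1) * min 1 d" using d(1) by (intro mult_right_mono) auto
        finally have "2 / (real j + 1) < min 1 d" by (subst pos_divide_less_eq) (auto simp: mult.commute)
        then show ?thesis unfolding \<delta>_def by simp
      qed
      obtain q where q: "q \<in> Q" "cdist I (real S) f q < \<delta> j / 2"
        using Q(4)[OF f cont, of "real S" "\<delta> j / 2"] \<delta>[of j] by auto
      have "F f - \<epsilon> / 2 \<le> \<phi> (q, S, j) f"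
      proof -
        have "F f - \<epsilon> / 2 \<le> F h" if h: "h \<in> cadlag_paths I" "cdist I (real S) h q < \<delta> j" for h
        proof -
          have "cdist I (real S) h f < min 1 d"
            using cdist_triangle[of "real S" I h f q] h(2) q(2) \<delta>j \<delta>[of j] by (simp add: cdist_commute[of I _ q f])
          then have "\<bar>h t p - f t p\<bar> < d" if "t \<in> {0..T}" "p \<in> I" for t p
            using cdist_bound[OF I, of "real S" h f t p] that S by auto
          then show ?thesis using d(2) h(1) by (smt (verit))
        qed
        moreover have "P (q, S, j) (\<phi> (q, S, j))" using q(1) by (intro \<phi>) (auto simp: X_def)
        ultimately show ?thesis unfolding P_def prod.case using f q(2) by (meson less_imp_le)
      qed
      moreover have "(q, S, j) \<in> X" using q by (auto simp: X_def)
      then obtain k0 where k0: "e k0 = (q, S, j)" unfolding e_def using from_nat_into_surj[OF X(1)] by blast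
      ultimately have "F f - \<epsilon> / 2 \<le> H k f" if "k0 \<le> k" for k using H3[OF that, of f] by simp
      then show "\<exists>no. \<forall>k\<ge>no. norm (H k f - F f) < \<epsilon>"
        using H2[OF f] \<epsilon> by (intro exI[of _ k0]) (smt (verit) real_norm_def field_sum_of_halves)
    qed
  qed
qed

lemma integrable_bounded_path_functional:
  fixes F :: "(real \<Rightarrow> 'i \<Rightarrow> real) \<Rightarrow> real"
  assumes "prob_space M" "Z \<in> measurable M (cadlag_space I)" "F \<in> borel_measurable (cadlag_space I)"
    "\<forall>f\<in>cadlag_paths I. \<bar>F f\<bar> \<le> c"
  shows "integrable M (\<lambda>\<omega>. F (Z \<omega>))"
proof -
  interpret prob_space M by fact
  show ?thesis
    using assms(4) measurable_space[OF assms(2)] measurable_compose[OF assms(2,3)]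
    by (intro integrable_const_bound[of _ c]) (auto simp: space_cadlag_space intro!: AE_I2)
qed

text \<open>A lower bound in the limit, applied to \<open>F\<close> and to \<open>- F\<close>,
  suffices. Under \<open>\<mu> n\<close>, whose paths may jump, only the inequality
  \<open>H k \<le> F\<close> is used. The convergence of \<open>H k\<close> to \<open>F\<close> is
  used under the limit law, where paths are continuous.\<close>

lemma weak_convergence_cadlagI:
  fixes \<mu> :: "nat \<Rightarrow> (real \<Rightarrow> 'i \<Rightarrow> real) measure"
  assumes I: "finite I" and M: "prob_space M"
    and Z: "Z \<in> measurable M (cadlag_space I)"
    and cont: "\<And>\<omega> p. \<omega> \<in> space M \<Longrightarrow> p \<in> I \<Longrightarrow> continuous_on {0..} (\<lambda>t. Z \<omega> t p)"
    and \<mu>: "\<And>n. prob_space (\<mu> n)" "\<And>n. sets (\<mu> n) = sets (cadlag_space I)"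
    and conv: "\<And>H. lipschitz_test I H \<Longrightarrow> (\<lambda>n. \<integral>f. H f \<partial>\<mu> n) \<longlonglongrightarrow> (\<integral>\<omega>. H (Z \<omega>) \<partial>M)"
  shows "weak_convergence (cadlag_topology I) \<mu> (distr M (cadlag_space I) Z)"
proof -
  interpret prob_space M by fact
  have path: "Z \<omega> \<in> cadlag_paths I" if "\<omega> \<in> space M" for \<omega>
    using measurable_space[OF Z that] by (simp add: space_cadlag_space)
  have space_\<mu>: "space (\<mu> n) = cadlag_paths I" for n
    using sets_eq_imp_space_eq[OF \<mu>(2)] by (simp add: space_cadlag_space)
  have int: "integrable (\<mu> n) F" if "F \<in> borel_measurable (cadlag_space I)" "\<forall>f\<in>cadlag_paths I. \<bar>F f\<bar> \<le> c"
    for n c and F :: "(real \<Rightarrow> 'i \<Rightarrow> real) \<Rightarrow> real"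
    by (rule integrable_bounded_path_functional[OF \<mu>(1) _ that]) (rule measurable_ident_sets[OF \<mu>(2)])
  have half: "\<forall>\<^sub>F n in sequentially. (\<integral>\<omega>. F (Z \<omega>) \<partial>M) - e < (\<integral>f. F f \<partial>\<mu> n)"
    if F: "continuous_map (cadlag_topology I) euclideanreal F" and Fm: "F \<in> borel_measurable (cadlag_space I)"
      and c: "\<forall>f\<in>cadlag_paths I. \<bar>F f\<bar> \<le> c" and e: "0 < e" for F c e
  proof -
    obtain H where H: "\<And>k::nat. lipschitz_test I (H k)"
      "\<And>k f. f \<in> cadlag_paths I \<Longrightarrow> - c \<le> H k f \<and> H k f \<le> F f"
      "\<And>f. f \<in> cadlag_paths I \<Longrightarrow> (\<And>p. p \<in> I \<Longrightarrow> continuous_on {0..} (\<lambda>t. f t p)) \<Longrightarrow> (\<lambda>k. H k f) \<longlonglongrightarrow> F f"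
      using lipschitz_minorants[OF I F c] by metis
    have Hm: "H k \<in> borel_measurable (cadlag_space I)" for k using H(1) by (simp add: lipschitz_test_def)
    have Hc: "\<forall>f\<in>cadlag_paths I. \<bar>H k f\<bar> \<le> c" for k 
    proof
      fix f assume f: "f \<in> cadlag_paths I"
      then have "\<bar>F f\<bar> \<le> c" using c by blast
      with H(2)[OF f, of k] show "\<bar>H k f\<bar> \<le> c" by linarith
    qed
    have "(\<lambda>k. \<integral>\<omega>. H k (Z \<omega>) \<partial>M) \<longlonglongrightarrow> (\<integral>\<omega>. F (Z \<omega>) \<partial>M)"
    proof (rule integral_dominated_convergence[where w = "\<lambda>_. c"])
      show "AE \<omega> in M. (\<lambda>k. H k (Z \<omega>)) \<longlonglongrightarrow> F (Z \<omega>)"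
        using H(3) path cont by (intro AE_I2) blast
      show "AE \<omega> in M. norm (H k (Z \<omega>)) \<le> c" for k using Hc path by (intro AE_I2) auto
    qed (use measurable_compose[OF Z Fm] measurable_compose[OF Z Hm] in auto)
    then have "\<forall>\<^sub>F k in sequentially. dist (\<integral>\<omega>. H k (Z \<omega>) \<partial>M) (\<integral>\<omega>. F (Z \<omega>) \<partial>M) < e / 2"
      using e by (intro tendstoD) auto
    then obtain k where k: "dist (\<integral>\<omega>. H k (Z \<omega>) \<partial>M) (\<integral>\<omega>. F (Z \<omega>) \<partial>M) < e / 2"
      using eventually_happens by fastforce
    have "\<forall>\<^sub>F n in sequentially. dist (\<integral>f. H k f \<partial>\<mu> n) (\<integral>\<omega>. H k (Z \<omega>) \<partial>M) < e / 2"
      using e by (intro tendstoD conv H) auto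
    then show ?thesis
    proof eventually_elim
      case (elim n)
      have "(\<integral>f. H k f \<partial>\<mu> n) \<le> (\<integral>f. F f \<partial>\<mu> n)"
        using H(2) by (intro integral_mono int[OF Hm Hc] int[OF Fm c]) (auto simp: space_\<mu>)
      with elim k show ?case unfolding dist_real_def by linarith
    qed
  qed
  show ?thesis
    unfolding weak_convergence_def
  proof (intro allI impI, elim conjE exE)
    fix F :: "(real \<Rightarrow> 'i \<Rightarrow> real) \<Rightarrow> real" and c :: real
    assume F: "continuous_map (cadlag_topology I) euclideanreal F"
      and Fm: "F \<in> borel_measurable (distr M (cadlag_space I) Z)"
      and c: "\<forall>x\<in>topspace (cadlag_topology I). \<bar>F x\<bar> \<le> c"
    have Fm: "F \<in> borel_measurable (cadlag_space I)" using Fm by simp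
    have c: "\<forall>f\<in>cadlag_paths I. \<bar>F f\<bar> \<le> c" using c by (simp add: topspace_cadlag_topology)
    have eq: "(\<integral>f. F f \<partial>distr M (cadlag_space I) Z) = (\<integral>\<omega>. F (Z \<omega>) \<partial>M)"
      by (rule integral_distr[OF Z Fm])
    show "(\<lambda>n. \<integral>f. F f \<partial>\<mu> n) \<longlonglongrightarrow> (\<integral>f. F f \<partial>distr M (cadlag_space I) Z)"
      unfolding eq
    proof (rule tendstoI)
      fix e :: real assume e: "0 < e"
      have "continuous_map (cadlag_topology I) euclideanreal (\<lambda>f. - F f)" using F by (intro continuous_intros)
      from half[OF F Fm c e] half[OF this _ _ e, of c] Fm c
      show "\<forall>\<^sub>F n in sequentially. dist (\<integral>f. F f \<partial>\<mu> n) (\<integral>\<omega>. F (Z \<omega>) \<partial>M) < e"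
        by (auto elim: eventually_elim2 simp: dist_real_def abs_less_iff)
    qed
  qed
qed

section \<open>Discretized reflection\<close>

definition grid_path :: "'i set \<Rightarrow> nat \<Rightarrow> nat \<Rightarrow> (real \<Rightarrow> 'i \<Rightarrow> real) \<Rightarrow> real \<Rightarrow> 'i \<Rightarrow> real" where
  "grid_path I m d f = (\<lambda>t\<in>{0..}. \<lambda>p\<in>I. f (real (nat \<lfloor>real m * t\<rfloor> + d) / real m) p)"

text \<open>A substitute for the modulus of continuity at mesh \<open>1 / m\<close>. The first term
  compares \<open>f\<close> with its values at the left ends of the cells; the second, evaluated at
  a grid time, bounds the increment over a cell. As a bounded, measurable and continuous functional
  it can serve as a test function for the driving walks.\<close>

definition osc :: "'i set \<Rightarrow> nat \<Rightarrow> real \<Rightarrow> (real \<Rightarrow> 'i \<Rightarrow> real) \<Rightarrow> real" where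
  "osc I m T f = cdist I T f (grid_path I m 0 f) + cdist I T f (grid_path I m 1 f)"

lemma grid_path_cadlag: "grid_path I m d f \<in> cadlag_paths I"
  unfolding grid_path_def by (rule step_cadlag[where c = "\<lambda>j. f (real (j + d) / real m)"])

lemma grid_path_measurable:
  "grid_path I m d \<in> measurable (cadlag_space I) (cadlag_space I)"
  by (rule measurable_cadlagI[OF grid_path_cadlag]) (simp_all add: grid_path_def measurable_cadlag_coord)

lemma osc_measurable:
  "finite I \<Longrightarrow> 0 \<le> T \<Longrightarrow> osc I m T \<in> borel_measurable (cadlag_space I)"
  unfolding osc_def[abs_def]
  by (intro borel_measurable_add cdist_measurable grid_path_measurable measurable_ident_sets refl) auto

lemma osc_bounds: "0 \<le> T \<Longrightarrow> 0 \<le> osc I m T f \<and> osc I m T f \<le> 2"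
  unfolding osc_def using cdist_nonneg[of T I] cdist_le_1[of T I] by (smt (verit))

lemma abs_osc_le: "0 \<le> T \<Longrightarrow> \<bar>osc I m T f\<bar> \<le> 2"
  using osc_bounds[of T I m f] by simp

lemma grid_time_bounds:
  assumes "0 < m" "t \<in> {0..T}" "d \<le> 1"
  shows "real (nat \<lfloor>real m * t\<rfloor> + d) / real m \<in> {0..T + 1}"
    and "\<bar>real (nat \<lfloor>real m * t\<rfloor> + d) / real m - t\<bar> \<le> 1 / real m"
proof -
  let ?j = "nat \<lfloor>real m * t\<rfloor>"
  have "0 \<le> real m * t" using assms by simp
  then have j: "real ?j \<le> real m * t" "real m * t < real ?j + 1" by linarith+
  have d: "0 \<le> real d" "real d \<le> 1" using assms by auto
  have "\<bar>real (?j + d) - real m * t\<bar> \<le> 1" using j d unfolding of_nat_add abs_le_iff by linarith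
  then have "\<bar>real (?j + d) - real m * t\<bar> / real m \<le> 1 / real m" by (rule divide_right_mono) simp
  moreover have "\<bar>real (?j + d) - real m * t\<bar> / real m = \<bar>(real (?j + d) - real m * t) / real m\<bar>" by simp
  moreover have "(real (?j + d) - real m * t) / real m = real (?j + d) / real m - t"
    using assms(1) by (simp add: diff_divide_distrib)
  ultimately show *: "\<bar>real (?j + d) / real m - t\<bar> \<le> 1 / real m" by metis
  have "1 / real m \<le> 1" using assms(1) by simp
  with * assms(2) show "real (?j + d) / real m \<in> {0..T + 1}" by auto
qed

lemma cdist_close:
  assumes "finite I" "0 \<le> T" "0 < e"
  obtains \<delta> where "0 < \<delta>"
    "\<And>f g f' g'. (\<And>t p. t \<in> {0..T} \<Longrightarrow> p \<in> I \<Longrightarrow> \<bar>f t p - f' t p\<bar> < \<delta> \<and> \<bar>g t p - g' t p\<bar> < \<delta>) \<Longrightarrow>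
      \<bar>cdist I T f g - cdist I T f' g'\<bar> < e"
proof
  define \<delta> where "\<delta> = e / (2 * real (card I) + 1)"
  show "0 < \<delta>" using assms by (simp add: \<delta>_def)
  fix f g f' g'
  assume *: "\<And>t p. t \<in> {0..T} \<Longrightarrow> p \<in> I \<Longrightarrow> \<bar>f t p - f' t p\<bar> < \<delta> \<and> \<bar>g t p - g' t p\<bar> < \<delta>"
  have f: "cdist I T f f' \<le> real (card I) * \<delta>" by (rule cdist_le_card) (use assms * in \<open>auto intro: less_imp_le\<close>)
  have g: "cdist I T g g' \<le> real (card I) * \<delta>" by (rule cdist_le_card) (use assms * in \<open>auto intro: less_imp_le\<close>)
  have "\<bar>cdist I T f g - cdist I T f' g'\<bar> \<le> cdist I T f f' + cdist I T g g'"
    using cdist_triangle[OF assms(2), of I f g f'] cdist_triangle[OF assms(2), of I f' g g']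
      cdist_triangle[OF assms(2), of I f' g' f] cdist_triangle[OF assms(2), of I f g' g]
    by (simp add: cdist_commute[of I T f' f] cdist_commute[of I T g' g])
  also have "\<dots> \<le> 2 * real (card I) * \<delta>" using f g by simp
  also have "\<dots> < e" unfolding \<delta>_def using assms by (simp add: field_simps)
  finally show "\<bar>cdist I T f g - cdist I T f' g'\<bar> < e" .
qed

lemma osc_continuous:
  assumes I: "finite I" and T: "0 \<le> T" and m: "0 < m"
  shows "continuous_map (cadlag_topology I) euclideanreal (osc I m T)"
proof (rule cadlag_continuousI)
  fix f :: "real \<Rightarrow> 'a \<Rightarrow> real" and e :: real assume e: "0 < e"
  obtain \<delta> where \<delta>: "0 < \<delta>"
    "\<And>f g f' g' :: real \<Rightarrow> 'a \<Rightarrow> real. (\<And>t p. t \<in> {0..T} \<Longrightarrow> p \<in> I \<Longrightarrow> \<bar>f t p - f' t p\<bar> < \<delta> \<and> \<bar>g t p - g' t p\<bar> < \<delta>) \<Longrightarrow>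
      \<bar>cdist I T f g - cdist I T f' g'\<bar> < e / 2"
    using cdist_close[OF I T, of "e / 2"] e by (metis half_gt_zero)
  \<comment> \<open>The horizon is enlarged because the right end of the last cell may lie beyond
    \<open>T\<close>, by at most \<open>1 / m \<le> 1\<close>.\<close>
  have "\<bar>osc I m T g - osc I m T f\<bar> < e" if g: "\<forall>t\<in>{0..T + 1}. \<forall>p\<in>I. \<bar>g t p - f t p\<bar> < \<delta>" for g
  proof -
    have "\<bar>cdist I T g (grid_path I m d g) - cdist I T f (grid_path I m d f)\<bar> < e / 2" if "d \<le> 1" for d
      using g grid_time_bounds(1)[OF m _ that] by (intro \<delta>(2)) (auto simp: grid_path_def)
    from this[of 0] this[of 1] show ?thesis unfolding osc_def by linarith
  qed
  then show "\<exists>T'. \<exists>\<delta>>0. \<forall>g\<in>cadlag_paths I. (\<forall>t\<in>{0..T'}. \<forall>p\<in>I. \<bar>g t p - f t p\<bar> < \<delta>) \<longrightarrow> \<bar>osc I m T g - osc I m T f\<bar> < e"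
    using \<delta>(1) by blast
qed

lemma osc_tendsto_0:
  assumes I: "finite I" and T: "0 \<le> T" and f: "\<And>p. p \<in> I \<Longrightarrow> continuous_on {0..} (\<lambda>t. f t p)"
  shows "(\<lambda>m. osc I m T f) \<longlonglongrightarrow> 0"
proof (rule LIMSEQ_I)
  fix e :: real assume e: "0 < e"
  define \<epsilon> where "\<epsilon> = e / (2 * real (card I) + 1)"
  have \<epsilon>: "0 < \<epsilon>" using e by (simp add: \<epsilon>_def)
  have "\<exists>\<delta>>0. \<forall>s\<in>{0..T + 1}. \<forall>t\<in>{0..T + 1}. \<bar>t - s\<bar> < \<delta> \<longrightarrow> \<bar>f t p - f s p\<bar> < \<epsilon>" if "p \<in> I" for p
  proof -
    have "uniformly_continuous_on {0..T + 1} (\<lambda>t. f t p)"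
      by (intro compact_uniformly_continuous continuous_on_subset[OF f[OF that]]) auto
    then show ?thesis unfolding uniformly_continuous_on_def dist_real_def using \<epsilon> by meson
  qed
  then obtain \<delta> where \<delta>: "\<And>p. p \<in> I \<Longrightarrow> 0 < \<delta> p"
    "\<And>p s t. p \<in> I \<Longrightarrow> s \<in> {0..T + 1} \<Longrightarrow> t \<in> {0..T + 1} \<Longrightarrow> \<bar>t - s\<bar> < \<delta> p \<Longrightarrow> \<bar>f t p - f s p\<bar> < \<epsilon>"
    by metis
  define \<delta>0 where "\<delta>0 = Min (insert 1 (\<delta> ` I))"
  have \<delta>0: "0 < \<delta>0" "\<And>p. p \<in> I \<Longrightarrow> \<delta>0 \<le> \<delta> p" unfolding \<delta>0_def using I \<delta>(1) by auto
  obtain m0 :: nat where m0: "1 / \<delta>0 < real m0" using reals_Archimedean2 by blast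
  have "norm (osc I m T f - 0) < e" if "m0 \<le> m" for m
  proof -
    have "1 / \<delta>0 < real m" using m0 that by linarith
    moreover have "0 < 1 / \<delta>0" using \<delta>0 by simp
    ultimately have m: "0 < real m" by linarith
    then have m\<delta>: "1 / real m < \<delta>0" using \<open>1 / \<delta>0 < real m\<close> \<delta>0 by (simp add: field_simps)
    have "cdist I T f (grid_path I m d f) \<le> real (card I) * \<epsilon>" if d: "d \<le> 1" for d
    proof (rule cdist_le_card[OF T])
      fix t p assume t: "t \<in> {0..T}" and p: "p \<in> I"
      have "\<bar>f t p - f (real (nat \<lfloor>real m * t\<rfloor> + d) / real m) p\<bar> < \<epsilon>"
        using grid_time_bounds[OF _ t d, of m] t m m\<delta> \<delta>0(2)[OF p] by (intro \<delta>(2)[OF p]) auto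
      then show "\<bar>f t p - grid_path I m d f t p\<bar> \<le> \<epsilon>" using t p by (simp add: grid_path_def)
    qed
    from this[of 0] this[of 1] have "osc I m T f \<le> 2 * real (card I) * \<epsilon>" unfolding osc_def by simp
    also have "\<dots> < e" unfolding \<epsilon>_def using e by (simp add: field_simps)
    finally show ?thesis using osc_bounds[OF T, of I m f] by simp
  qed
  then show "\<exists>no. \<forall>m\<ge>no. norm (osc I m T f - 0) < e" by blast
qed

section \<open>Comparison with the discretized path\<close>

text \<open>The Lipschitz bound with \<open>\<delta> = 0\<close> is equality.\<close>

lemma clip_cong:
  assumes "\<And>j q. q \<in> tri N \<Longrightarrow> D j q = D' j q" "k \<le> N" "i \<in> {1..k}"
  shows "clip D k j i = clip D' k j i"
  using clip_Lipschitz[of j N D D' 0 j k i] assms by (auto simp: tri_def)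

lemma clip_path_cong:
  assumes "\<And>j q. j < J \<Longrightarrow> q \<in> tri N \<Longrightarrow> D j q = D' j q"
  shows "clip_path N m J D = clip_path N m J D'"
  unfolding clip_path_def
  by (intro restrict_ext, clarsimp, intro clip_cong[of N]) (use assms in \<open>auto simp: tri_def\<close>)

lemma clip_path_cadlag: "clip_path N m J D \<in> cadlag_paths (tri N)"
  using step_cadlag[where m = m and I = "tri N" and c = "\<lambda>n (i, k). clip (\<lambda>j q. if j < J then D j q else 0) k n i"]
  by (simp add: clip_path_def)

text \<open>Stability, with the driver error and the jumps of the discretized path both controlled
  by the oscillation. For jump size \<open>\<omega> + 2 * \<eta>\<close> and driver error
  \<open>\<omega>\<close> a level costs \<open>5 * \<eta> + 4 * \<omega>\<close>, whence
  \<open>5 * real N\<close>; the \<open>+ 1\<close> pays for the initial positions, and the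
  cardinality for the sum in \<open>cdist\<close>.\<close>

lemma clip_path_error:
  fixes T :: nat
  assumes N: "1 \<le> N" and m: "0 < m" and w: "near_reflected N (real T) \<eta> (2 * \<eta>) f w" and \<eta>: "0 < \<eta>"
  shows "cdist (tri N) (real T) w (clip_path N m (m * T) (grid_incr m f))
    \<le> (real (card (tri N)) * (5 * real N + 1)) *
      (min 1 (\<Sum>q\<in>tri N. \<bar>w 0 q\<bar>) + \<eta> + osc (tri N) m (real T) f)"
proof -
  let ?V = "clip_path N m (m * T) (grid_incr m f)"
  define \<iota> where "\<iota> = (\<Sum>q\<in>tri N. \<bar>w 0 q\<bar>)"
  define \<omega> where "\<omega> = osc (tri N) m (real T) f"
  have "0 \<le> \<iota>" by (simp add: \<iota>_def sum_nonneg)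
  have "0 \<le> \<omega>" using osc_bounds[of "real T" "tri N" m f] by (simp add: \<omega>_def)
  have "(1, 1) \<in> tri N" using N by (auto simp: tri_def)
  then have card: "1 \<le> real (card (tri N))" using finite_tri[of N] by (auto simp: Suc_le_eq card_gt_0_iff)
  show ?thesis
  \<comment> \<open>If one of the two quantities reaches 1, the right-hand side is at least 1 and
    \<open>cdist\<close> never exceeds 1. Otherwise the truncations are inactive and the pointwise
    bounds are available.\<close>
  proof (cases "\<iota> < 1 \<and> \<omega> < 1")
    case False
    then have "1 \<le> min 1 \<iota> + \<eta> + \<omega>" using \<open>0 \<le> \<iota>\<close> \<open>0 \<le> \<omega>\<close> \<eta> by (auto simp: min_def)
    moreover have "1 \<le> real (card (tri N)) * (5 * real N + 1)"
      using card mult_mono[of 1 "real (card (tri N))" 1 "5 * real N + 1"] by simp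
    ultimately have "1 * 1 \<le> (real (card (tri N)) * (5 * real N + 1)) * (min 1 \<iota> + \<eta> + \<omega>)"
      by (intro mult_mono) auto
    moreover have "cdist (tri N) (real T) w ?V \<le> 1" by (rule cdist_le_1) simp
    ultimately show ?thesis unfolding \<iota>_def \<omega>_def by simp
  next
    case True
    have nn: "0 \<le> cdist (tri N) (real T) f g" for g by (rule cdist_nonneg) simp
    have grid: "\<bar>f t q - grid_path (tri N) m d f t q\<bar> \<le> \<omega>" if "d \<in> {0, 1}" "t \<in> {0..real T}" "q \<in> tri N" for d t q
    proof -
      have "cdist (tri N) (real T) f (grid_path (tri N) m d f) \<le> \<omega>"
        using that(1) nn by (auto simp: \<omega>_def osc_def)
      with cdist_bound[OF finite_tri, of N "real T" f "grid_path (tri N) m d f" t q] that True show ?thesis by simp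
    qed
    have incr: "\<bar>grid_incr m f j q\<bar> \<le> \<omega>" if "j < m * T" "q \<in> tri N" for j q
    proof -
      have "real j \<le> real m * real T" using that by (metis less_imp_le of_nat_le_iff of_nat_mult)
      then have "real j / real m \<in> {0..real T}" using m by (simp add: field_simps)
      from grid[OF _ this that(2), of 1] show ?thesis
        using m that by (simp add: grid_path_def grid_incr_def abs_minus_commute add.commute)
    qed
    have V: "near_reflected N (real T) \<eta> (\<omega> + 2 * \<eta>) (\<lambda>t. f (real (nat \<lfloor>real m * t\<rfloor>) / real m)) ?V"
      using m \<eta> \<open>0 \<le> \<omega>\<close> incr by (intro near_reflected_clip_path[where \<delta> = \<omega>]) auto
    have w': "near_reflected N (real T) \<eta> (\<omega> + 2 * \<eta>) f w"
      by (rule near_reflected_mono[OF w]) (use \<open>0 \<le> \<omega>\<close> in simp)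
    have "\<bar>w t q - ?V t q\<bar> \<le> (5 * real N + 1) * (\<iota> + \<eta> + \<omega>)" if t: "t \<in> {0..real T}" and q: "q \<in> tri N" for t q
    proof -
      obtain i k where ik: "q = (i, k)" "k \<le> N" "i \<in> {1..k}" using q by (auto simp: tri_def)
      have "\<bar>w t (i, k) - ?V t (i, k)\<bar> \<le> \<iota> + real k * (\<eta> + 2 * (\<omega> + 2 * \<eta>) + 2 * \<omega>)"
      proof (rule near_reflected_stability[OF w' V _ _ _ _ _ ik(2) t ik(3)])
        show "\<bar>f t q - f (real (nat \<lfloor>real m * t\<rfloor>) / real m) q\<bar> \<le> \<omega>" if "t \<in> {0..real T}" "q \<in> tri N" for t q
          using grid[of 0 t q] that by (simp add: grid_path_def)
        show "\<bar>w 0 q - ?V 0 q\<bar> \<le> \<iota>" if "q \<in> tri N" for q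
        proof -
          have "?V 0 q = 0" using that by (auto simp: clip_path_def)
          then show ?thesis unfolding \<iota>_def using that finite_tri by (auto intro!: member_le_sum[where f = "\<lambda>q. \<bar>w 0 q\<bar>"])
        qed
      qed (use \<eta> \<open>0 \<le> \<omega>\<close> in auto)
      also have "\<dots> \<le> \<iota> + real N * (\<eta> + 2 * (\<omega> + 2 * \<eta>) + 2 * \<omega>)"
        using ik \<eta> \<open>0 \<le> \<omega>\<close> by (intro add_left_mono mult_right_mono) auto
      also have "\<dots> \<le> (5 * real N + 1) * (\<iota> + \<eta> + \<omega>)"
      proof -
        have "0 \<le> real N * \<iota>" "0 \<le> real N * \<omega>" using \<open>0 \<le> \<iota>\<close> \<open>0 \<le> \<omega>\<close> by simp_all
        then show ?thesis using \<eta> \<open>0 \<le> \<omega>\<close> by (simp add: algebra_simps)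
      qed
      finally show ?thesis unfolding ik(1) .
    qed
    then have "cdist (tri N) (real T) w ?V \<le> real (card (tri N)) * ((5 * real N + 1) * (\<iota> + \<eta> + \<omega>))"
      by (intro cdist_le_card) auto
    then show ?thesis using True unfolding \<iota>_def[symmetric] \<omega>_def[symmetric] by (simp add: mult.assoc min_def)
  qed
qed

text \<open>Uniform closeness of drivers makes their increments close, with a factor 2 for the two
  ends of a cell, and \<open>clip_Lipschitz\<close> adds up at most \<open>m * T\<close> such
  errors. The constant grows with \<open>m\<close>, but \<open>m\<close> stays fixed while the walks
  converge.\<close>

lemma clip_functional_continuous:
  fixes T :: nat
  assumes m: "0 < m" and L: "0 \<le> L"
    and H: "\<forall>f\<in>cadlag_paths (tri N). \<forall>g\<in>cadlag_paths (tri N). \<bar>H f - H g\<bar> \<le> L * cdist (tri N) (real T) f g"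
  shows "continuous_map (cadlag_topology (tri N)) euclideanreal (\<lambda>f. H (clip_path N m (m * T) (grid_incr m f)))"
proof (rule cadlag_continuousI)
  let ?V = "\<lambda>f. clip_path N m (m * T) (grid_incr m f)"
  fix f :: "real \<Rightarrow> nat \<times> nat \<Rightarrow> real" and e :: real assume e: "0 < e"
  define K where "K = L * (real (card (tri N)) * (real (m * T) * 2))"
  have K: "0 \<le> K" using L by (simp add: K_def)
  define \<delta> where "\<delta> = e / (K + 1)"
  have \<delta>: "0 < \<delta>" using e K by (simp add: \<delta>_def)
  have "\<bar>H (?V g) - H (?V f)\<bar> < e" if g: "\<forall>t\<in>{0..real T}. \<forall>p\<in>tri N. \<bar>g t p - f t p\<bar> < \<delta>" for g
  proof -
    have incr: "\<bar>grid_incr m g j q - grid_incr m f j q\<bar> \<le> 2 * \<delta>" if "j < m * T" "q \<in> tri N" for j q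
    proof -
      have "real (Suc j) \<le> real m * real T" using that(1) by (metis Suc_leI of_nat_le_iff of_nat_mult)
      then have "real (Suc j) / real m \<in> {0..real T}" "real j / real m \<in> {0..real T}" using m by (auto simp: field_simps)
      with g that(2) have "\<bar>g (real (Suc j) / real m) q - f (real (Suc j) / real m) q\<bar> < \<delta>"
        "\<bar>g (real j / real m) q - f (real j / real m) q\<bar> < \<delta>" by blast+
      then show ?thesis unfolding grid_incr_def by linarith
    qed
    have "cdist (tri N) (real T) (?V g) (?V f) \<le> real (card (tri N)) * (real (m * T) * (2 * \<delta>))"
    proof (rule cdist_le_card)
      fix t q assume t: "t \<in> {0..real T}" and q: "q \<in> tri N"
      obtain i k where ik: "q = (i, k)" "k \<le> N" "i \<in> {1..k}" using q by (auto simp: tri_def)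
      let ?n = "nat \<lfloor>real m * t\<rfloor>"
      have "real m * t \<le> real m * real T" using t by (intro mult_left_mono) auto
      then have "real m * t \<le> real_of_int (int (m * T))" by simp
      then have "\<lfloor>real m * t\<rfloor> \<le> int (m * T)" by linarith
      then have n: "?n \<le> m * T" by (simp only: nat_le_iff)
      have "\<bar>?V g t q - ?V f t q\<bar> \<le> real ?n * (2 * \<delta>)"
        using t q ik clip_Lipschitz[of "m * T" N "\<lambda>j q. if j < m * T then grid_incr m g j q else 0"
            "\<lambda>j q. if j < m * T then grid_incr m f j q else 0" "2 * \<delta>" ?n k i] incr \<delta> n
        by (auto simp: clip_path_def tri_def)
      also have "\<dots> \<le> real (m * T) * (2 * \<delta>)" using n \<delta> by (intro mult_right_mono of_nat_mono) auto
      finally show "\<bar>?V g t q - ?V f t q\<bar> \<le> real (m * T) * (2 * \<delta>)" .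
    qed simp
    then have "L * cdist (tri N) (real T) (?V g) (?V f) \<le> K * \<delta>"
      using mult_left_mono[OF _ L] by (fastforce simp: K_def mult.assoc)
    moreover have "\<bar>H (?V g) - H (?V f)\<bar> \<le> L * cdist (tri N) (real T) (?V g) (?V f)"
      using H clip_path_cadlag by blast
    moreover have "K * \<delta> < e" unfolding \<delta>_def using K e by (simp add: field_simps)
    ultimately show ?thesis by linarith
  qed
  then show "\<exists>T. \<exists>\<delta>>0. \<forall>g\<in>cadlag_paths (tri N). (\<forall>t\<in>{0..T}. \<forall>p\<in>tri N. \<bar>g t p - f t p\<bar> < \<delta>) \<longrightarrow>
      \<bar>H (?V g) - H (?V f)\<bar> < e"
    using \<delta> by blast
qed

lemma clip_measurable:
  assumes "\<And>j q. q \<in> tri N \<Longrightarrow> (\<lambda>\<omega>. D \<omega> j q) \<in> borel_measurable M"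
  shows "k \<le> N \<Longrightarrow> i \<in> {1..k} \<Longrightarrow> (\<lambda>\<omega>. clip (D \<omega>) k j i) \<in> borel_measurable M"
proof (induction j arbitrary: k i)
  case (Suc j)
  note IH = Suc.IH
  show ?case using Suc.prems
  proof (induction k arbitrary: i)
    case (Suc k)
    have D: "(\<lambda>\<omega>. D \<omega> j (i, Suc k)) \<in> borel_measurable M" using Suc.prems by (intro assms) (auto simp: tri_def)
    have j: "(\<lambda>\<omega>. clip (D \<omega>) (Suc k) j i) \<in> borel_measurable M" using Suc.prems by (intro IH)
    have l: "(\<lambda>\<omega>. clip (D \<omega>) k (Suc j) (i - 1)) \<in> borel_measurable M" if "1 < i"
      using Suc.prems that by (intro Suc.IH) auto
    have u: "(\<lambda>\<omega>. clip (D \<omega>) k (Suc j) i) \<in> borel_measurable M" if "i < Suc k"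
      using Suc.prems that by (intro Suc.IH) auto
    show ?case unfolding clip.simps Let_def
      using D j l u by (cases "1 < i"; cases "i < Suc k") simp_all
  qed simp
qed simp

lemma clip_path_measurable:
  assumes "\<And>j q. j < J \<Longrightarrow> q \<in> tri N \<Longrightarrow> (\<lambda>\<omega>. D \<omega> j q) \<in> borel_measurable M"
  shows "(\<lambda>\<omega>. clip_path N m J (D \<omega>)) \<in> measurable M (cadlag_space (tri N))"
proof (rule measurable_cadlagI[OF clip_path_cadlag])
  fix t :: real and q assume t: "0 \<le> t" and q: "q \<in> tri N"
  obtain i k where ik: "q = (i, k)" "k \<le> N" "i \<in> {1..k}" using q by (auto simp: tri_def)
  have "(\<lambda>\<omega>. clip (\<lambda>j q. if j < J then D \<omega> j q else 0) k (nat \<lfloor>real m * t\<rfloor>) i) \<in> borel_measurable M"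
  proof (rule clip_measurable[OF _ ik(2,3)])
    show "(\<lambda>\<omega>. if j < J then D \<omega> j q else 0) \<in> borel_measurable M" if "q \<in> tri N" for j q
      using assms[of j q] that by (cases "j < J") auto
  qed
  then show "(\<lambda>\<omega>. clip_path N m J (D \<omega>) t q) \<in> borel_measurable M"
    using t q by (simp add: clip_path_def ik)
qed

section \<open>Laws and measurability\<close>

text \<open>The product measure mentions neither \<open>M\<close> nor \<open>B\<close>, so
  functionals of Brownian motions on different spaces can be equated. Independence across
  coordinates comes from that of whole paths; within a coordinate, from that of increments.\<close>

lemma brownian_increments_law:
  assumes "prob_space M" and B: "multidim_brownian_motion M I B" and "I \<noteq> {}" and m: "0 < m" and J: "0 < J"
  defines "A \<equiv> \<lambda>\<omega>. \<lambda>q\<in>I. \<lambda>j\<in>{..<J}. B q (real (Suc j) / real m) \<omega> - B q (real j / real m) \<omega>"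
  shows "A \<in> measurable M (\<Pi>\<^sub>M q\<in>I. \<Pi>\<^sub>M j\<in>{..<J}. borel)"
    and "distr M (\<Pi>\<^sub>M q\<in>I. \<Pi>\<^sub>M j\<in>{..<J}. borel) A =
      (\<Pi>\<^sub>M q\<in>I. \<Pi>\<^sub>M j\<in>{..<J}. distr (density lborel (normal_density 0 (sqrt (1 / real m)))) borel (\<lambda>x. x))"
proof -
  interpret prob_space M by fact
  define X where "X q j \<omega> = B q (real (Suc j) / real m) \<omega> - B q (real j / real m) \<omega>" for q j \<omega>
  define Y where "Y q \<omega> = (\<lambda>j\<in>{..<J}. X q j \<omega>)" for q \<omega>
  have A: "A = (\<lambda>\<omega>. \<lambda>q\<in>I. Y q \<omega>)" by (simp add: A_def Y_def X_def)
  have bm: "standard_brownian_motion M (B q)" if "q \<in> I" for q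
    using B that by (simp add: multidim_brownian_motion_def)
  have X: "random_variable borel (X q j)" if "q \<in> I" for q j
    using bm[OF that] unfolding X_def standard_brownian_motion_def
    by (intro borel_measurable_diff) (auto simp: divide_nonneg_nonneg)
  have Y: "random_variable (\<Pi>\<^sub>M j\<in>{..<J}. borel) (Y q)" if "q \<in> I" for q
    unfolding Y_def using X[OF that] by (intro measurable_restrict)
  show "A \<in> measurable M (\<Pi>\<^sub>M q\<in>I. \<Pi>\<^sub>M j\<in>{..<J}. borel)"
    unfolding A using Y by (intro measurable_restrict)
  define g where "g x = (\<lambda>j\<in>{..<J}. x (real (Suc j) / real m) - x (real j / real m))" for x :: "real \<Rightarrow> real"
  have "indep_vars (\<lambda>_. \<Pi>\<^sub>M t\<in>{0..}. borel) (\<lambda>p \<omega>. \<lambda>t\<in>{0..}. B p t \<omega>) I"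
    using B by (simp add: multidim_brownian_motion_def)
  moreover have "g \<in> measurable (\<Pi>\<^sub>M t\<in>{0..}. borel) (\<Pi>\<^sub>M j\<in>{..<J}. borel)"
    unfolding g_def by (intro measurable_restrict borel_measurable_diff measurable_component_singleton) auto
  ultimately have "indep_vars (\<lambda>_. \<Pi>\<^sub>M j\<in>{..<J}. borel) (\<lambda>q \<omega>. g (\<lambda>t\<in>{0..}. B q t \<omega>)) I"
    by (rule indep_vars_compose2[where Y = "\<lambda>_. g"])
  also have "(\<lambda>q \<omega>. g (\<lambda>t\<in>{0..}. B q t \<omega>)) = Y"
    by (intro ext) (auto simp: g_def Y_def X_def)
  finally have 1: "distr M (\<Pi>\<^sub>M q\<in>I. \<Pi>\<^sub>M j\<in>{..<J}. borel) A = (\<Pi>\<^sub>M q\<in>I. distr M (\<Pi>\<^sub>M j\<in>{..<J}. borel) (Y q))"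
    unfolding A using indep_vars_iff_distr_eq_PiM'[OF \<open>I \<noteq> {}\<close> Y] by simp
  have "distr M (\<Pi>\<^sub>M j\<in>{..<J}. borel) (Y q) =
      (\<Pi>\<^sub>M j\<in>{..<J}. distr (density lborel (normal_density 0 (sqrt (1 / real m)))) borel (\<lambda>x. x))" if q: "q \<in> I" for q
  proof -
    define \<tau> where "\<tau> k = real k / real m" for k
    have "0 \<le> \<tau> 0" "mono \<tau>" by (auto simp: \<tau>_def mono_def divide_right_mono)
    then have "indep_vars (\<lambda>_. borel) (\<lambda>k \<omega>. B q (\<tau> (Suc k)) \<omega> - B q (\<tau> k) \<omega>) {..<J}"
      using bm[OF q] unfolding standard_brownian_motion_def by blast
    then have "indep_vars (\<lambda>_. borel) (X q) {..<J}" by (simp add: X_def[abs_def] \<tau>_def)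
    then have "distr M (\<Pi>\<^sub>M j\<in>{..<J}. borel) (Y q) = (\<Pi>\<^sub>M j\<in>{..<J}. distr M borel (X q j))"
      unfolding Y_def[abs_def] using indep_vars_iff_distr_eq_PiM'[where I = "{..<J}" and M' = "\<lambda>_. borel" and X = "X q"] J X[OF q] by auto
    also have "\<dots> = (\<Pi>\<^sub>M j\<in>{..<J}. distr (density lborel (normal_density 0 (sqrt (1 / real m)))) borel (\<lambda>x. x))"
    proof (rule PiM_cong)
      fix j
      have "real j / real m < real (Suc j) / real m" using m by (simp add: divide_strict_right_mono)
      moreover have "real (Suc j) / real m - real j / real m = 1 / real m"
        by (simp add: diff_divide_distrib[symmetric])
      ultimately have "distributed M lborel (X q j) (normal_density 0 (sqrt (1 / real m)))"
        using bm[OF q] unfolding standard_brownian_motion_def X_def by (metis divide_nonneg_nonneg of_nat_0_le_iff)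
      then have "distr M lborel (X q j) = density lborel (normal_density 0 (sqrt (1 / real m)))"
        unfolding distributed_def by simp
      \<comment> \<open>\<open>distributed\<close> has target \<open>lborel\<close>, while the
        product of laws has factors with target \<open>borel\<close>; the identity image turns one
        into the other.\<close>
      then have "distr (density lborel (normal_density 0 (sqrt (1 / real m)))) borel (\<lambda>x. x) =
          distr (distr M lborel (X q j)) borel (\<lambda>x. x)" by simp
      also have "\<dots> = distr M borel (X q j)"
        using X[OF q] by (subst distr_distr) (auto simp: comp_def)
      finally show "distr M borel (X q j) = distr (density lborel (normal_density 0 (sqrt (1 / real m)))) borel (\<lambda>x. x)" ..
    qed simp
    finally show ?thesis .
  qed
  with 1 show "distr M (\<Pi>\<^sub>M q\<in>I. \<Pi>\<^sub>M j\<in>{..<J}. borel) A =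
      (\<Pi>\<^sub>M q\<in>I. \<Pi>\<^sub>M j\<in>{..<J}. distr (density lborel (normal_density 0 (sqrt (1 / real m)))) borel (\<lambda>x. x))"
    by (simp cong: PiM_cong)
qed

lemma integral_clip_brownian:
  fixes B :: "nat \<times> nat \<Rightarrow> real \<Rightarrow> 'w \<Rightarrow> real" and H :: "(real \<Rightarrow> nat \<times> nat \<Rightarrow> real) \<Rightarrow> real"
  assumes M: "prob_space M" and B: "multidim_brownian_motion M (tri N) B" and N: "1 \<le> N" and m: "0 < m" and J: "0 < J"
    and H: "H \<in> borel_measurable (cadlag_space (tri N))"
  shows "(\<integral>\<omega>. H (clip_path N m J (grid_incr m (\<lambda>t\<in>{0..}. \<lambda>q\<in>tri N. B q t \<omega>))) \<partial>M) =
    (\<integral>x. H (clip_path N m J (\<lambda>j q. x q j)) \<partial>(\<Pi>\<^sub>M q\<in>tri N. \<Pi>\<^sub>M j\<in>{..<J}. distr (density lborel (normal_density 0 (sqrt (1 / real m)))) borel (\<lambda>x. x)))"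
proof -
  define A where "A = (\<lambda>\<omega>. \<lambda>q\<in>tri N. \<lambda>j\<in>{..<J}. B q (real (Suc j) / real m) \<omega> - B q (real j / real m) \<omega>)"
  have ne: "tri N \<noteq> {}" using N by (auto simp: tri_def)
  note A = brownian_increments_law[OF M B ne m J, folded A_def]
  have meas: "(\<lambda>x. clip_path N m J (\<lambda>j q. x q j)) \<in> measurable (\<Pi>\<^sub>M q\<in>tri N. \<Pi>\<^sub>M j\<in>{..<J}. borel) (cadlag_space (tri N))"
  proof (rule clip_path_measurable)
    fix j q assume "j < J" "q \<in> tri N"
    then show "(\<lambda>x. x q j) \<in> borel_measurable (\<Pi>\<^sub>M q\<in>tri N. \<Pi>\<^sub>M j\<in>{..<J}. borel)"
      by (intro measurable_compose[where g = "\<lambda>x. x j", OF measurable_component_singleton[of q] measurable_component_singleton]) auto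
  qed
  have "clip_path N m J (grid_incr m (\<lambda>t\<in>{0..}. \<lambda>q\<in>tri N. B q t \<omega>)) = clip_path N m J (\<lambda>j q. A \<omega> q j)" for \<omega>
    by (rule clip_path_cong) (auto simp: grid_incr_def A_def divide_nonneg_nonneg)
  then show ?thesis
    using integral_distr[OF A(1) measurable_compose[OF meas H]] unfolding A(2) by simp
qed

text \<open>A path more than \<open>\<eta>\<close> away from a barrier avoids it, and a continuous
  path has jumps below every positive \<open>\<delta>\<close>. An infinite barrier is always
  avoided, which matches the guards for absent neighbours.\<close>

lemma reflected_imp_near_reflected:
  assumes refl: "\<And>k i. k \<in> {1..N} \<Longrightarrow> i \<in> {1..k} \<Longrightarrow> reflected_path (b (i, k))
      (\<lambda>t. if i > 1 then ereal (w (i - 1, k - 1) t) else - \<infinity>)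
      (\<lambda>t. if i < k then ereal (w (i, k - 1) t) else \<infinity>) (w (i, k))"
    and "0 \<le> \<eta>" "0 < \<delta>"
  shows "near_reflected N T \<eta> \<delta> (\<lambda>t\<in>{0..}. \<lambda>q\<in>tri N. b q t) (\<lambda>t\<in>{0..}. \<lambda>q\<in>tri N. w q t)"
  unfolding near_reflected_def
proof (intro ballI conjI impI allI)
  fix k i assume ki: "k \<in> {1..N}" "i \<in> {1..k}"
  then have q: "(i, k) \<in> tri N" by (auto simp: tri_def)
  have ql: "(i - 1, k - 1) \<in> tri N" if "1 < i" using ki that by (auto simp: tri_def)
  have qu: "(i, k - 1) \<in> tri N" if "i < k" using ki that by (auto simp: tri_def)
  note R = refl[OF ki, unfolded reflected_path_def]
  let ?w = "\<lambda>t\<in>{0..}. \<lambda>q\<in>tri N. w q t" and ?b = "\<lambda>t\<in>{0..}. \<lambda>q\<in>tri N. b q t"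
  show "?w t (i - 1, k - 1) \<le> ?w t (i, k)" if "1 < i" "t \<in> {0..T}" for t
    using R[THEN conjunct2, THEN conjunct1, rule_format, of t] that q ql by simp
  show "?w t (i, k) \<le> ?w t (i, k - 1)" if "i < k" "t \<in> {0..T}" for t
    using R[THEN conjunct2, THEN conjunct1, rule_format, of t] that q qu by simp
  show "?w s (i, k) - ?b s (i, k) \<le> ?w t (i, k) - ?b t (i, k)"
    if st: "0 \<le> s \<and> s \<le> t \<and> t \<le> T \<and> (i < k \<longrightarrow> (\<forall>r\<in>{s<..t}. ?w r (i, k) + \<eta> < ?w r (i, k - 1)))" for s t
  proof -
    have "ereal (w (i, k) r) < (if i < k then ereal (w (i, k - 1) r) else \<infinity>)" if r: "r \<in> {s<..t}" for r
    proof (cases "i < k")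
      case True
      with st r have "?w r (i, k) + \<eta> < ?w r (i, k - 1)" by blast
      then show ?thesis using True r st q qu \<open>0 \<le> \<eta>\<close> by simp
    qed simp
    then show ?thesis
      using R[THEN conjunct2, THEN conjunct2, THEN conjunct1, rule_format, of s t] st q by simp
  qed
  show "?w t (i, k) - ?b t (i, k) \<le> ?w s (i, k) - ?b s (i, k)"
    if st: "0 \<le> s \<and> s \<le> t \<and> t \<le> T \<and> (1 < i \<longrightarrow> (\<forall>r\<in>{s<..t}. ?w r (i - 1, k - 1) + \<eta> < ?w r (i, k)))" for s t
  proof -
    have "(if i > 1 then ereal (w (i - 1, k - 1) r) else - \<infinity>) < ereal (w (i, k) r)" if r: "r \<in> {s<..t}" for r
    proof (cases "1 < i")
      case True
      with st r have "?w r (i - 1, k - 1) + \<eta> < ?w r (i, k)" by blast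
      then show ?thesis using True r st q ql \<open>0 \<le> \<eta>\<close> by simp
    qed simp
    then show ?thesis
      using R[THEN conjunct2, THEN conjunct2, THEN conjunct2, rule_format, of s t] st q by simp
  qed
  show "\<forall>\<^sub>F s in at_left t. \<bar>?w t (i, k) - ?w s (i, k)\<bar> \<le> \<delta>" if t: "t \<in> {0<..T}" for t
  proof -
    have "continuous (at t) (w (i, k))"
      using R t by (intro continuous_on_interior[of "{0..}"]) (auto simp: interior_real_atLeast)
    then have "(w (i, k) \<longlongrightarrow> w (i, k) t) (at_left t)"
      using continuous_at_imp_continuous_at_within continuous_within by blast
    then have "\<forall>\<^sub>F s in at_left t. dist (w (i, k) s) (w (i, k) t) < \<delta>"
      using \<open>0 < \<delta>\<close> by (intro tendstoD) auto
    moreover have "\<forall>\<^sub>F s in at_left t. 0 < s"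
      unfolding eventually_at_left_field using t by (intro exI[of _ 0]) auto
    ultimately show ?thesis
      by eventually_elim (use t q in \<open>auto simp: dist_real_def abs_minus_commute\<close>)
  qed
qed

section \<open>Measurability of walks and dynamics\<close>

lemma measurable_int_combine:
  fixes f :: "'w \<Rightarrow> 'x :: countable" and g :: "'w \<Rightarrow> 'y :: countable"
  assumes "f \<in> measurable M (count_space UNIV)" "g \<in> measurable M (count_space UNIV)"
  shows "(\<lambda>\<omega>. h (f \<omega>) (g \<omega>)) \<in> measurable M (count_space UNIV)"
proof (rule measurable_compose_countable[OF _ assms(1)])
  show "(\<lambda>\<omega>. h i (g \<omega>)) \<in> measurable M (count_space UNIV)" for i
    by (rule measurable_compose[OF assms(2)]) simp
qed

text \<open>The dynamics are given pathwise, with measurability known only at time 0. Induction on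
  time, and within a step on the level, exhibits every coordinate as a function of countably valued
  random variables already treated.\<close>

lemma interlacing_measurable:
  fixes X Y :: "nat \<times> nat \<Rightarrow> nat \<Rightarrow> 'w \<Rightarrow> int"
  assumes dyn: "\<And>\<omega>. \<omega> \<in> space M \<Longrightarrow> discrete_interlacing_dynamics N (\<lambda>q t. X q t \<omega>) (\<lambda>q t. Y q t \<omega>)"
    and X: "\<And>q t. q \<in> tri N \<Longrightarrow> X q t \<in> measurable M (count_space UNIV)"
    and Y0: "\<And>q. q \<in> tri N \<Longrightarrow> Y q 0 \<in> measurable M (count_space UNIV)"
  shows "q \<in> tri N \<Longrightarrow> Y q m \<in> measurable M (count_space UNIV)"
proof (induction m arbitrary: q)
  case 0 then show ?case by (rule Y0)
next
  case (Suc m)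
  \<comment> \<open>On this event no update takes place, so the recursion has to be split along
    it.\<close>
  define S where "S = {\<omega> \<in> space M. \<forall>q\<in>tri N. X q (Suc m) \<omega> = X q m \<omega>}"
  have S: "S \<in> sets M"
    unfolding S_def
  proof (rule sets.sets_Collect_finite_All[OF _ finite_tri])
    fix q assume q: "q \<in> tri N"
    have "(\<lambda>\<omega>. X q (Suc m) \<omega> = X q m \<omega>) \<in> measurable M (count_space UNIV)"
      by (rule measurable_int_combine[OF X X]) (use q in auto)
    then show "{\<omega> \<in> space M. X q (Suc m) \<omega> = X q m \<omega>} \<in> sets M" by (simp add: pred_def)
  qed
  have step: "(\<lambda>\<omega>. if \<omega> \<in> S then Y q m \<omega> else f \<omega>) \<in> measurable M (count_space UNIV)"
    if "f \<in> measurable M (count_space UNIV)" "q \<in> tri N" for f q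
    using that S sets.sets_into_space[OF S] by (intro measurable_If Suc.IH) (auto simp: Int_absorb1 Collect_conj_eq)
  have stay: "Y q (Suc m) \<omega> = Y q m \<omega>" if "\<omega> \<in> S" "q \<in> tri N" for \<omega> q
    using discrete_interlacing_dynamicsD(2)[OF dyn, of \<omega> m] that by (auto simp: S_def)
  have upd: "gt_update N (\<lambda>q. Y q m \<omega>) (\<lambda>q. X q (Suc m) \<omega> - X q m \<omega>) (\<lambda>q. Y q (Suc m) \<omega>)"
    if "\<omega> \<in> space M" "\<omega> \<notin> S" for \<omega>
    using discrete_interlacing_dynamicsD(2)[OF dyn[OF that(1)], of m] that by (auto simp: S_def split: if_splits)
  have dX: "(\<lambda>\<omega>. X q (Suc m) \<omega> - X q m \<omega>) \<in> measurable M (count_space UNIV)" if "q \<in> tri N" for q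
    by (rule measurable_int_combine[OF X X]) (use that in auto)
  have "Y (i, k) (Suc m) \<in> measurable M (count_space UNIV)" if "k \<le> N" "i \<in> {1..k}" for i k
    using that
  proof (induction k arbitrary: i)
    case (Suc k)
    have q: "(i, Suc k) \<in> tri N" using Suc.prems by (auto simp: tri_def)
    note IHm = \<open>\<And>q. q \<in> tri N \<Longrightarrow> Y q m \<in> measurable M (count_space UNIV)\<close>
    show ?case
    proof (cases "k = 0")
      case True
      then have i: "(i, Suc k) = (1, 1)" using Suc.prems by simp
      have "(\<lambda>\<omega>. if \<omega> \<in> S then Y (1, 1) m \<omega> else Y (1, 1) m \<omega> + (X (1, 1) (Suc m) \<omega> - X (1, 1) m \<omega>))
          \<in> measurable M (count_space UNIV)"
        using q unfolding i by (intro step measurable_int_combine[where h = "(+)"] IHm dX)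
      moreover have "Y (1, 1) (Suc m) \<omega> = (if \<omega> \<in> S then Y (1, 1) m \<omega> else Y (1, 1) m \<omega> + (X (1, 1) (Suc m) \<omega> - X (1, 1) m \<omega>))"
        if "\<omega> \<in> space M" for \<omega>
        using stay[of \<omega> "(1, 1)"] upd[OF that] q Suc.prems(1) unfolding i by (auto simp: gt_update_def)
      ultimately show ?thesis unfolding i by (subst measurable_cong) auto
    next
      case False
      then have k: "Suc k \<in> {2..N}" using Suc.prems by auto
      \<comment> \<open>Outside the triangle nothing is known about \<open>Y\<close>. The value 0
        for an absent neighbour is a placeholder behind the guards of \<open>h\<close>.\<close>
      define l where "l \<omega> = (if 1 < i then Y (i - 1, k) (Suc m) \<omega> else 0)" for \<omega>
      define u where "u \<omega> = (if i < Suc k then Y (i, k) (Suc m) \<omega> else 0)" for \<omega>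
      have l: "l \<in> measurable M (count_space UNIV)"
      proof (cases "1 < i")
        case True
        then have "i - 1 \<in> {1..k}" using Suc.prems by auto
        then show ?thesis using Suc.IH Suc.prems True by (simp add: l_def[abs_def])
      qed (simp add: l_def[abs_def])
      have u: "u \<in> measurable M (count_space UNIV)"
        using Suc.IH[of i] Suc.prems by (cases "i < Suc k") (auto simp: u_def[abs_def])
      define h :: "int \<times> int \<Rightarrow> int \<times> int \<Rightarrow> int" where "h = (\<lambda>(y, dx) (l, u).
        (if i > 1 \<and> y = l - 1 then y + 1
        else if i < Suc k \<and> y = u then y - 1
        else if dx = 1 then (if i < Suc k \<and> u = y + 1 then y else y + 1)
        else if dx = - 1 then (if i > 1 \<and> l = y then y else y - 1)
        else y))"
      have "(\<lambda>\<omega>. if \<omega> \<in> S then Y (i, Suc k) m \<omega> else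
          h (Y (i, Suc k) m \<omega>, X (i, Suc k) (Suc m) \<omega> - X (i, Suc k) m \<omega>) (l \<omega>, u \<omega>)) \<in> measurable M (count_space UNIV)"
        using q by (intro step measurable_int_combine[where h = h] measurable_int_combine[where h = Pair] IHm dX l u)
      moreover have "Y (i, Suc k) (Suc m) \<omega> = (if \<omega> \<in> S then Y (i, Suc k) m \<omega> else
          h (Y (i, Suc k) m \<omega>, X (i, Suc k) (Suc m) \<omega> - X (i, Suc k) m \<omega>) (l \<omega>, u \<omega>))" if \<omega>: "\<omega> \<in> space M" for \<omega>
      proof (cases "\<omega> \<in> S")
        case True
        then show ?thesis using stay q by simp
      next
        case False
        from upd[OF \<omega> False, unfolded gt_update_def, THEN conjunct2, THEN bspec, OF k, THEN bspec, OF Suc.prems(2)]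
        show ?thesis using False by (simp add: h_def l_def u_def)
      qed
      ultimately show ?thesis by (subst measurable_cong) auto
    qed
  qed simp
  then show ?case using Suc.prems by (auto simp: tri_def)
qed

lemma simple_random_walk_measurable:
  assumes "prob_space M" "simple_random_walk M d p S"
  shows "S m \<in> measurable M (count_space UNIV)"
proof -
  interpret prob_space M by fact
  have *: "random_variable (count_space UNIV) (\<lambda>\<omega>. case t of 0 \<Rightarrow> S 0 \<omega> | Suc m \<Rightarrow> S (Suc m) \<omega> - S m \<omega>)" for t
    using assms(2) unfolding simple_random_walk_def indep_vars_def by auto
  show ?thesis
  proof (induction m)
    case 0 show ?case using *[of 0] by simp
  next
    case (Suc m)
    have "(\<lambda>\<omega>. S m \<omega> + (S (Suc m) \<omega> - S m \<omega>)) \<in> measurable M (count_space UNIV)"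
      using *[of "Suc m"] by (intro measurable_int_combine[where h = "(+)"] Suc.IH) simp
    then show ?case by simp
  qed
qed

lemma simple_random_walk_steps:
  assumes "prob_space M" "simple_random_walk M d p S"
  shows "AE \<omega> in M. \<forall>m. S (Suc m) \<omega> - S m \<omega> \<in> {1, d}"
  unfolding AE_all_countable
proof
  fix m
  have "AE x in distr M (count_space UNIV) (\<lambda>\<omega>. S (Suc m) \<omega> - S m \<omega>). x \<in> {1, d}"
  proof -
    have "distr M (count_space UNIV) (\<lambda>\<omega>. S (Suc m) \<omega> - S m \<omega>) =
        measure_pmf (map_pmf (\<lambda>h. if h then 1 else d) (bernoulli_pmf p))"
      using assms(2) unfolding simple_random_walk_def by blast
    then show ?thesis by (simp only: AE_measure_pmf_iff) auto
  qed
  moreover have "(\<lambda>\<omega>. S (Suc m) \<omega> - S m \<omega>) \<in> measurable M (count_space UNIV)"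
    by (intro measurable_int_combine[where h = "(-)"] simple_random_walk_measurable[OF assms])
  ultimately show "AE \<omega> in M. S (Suc m) \<omega> - S m \<omega> \<in> {1, d}"
    by (subst (asm) AE_distr_iff) auto
qed

section \<open>Convergence\<close>

text \<open>The expectation of \<open>clip_path_error\<close>. It serves twice: for the walks with
  the particle dynamics, and for \<open>W\<close> with its own Brownian motion. After integration
  the two estimates can be chained although they live on different spaces.\<close>

lemma clip_coupling:
  fixes T :: nat and f w :: "'w \<Rightarrow> real \<Rightarrow> nat \<times> nat \<Rightarrow> real"
  assumes M: "prob_space M" and N: "1 \<le> N" and m: "0 < m"
    and f: "f \<in> measurable M (cadlag_space (tri N))" and w: "w \<in> measurable M (cadlag_space (tri N))"
    and refl: "AE \<omega> in M. near_reflected N (real T) \<eta> (2 * \<eta>) (f \<omega>) (w \<omega>)" and \<eta>: "0 < \<eta>"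
    and H: "H \<in> borel_measurable (cadlag_space (tri N))" and c: "\<forall>f\<in>cadlag_paths (tri N). \<bar>H f\<bar> \<le> c" and L: "0 \<le> L"
    and Lip: "\<forall>f\<in>cadlag_paths (tri N). \<forall>g\<in>cadlag_paths (tri N). \<bar>H f - H g\<bar> \<le> L * cdist (tri N) (real T) f g"
  shows "\<bar>(\<integral>\<omega>. H (w \<omega>) \<partial>M) - (\<integral>\<omega>. H (clip_path N m (m * T) (grid_incr m (f \<omega>))) \<partial>M)\<bar>
    \<le> L * (real (card (tri N)) * (5 * real N + 1)) *
      ((\<integral>\<omega>. min 1 (\<Sum>q\<in>tri N. \<bar>w \<omega> 0 q\<bar>) \<partial>M) + \<eta> + (\<integral>\<omega>. osc (tri N) m (real T) (f \<omega>) \<partial>M))"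
proof -
  interpret prob_space M by fact
  let ?V = "\<lambda>f. clip_path N m (m * T) (grid_incr m f)"
  let ?C = "L * (real (card (tri N)) * (5 * real N + 1))"
  have path: "w \<omega> \<in> cadlag_paths (tri N)" if "\<omega> \<in> space M" for \<omega>
    using measurable_space[OF w that] by (simp add: space_cadlag_space)
  have V: "(\<lambda>\<omega>. ?V (f \<omega>)) \<in> measurable M (cadlag_space (tri N))"
    unfolding grid_incr_def
    by (intro clip_path_measurable borel_measurable_diff measurable_compose[OF f measurable_cadlag_coord]) auto
  have int1: "integrable M (\<lambda>\<omega>. H (w \<omega>))" by (rule integrable_bounded_path_functional[OF M w H c])
  have int2: "integrable M (\<lambda>\<omega>. H (?V (f \<omega>)))" by (rule integrable_bounded_path_functional[OF M V H c])
  have int3: "integrable M (\<lambda>\<omega>. min 1 (\<Sum>q\<in>tri N. \<bar>w \<omega> 0 q\<bar>))"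
  proof (rule integrable_const_bound[of _ 1])
    show "(\<lambda>\<omega>. min 1 (\<Sum>q\<in>tri N. \<bar>w \<omega> 0 q\<bar>)) \<in> borel_measurable M"
      by (intro borel_measurable_min borel_measurable_sum borel_measurable_abs
          measurable_compose[OF w measurable_cadlag_coord]) auto
  qed (auto intro!: AE_I2 simp: sum_nonneg abs_of_nonneg)
  have int4: "integrable M (\<lambda>\<omega>. osc (tri N) m (real T) (f \<omega>))"
  proof (rule integrable_const_bound[of _ 2])
    show "(\<lambda>\<omega>. osc (tri N) m (real T) (f \<omega>)) \<in> borel_measurable M"
      by (rule measurable_compose[OF f osc_measurable]) (use finite_tri m in auto)
  qed (simp add: abs_osc_le)
  let ?E = "\<lambda>\<omega>. ?C * (min 1 (\<Sum>q\<in>tri N. \<bar>w \<omega> 0 q\<bar>) + \<eta> + osc (tri N) m (real T) (f \<omega>))"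
  have intE: "integrable M ?E" using int3 int4 by auto
  have "AE \<omega> in M. \<bar>H (w \<omega>) - H (?V (f \<omega>))\<bar> \<le> ?E \<omega>"
    using refl AE_space
  proof eventually_elim
    case (elim \<omega>)
    have "\<bar>H (w \<omega>) - H (?V (f \<omega>))\<bar> \<le> L * cdist (tri N) (real T) (w \<omega>) (?V (f \<omega>))"
      using Lip path[OF elim(2)] clip_path_cadlag by blast
    also have "\<dots> \<le> L * ((real (card (tri N)) * (5 * real N + 1)) *
      (min 1 (\<Sum>q\<in>tri N. \<bar>w \<omega> 0 q\<bar>) + \<eta> + osc (tri N) m (real T) (f \<omega>)))"
      by (intro mult_left_mono clip_path_error N m elim \<eta> L)
    finally show ?case by (simp only: mult.assoc)
  qed
  then have "(\<integral>\<omega>. \<bar>H (w \<omega>) - H (?V (f \<omega>))\<bar> \<partial>M) \<le> (\<integral>\<omega>. ?E \<omega> \<partial>M)"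
    using int1 int2 intE by (intro integral_mono_AE) auto
  moreover have "\<bar>(\<integral>\<omega>. H (w \<omega>) - H (?V (f \<omega>)) \<partial>M)\<bar> \<le> (\<integral>\<omega>. \<bar>H (w \<omega>) - H (?V (f \<omega>))\<bar> \<partial>M)"
    by (rule integral_abs_bound)
  moreover have "(\<integral>\<omega>. H (w \<omega>) - H (?V (f \<omega>)) \<partial>M) = (\<integral>\<omega>. H (w \<omega>) \<partial>M) - (\<integral>\<omega>. H (?V (f \<omega>)) \<partial>M)"
    using int1 int2 by (rule Bochner_Integration.integral_diff)
  moreover have "(\<integral>\<omega>. ?E \<omega> \<partial>M) = ?C * ((\<integral>\<omega>. min 1 (\<Sum>q\<in>tri N. \<bar>w \<omega> 0 q\<bar>) \<partial>M) + \<eta> + (\<integral>\<omega>. osc (tri N) m (real T) (f \<omega>) \<partial>M))"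
    using int3 int4 by (simp add: prob_space)
  ultimately show ?thesis by linarith
qed

lemma integral_osc_tendsto_0:
  assumes M: "prob_space M" and I: "finite I" and T: "0 \<le> T" and f: "f \<in> measurable M (cadlag_space I)"
    and cont: "\<And>\<omega> p. \<omega> \<in> space M \<Longrightarrow> p \<in> I \<Longrightarrow> continuous_on {0..} (\<lambda>t. f \<omega> t p)"
  shows "(\<lambda>m. \<integral>\<omega>. osc I (Suc m) T (f \<omega>) \<partial>M) \<longlonglongrightarrow> 0"
proof -
  interpret prob_space M by fact
  have "(\<lambda>m. \<integral>\<omega>. osc I (Suc m) T (f \<omega>) \<partial>M) \<longlonglongrightarrow> (\<integral>\<omega>. 0 \<partial>M)"
  proof (rule integral_dominated_convergence[where w = "\<lambda>_. 2"])
    show "AE \<omega> in M. (\<lambda>m. osc I (Suc m) T (f \<omega>)) \<longlonglongrightarrow> 0"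
      using cont by (intro AE_I2 LIMSEQ_Suc osc_tendsto_0[OF I T]) auto
    show "AE \<omega> in M. norm (osc I (Suc m) T (f \<omega>)) \<le> 2" for m
      using T by (simp add: abs_osc_le)
    show "(\<lambda>\<omega>. osc I (Suc m) T (f \<omega>)) \<in> borel_measurable M" for m
      by (rule measurable_compose[OF f osc_measurable[OF I T]])
  qed auto
  then show ?thesis by simp
qed

lemma continuous_path_measurable:
  assumes "\<And>q t. q \<in> I \<Longrightarrow> 0 \<le> t \<Longrightarrow> B q t \<in> borel_measurable M"
    and "\<And>\<omega> q. \<omega> \<in> space M \<Longrightarrow> q \<in> I \<Longrightarrow> continuous_on {0..} (\<lambda>t. B q t \<omega>)"
  shows "(\<lambda>\<omega>. \<lambda>t\<in>{0..}. \<lambda>q\<in>I. B q t \<omega>) \<in> measurable M (cadlag_space I)"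
proof (rule measurable_cadlagI)
  fix \<omega> assume \<omega>: "\<omega> \<in> space M"
  show "(\<lambda>t\<in>{0..}. \<lambda>q\<in>I. B q t \<omega>) \<in> cadlag_paths I"
  proof (rule cadlag_pathsI)
    fix t :: real and q assume q: "q \<in> I"
    have *: "((\<lambda>t. B q t \<omega>) \<longlongrightarrow> B q t \<omega>) (at t within {0..})" if "0 \<le> t"
      using assms(2)[OF \<omega> q] that by (auto simp: continuous_on_def)
    show "((\<lambda>s. B q s \<omega>) \<longlongrightarrow> B q t \<omega>) (at_right t)" if "0 \<le> t"
      by (rule tendsto_within_subset[OF *[OF that]]) (use that in auto)
    show "\<exists>l. ((\<lambda>s. B q s \<omega>) \<longlongrightarrow> l) (at_left t)" if "0 < t"
    proof -
      have "continuous (at t) (\<lambda>t. B q t \<omega>)"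
        using assms(2)[OF \<omega> q] that by (intro continuous_on_interior[of "{0..}"]) (auto simp: interior_real_atLeast)
      then show ?thesis using continuous_at_imp_continuous_at_within continuous_within by blast
    qed
  qed
next
  fix t :: real and q assume "0 \<le> t" "q \<in> I"
  then show "(\<lambda>\<omega>. (\<lambda>t\<in>{0..}. \<lambda>q\<in>I. B q t \<omega>) t q) \<in> borel_measurable M"
    using assms(1) by simp
qed

lemma brownian_path_measurable:
  assumes "multidim_brownian_motion M I B"
  shows "(\<lambda>\<omega>. \<lambda>t\<in>{0..}. \<lambda>q\<in>I. B q t \<omega>) \<in> measurable M (cadlag_space I)"
  by (rule continuous_path_measurable)
    (use assms in \<open>auto simp: multidim_brownian_motion_def standard_brownian_motion_def\<close>)

lemma weak_convergenceD:
  assumes "weak_convergence T (\<lambda>n. distr M S (Z n)) (distr M' S Z')"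
    and "\<And>n. Z n \<in> measurable M S" "Z' \<in> measurable M' S"
    and "continuous_map T euclideanreal F" "F \<in> borel_measurable S" "\<forall>x\<in>topspace T. \<bar>F x\<bar> \<le> c"
  shows "(\<lambda>n. \<integral>\<omega>. F (Z n \<omega>) \<partial>M) \<longlonglongrightarrow> (\<integral>\<omega>. F (Z' \<omega>) \<partial>M')"
proof -
  have "(\<lambda>n. \<integral>x. F x \<partial>distr M S (Z n)) \<longlonglongrightarrow> (\<integral>x. F x \<partial>distr M' S Z')"
    using assms(1,4,5,6) unfolding weak_convergence_def by auto
  then show ?thesis using assms by (simp add: integral_distr)
qed

theorem mainTheorem3:
  fixes N :: nat
    and M :: "'a measure" and X Y :: "nat \<times> nat \<Rightarrow> nat \<Rightarrow> 'a \<Rightarrow> int"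
    and MB :: "'b measure" and B :: "nat \<times> nat \<Rightarrow> real \<Rightarrow> 'b \<Rightarrow> real"
    and MW :: "'c measure" and W :: "nat \<times> nat \<Rightarrow> real \<Rightarrow> 'c \<Rightarrow> real"
    and a :: "nat \<Rightarrow> real \<Rightarrow> real" and b :: "nat \<Rightarrow> real"
    and d :: int and p :: real
  assumes "N \<ge> 1"
    and "prob_space M" and "prob_space MB" and "prob_space MW"
    and "d \<in> {-1, 0}" and "0 < p" and "p < 1"
    and "independent_simple_random_walks M d p (tri N) X"
    and "\<And>\<omega>. \<omega> \<in> space M \<Longrightarrow>
           discrete_interlacing_dynamics N (\<lambda>q t. X q t \<omega>) (\<lambda>q t. Y q t \<omega>)"
    and "independent_rvs M
           (\<Pi>\<^sub>M q\<in>tri N. count_space UNIV) (\<lambda>\<omega>. \<lambda>q\<in>tri N. Y q 0 \<omega>)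
           (\<Pi>\<^sub>M t\<in>UNIV. \<Pi>\<^sub>M q\<in>tri N. count_space UNIV)
             (\<lambda>\<omega> t. \<lambda>q\<in>tri N. X q (Suc t) \<omega> - X q t \<omega>)"
    and "\<And>n. continuous_on {0..} (a n)"
    and "\<And>n. b n > 0" and "filterlim b at_top sequentially"
    and "multidim_brownian_motion MB (tri N) B"
    and "weak_convergence (cadlag_topology (tri N))
           (\<lambda>n. path_law M (tri N)
              (\<lambda>q t \<omega>. (real_of_int (X q (nat \<lfloor>real n * t\<rfloor>) \<omega>) - a n t) / b n))
           (path_law MB (tri N) B)"
    and "weak_convergence (product_topology (\<lambda>_. euclideanreal) (tri N))
           (\<lambda>n. distr M (\<Pi>\<^sub>M q\<in>tri N. borel)
              (\<lambda>\<omega>. \<lambda>q\<in>tri N. (real_of_int (Y q 0 \<omega>) - a n 0) / b n))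
           (return (\<Pi>\<^sub>M q\<in>tri N. borel) (\<lambda>q\<in>tri N. 0))"
    and "warren_process MW N W" and "started_from_zero MW N W"
  shows "weak_convergence (cadlag_topology (tri N))
           (\<lambda>n. path_law M (tri N)
              (\<lambda>q t \<omega>. (real_of_int (Y q (nat \<lfloor>real n * t\<rfloor>) \<omega>) - a n t) / b n))
           (path_law MW (tri N) W)"
proof -
  let ?I = "tri N"
  note N = \<open>N \<ge> 1\<close> and M = \<open>prob_space M\<close> and MB = \<open>prob_space MB\<close> and MW = \<open>prob_space MW\<close>
  interpret M: prob_space M by fact
  interpret MB: prob_space MB by fact
  interpret MW: prob_space MW by fact
  have walk: "simple_random_walk M d p (X q)" if "q \<in> ?I" for q
    using assms(8) that by (simp add: independent_simple_random_walks_def)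
  have X: "X q t \<in> measurable M (count_space UNIV)" if "q \<in> ?I" for q t
    by (rule simple_random_walk_measurable[OF M walk[OF that]])
  \<comment> \<open>The law of a walk fixes its steps only almost surely, so the dynamics are
    approximately reflected off a null set.\<close>
  have dX: "AE \<omega> in M. \<forall>q\<in>?I. \<forall>m. X q (Suc m) \<omega> - X q m \<omega> \<in> {- 1, 0, 1}"
  proof (rule AE_finite_allI[OF finite_tri])
    fix q assume "q \<in> ?I"
    then have "AE \<omega> in M. \<forall>m. X q (Suc m) \<omega> - X q m \<omega> \<in> {1, d}"
      by (rule simple_random_walk_steps[OF M walk])
    then show "AE \<omega> in M. \<forall>m. X q (Suc m) \<omega> - X q m \<omega> \<in> {- 1, 0, 1}"
      by eventually_elim (use \<open>d \<in> {-1, 0}\<close> in auto)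
  qed
  have Y0: "Y q 0 \<in> measurable M (count_space UNIV)" if q: "q \<in> ?I" for q
  proof -
    have "(\<lambda>\<omega>. \<lambda>q\<in>?I. Y q 0 \<omega>) \<in> measurable M (\<Pi>\<^sub>M q\<in>?I. count_space UNIV)"
      using assms(10) by (simp add: independent_rvs_def)
    from measurable_compose[OF this measurable_component_singleton[OF q]] q show ?thesis by simp
  qed
  have Y: "Y q t \<in> measurable M (count_space UNIV)" if "q \<in> ?I" for q t
    using assms(9) X Y0 that by (rule interlacing_measurable)
  define PX where "PX n \<omega> = (\<lambda>t\<in>{0..}. \<lambda>q\<in>?I. (real_of_int (X q (nat \<lfloor>real n * t\<rfloor>) \<omega>) - a n t) / b n)" for n \<omega>
  define PY where "PY n \<omega> = (\<lambda>t\<in>{0..}. \<lambda>q\<in>?I. (real_of_int (Y q (nat \<lfloor>real n * t\<rfloor>) \<omega>) - a n t) / b n)" for n \<omega>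
  define PB where "PB \<omega> = (\<lambda>t\<in>{0..}. \<lambda>q\<in>?I. B q t \<omega>)" for \<omega>
  define PW where "PW \<omega> = (\<lambda>t\<in>{0..}. \<lambda>q\<in>?I. W q t \<omega>)" for \<omega>
  have rescaled: "(\<lambda>\<omega>. \<lambda>t\<in>{0..}. \<lambda>q\<in>?I. (real_of_int (Z q (nat \<lfloor>real n * t\<rfloor>) \<omega>) - a n t) / b n) \<in> measurable M (cadlag_space ?I)"
    if Z: "\<And>q t. q \<in> ?I \<Longrightarrow> Z q t \<in> measurable M (count_space UNIV)" for Z n
  proof (rule measurable_cadlagI[OF step_minus_continuous_cadlag[OF assms(11)]])
    fix t :: real and q assume tq: "0 \<le> t" "q \<in> ?I"
    have "(\<lambda>\<omega>. real_of_int (Z q (nat \<lfloor>real n * t\<rfloor>) \<omega>)) \<in> borel_measurable M"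
      by (rule measurable_compose[OF Z[OF tq(2)]]) simp
    then show "(\<lambda>\<omega>. (\<lambda>t\<in>{0..}. \<lambda>q\<in>?I. (real_of_int (Z q (nat \<lfloor>real n * t\<rfloor>) \<omega>) - a n t) / b n) t q) \<in> borel_measurable M"
      using tq by simp
  qed
  have PX: "PX n \<in> measurable M (cadlag_space ?I)" for n unfolding PX_def by (rule rescaled[OF X])
  have PY: "PY n \<in> measurable M (cadlag_space ?I)" for n unfolding PY_def by (rule rescaled[OF Y])
  have PB: "PB \<in> measurable MB (cadlag_space ?I)" unfolding PB_def by (rule brownian_path_measurable[OF assms(14)])
  have W: "\<And>q t. q \<in> ?I \<Longrightarrow> 0 \<le> t \<Longrightarrow> W q t \<in> borel_measurable MW"
    "\<And>q \<omega>. q \<in> ?I \<Longrightarrow> \<omega> \<in> space MW \<Longrightarrow> continuous_on {0..} (\<lambda>t. W q t \<omega>)"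
    using assms(17) unfolding warren_process_def by blast+
  have PW: "PW \<in> measurable MW (cadlag_space ?I)" unfolding PW_def
    by (rule continuous_path_measurable) (use W in auto)
  \<comment> \<open>The Brownian motion driving \<open>W\<close>. It is related to \<open>B\<close>,
    the limit of the walks, by its law alone.\<close>
  obtain B' where B': "multidim_brownian_motion MW ?I B'"
    and refl: "AE \<omega> in MW. \<forall>k\<in>{1..N}. \<forall>i\<in>{1..k}. reflected_path (\<lambda>t. B' (i, k) t \<omega>)
             (\<lambda>t. if i > 1 then ereal (W (i - 1, k - 1) t \<omega>) else - \<infinity>)
             (\<lambda>t. if i < k then ereal (W (i, k - 1) t \<omega>) else \<infinity>) (\<lambda>t. W (i, k) t \<omega>)"
    using assms(17) unfolding warren_process_def by blast
  define PB' where "PB' \<omega> = (\<lambda>t\<in>{0..}. \<lambda>q\<in>?I. B' q t \<omega>)" for \<omega>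
  have PB': "PB' \<in> measurable MW (cadlag_space ?I)" unfolding PB'_def by (rule brownian_path_measurable[OF B'])
  have cont_restrict: "continuous_on {0..} (\<lambda>t. (\<lambda>t\<in>{0..}. \<lambda>q\<in>?I. Z q t) t q)"
    if "continuous_on {0..} (Z q)" "q \<in> ?I" for Z and q
    using that by (auto intro: continuous_on_eq)
  have cont: "\<omega> \<in> space MB \<Longrightarrow> q \<in> ?I \<Longrightarrow> continuous_on {0..} (\<lambda>t. PB \<omega> t q)"
    "\<omega>' \<in> space MW \<Longrightarrow> q \<in> ?I \<Longrightarrow> continuous_on {0..} (\<lambda>t. PB' \<omega>' t q)"
    "\<omega>' \<in> space MW \<Longrightarrow> q \<in> ?I \<Longrightarrow> continuous_on {0..} (\<lambda>t. PW \<omega>' t q)" for \<omega> \<omega>' q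
    unfolding PB_def PB'_def PW_def
    by (rule cont_restrict; use assms(14) B' W(2) in \<open>simp add: multidim_brownian_motion_def standard_brownian_motion_def\<close>)+
  \<comment> \<open>The truncated sum is bounded and continuous, so the weak convergence of the
    initial configurations applies to it; its value at the limit point is 0.\<close>
  have init: "(\<lambda>n. \<integral>\<omega>. min 1 (\<Sum>q\<in>?I. \<bar>PY n \<omega> 0 q\<bar>) \<partial>M) \<longlonglongrightarrow> 0"
  proof -
    let ?P = "\<Pi>\<^sub>M q\<in>?I. (borel :: real measure)"
    define F where "F x = min 1 (\<Sum>q\<in>?I. \<bar>x q\<bar>)" for x :: "nat \<times> nat \<Rightarrow> real"
    have F: "F \<in> borel_measurable ?P" unfolding F_def
      by (intro borel_measurable_min borel_measurable_sum borel_measurable_abs measurable_component_singleton) auto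
    have Fc: "continuous_map (product_topology (\<lambda>_. euclideanreal) ?I) euclideanreal F" unfolding F_def
      by (intro continuous_intros continuous_map_product_projection finite_tri) auto
    have Fb: "\<forall>x\<in>topspace (product_topology (\<lambda>_. euclideanreal) ?I). \<bar>F x\<bar> \<le> 1"
      unfolding F_def by (auto simp: sum_nonneg abs_of_nonneg)
    define Z where "Z n \<omega> = (\<lambda>q\<in>?I. (real_of_int (Y q 0 \<omega>) - a n 0) / b n)" for n \<omega>
    have Z: "Z n \<in> measurable M ?P" for n unfolding Z_def
    proof (rule measurable_restrict)
      fix q assume "q \<in> ?I"
      have "(\<lambda>\<omega>. real_of_int (Y q 0 \<omega>)) \<in> borel_measurable M"
        by (rule measurable_compose[OF Y0[OF \<open>q \<in> ?I\<close>]]) simp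
      then show "(\<lambda>\<omega>. (real_of_int (Y q 0 \<omega>) - a n 0) / b n) \<in> borel_measurable M" by simp
    qed
    have "(\<lambda>n. \<integral>x. F x \<partial>distr M ?P (Z n)) \<longlonglongrightarrow> (\<integral>x. F x \<partial>return ?P (\<lambda>q\<in>?I. 0))"
      using assms(16) Fc F Fb unfolding weak_convergence_def Z_def[abs_def] by auto
    moreover have "(\<integral>x. F x \<partial>return ?P (\<lambda>q\<in>?I. 0)) = 0"
      by (subst integral_return) (auto simp: F space_PiM F_def)
    moreover have "(\<integral>x. F x \<partial>distr M ?P (Z n)) = (\<integral>\<omega>. min 1 (\<Sum>q\<in>?I. \<bar>PY n \<omega> 0 q\<bar>) \<partial>M)" for n
      unfolding integral_distr[OF Z F] by (simp add: F_def Z_def PY_def)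
    ultimately show ?thesis by simp
  qed
  have b0: "(\<lambda>n. 1 / b n) \<longlonglongrightarrow> 0"
    using tendsto_inverse_0_at_top[OF assms(13)] by (simp add: inverse_eq_divide)
  have zero: "(\<integral>\<omega>. min 1 (\<Sum>q\<in>?I. \<bar>PW \<omega> 0 q\<bar>) \<partial>MW) = 0"
  proof -
    have "AE \<omega> in MW. min 1 (\<Sum>q\<in>?I. \<bar>PW \<omega> 0 q\<bar>) = 0"
      using assms(18) unfolding started_from_zero_def by eventually_elim (simp add: PW_def)
    then show ?thesis by (rule integral_eq_zero_AE)
  qed
  have "weak_convergence (cadlag_topology ?I) (\<lambda>n. distr M (cadlag_space ?I) (PY n)) (distr MW (cadlag_space ?I) PW)"
  proof (rule weak_convergence_cadlagI[OF finite_tri MW PW cont(3)])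
    show "prob_space (distr M (cadlag_space ?I) (PY n))" for n by (rule M.prob_space_distr[OF PY])
    show "sets (distr M (cadlag_space ?I) (PY n)) = sets (cadlag_space ?I)" for n by simp
    fix H assume "lipschitz_test ?I H"
    then obtain c T0 L where H: "H \<in> borel_measurable (cadlag_space ?I)" and c: "\<forall>f\<in>cadlag_paths ?I. \<bar>H f\<bar> \<le> c"
      and L: "0 \<le> L" and Lip0: "\<forall>f\<in>cadlag_paths ?I. \<forall>g\<in>cadlag_paths ?I. \<bar>H f - H g\<bar> \<le> L * cdist ?I (real T0) f g"
      unfolding lipschitz_test_def by blast
    \<comment> \<open>The successor ensures \<open>0 < m * T\<close>, so that the family of grid
      increments is nonempty.\<close>
    define T where "T = Suc T0"
    have Lip: "\<forall>f\<in>cadlag_paths ?I. \<forall>g\<in>cadlag_paths ?I. \<bar>H f - H g\<bar> \<le> L * cdist ?I (real T) f g"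
    proof (intro ballI)
      fix f g assume fg: "f \<in> cadlag_paths ?I" "g \<in> cadlag_paths ?I"
      have "cdist ?I (real T0) f g \<le> cdist ?I (real T) f g" by (rule cdist_mono) (auto simp: T_def)
      from mult_left_mono[OF this L] Lip0 fg show "\<bar>H f - H g\<bar> \<le> L * cdist ?I (real T) f g"
        by (meson order_trans)
    qed
    define C where "C = L * (real (card ?I) * (5 * real N + 1))"
    have C: "0 \<le> C" using L by (simp add: C_def)
    let ?V = "\<lambda>m f. clip_path N m (m * T) (grid_incr m f)"
    have V: "(\<lambda>f. ?V m f) \<in> measurable (cadlag_space ?I) (cadlag_space ?I)" for m
      unfolding grid_incr_def
      by (intro clip_path_measurable borel_measurable_diff measurable_cadlag_coord) auto
    have eY: "\<bar>(\<integral>\<omega>. H (PY n \<omega>) \<partial>M) - (\<integral>\<omega>. H (?V m (PX n \<omega>)) \<partial>M)\<bar>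
        \<le> C * ((\<integral>\<omega>. min 1 (\<Sum>q\<in>?I. \<bar>PY n \<omega> 0 q\<bar>) \<partial>M) + 1 / b n + (\<integral>\<omega>. osc ?I m (real T) (PX n \<omega>) \<partial>M))"
      if "0 < m" "0 < n" for m n
      unfolding C_def
    proof (rule clip_coupling[OF M N that(1) PX PY _ _ H c L Lip])
      show "AE \<omega> in M. near_reflected N (real T) (1 / b n) (2 * (1 / b n)) (PX n \<omega>) (PY n \<omega>)"
        using dX AE_space
      proof eventually_elim
        case (elim \<omega>)
        show ?case unfolding PX_def PY_def
          by (rule interlacing_near_reflected[OF assms(9)[OF elim(2)] _ that(2) assms(11,12)]) (use elim(1) in auto)
      qed
    qed (use assms(12) in simp)
    \<comment> \<open>\<open>W\<close> is exactly reflected, so any positive tolerance is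
      admissible; \<open>1 / real m\<close> is chosen to vanish with the mesh. The initial term is 0
      because \<open>W\<close> starts at 0.\<close>
    have eW: "\<bar>(\<integral>\<omega>. H (PW \<omega>) \<partial>MW) - (\<integral>\<omega>. H (?V m (PB' \<omega>)) \<partial>MW)\<bar>
        \<le> C * (1 / real m + (\<integral>\<omega>. osc ?I m (real T) (PB' \<omega>) \<partial>MW))" if "0 < m" for m
    proof -
      have "AE \<omega> in MW. near_reflected N (real T) (1 / real m) (2 * (1 / real m)) (PB' \<omega>) (PW \<omega>)"
        using refl
      proof eventually_elim
        case (elim \<omega>)
        show ?case unfolding PB'_def PW_def
          by (rule reflected_imp_near_reflected) (use elim that in auto)
      qed
      from clip_coupling[OF MW N that PB' PW this _ H c L Lip] show ?thesis
        using that unfolding zero C_def by simp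
    qed
    \<comment> \<open>This is the only link between the limit of the walks and the process
      \<open>W\<close>.\<close>
    have eq: "(\<integral>\<omega>. H (?V m (PB \<omega>)) \<partial>MB) = (\<integral>\<omega>. H (?V m (PB' \<omega>)) \<partial>MW)" if "0 < m" for m
    proof -
      have J: "0 < m * T" using that by (simp add: T_def)
      show ?thesis unfolding PB_def PB'_def
        by (simp only: integral_clip_brownian[OF MB assms(14) N that J H] integral_clip_brownian[OF MW B' N that J H])
    qed
    have conv: "weak_convergence (cadlag_topology ?I) (\<lambda>n. distr M (cadlag_space ?I) (PX n)) (distr MB (cadlag_space ?I) PB)"
      using assms(15) unfolding path_law_def PX_def[abs_def] PB_def[abs_def] .
    have convH: "(\<lambda>n. \<integral>\<omega>. H (?V m (PX n \<omega>)) \<partial>M) \<longlonglongrightarrow> (\<integral>\<omega>. H (?V m (PB \<omega>)) \<partial>MB)" if m: "0 < m" for m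
    proof (rule weak_convergenceD[OF conv PX PB, where F = "\<lambda>f. H (?V m f)"])
      show "continuous_map (cadlag_topology ?I) euclideanreal (\<lambda>f. H (?V m f))"
        by (rule clip_functional_continuous[OF m L Lip])
      show "(\<lambda>f. H (?V m f)) \<in> borel_measurable (cadlag_space ?I)" by (rule measurable_compose[OF V H])
      show "\<forall>f\<in>topspace (cadlag_topology ?I). \<bar>H (?V m f)\<bar> \<le> c" using c clip_path_cadlag by blast
    qed
    have convO: "(\<lambda>n. \<integral>\<omega>. osc ?I m (real T) (PX n \<omega>) \<partial>M) \<longlonglongrightarrow> (\<integral>\<omega>. osc ?I m (real T) (PB \<omega>) \<partial>MB)" if m: "0 < m" for m
    proof (rule weak_convergenceD[OF conv PX PB])
      show "continuous_map (cadlag_topology ?I) euclideanreal (osc ?I m (real T))"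
        by (rule osc_continuous[OF finite_tri _ m]) simp
      show "osc ?I m (real T) \<in> borel_measurable (cadlag_space ?I)" by (rule osc_measurable[OF finite_tri]) simp
      show "\<forall>f\<in>topspace (cadlag_topology ?I). \<bar>osc ?I m (real T) f\<bar> \<le> 2"
        by (simp add: abs_osc_le)
    qed
    \<comment> \<open>What is left once \<open>n\<close> has tended to infinity at mesh
      \<open>1 / m\<close>: the limiting error on the side of the walks, and the error on the side
      of \<open>W\<close>.\<close>
    define r where "r m = C * ((\<integral>\<omega>. osc ?I m (real T) (PB \<omega>) \<partial>MB)) + C * (1 / real m + (\<integral>\<omega>. osc ?I m (real T) (PB' \<omega>) \<partial>MW))" for m
    have r: "(\<lambda>m. r (Suc m)) \<longlonglongrightarrow> 0"
    proof -
      have "(\<lambda>m. r (Suc m)) \<longlonglongrightarrow> C * 0 + C * (0 + 0)" unfolding r_def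
      proof (intro tendsto_intros)
        show "(\<lambda>m. \<integral>\<omega>. osc ?I (Suc m) (real T) (PB \<omega>) \<partial>MB) \<longlonglongrightarrow> 0"
          by (rule integral_osc_tendsto_0[OF MB finite_tri _ PB cont(1)]) auto
        show "(\<lambda>m. \<integral>\<omega>. osc ?I (Suc m) (real T) (PB' \<omega>) \<partial>MW) \<longlonglongrightarrow> 0"
          by (rule integral_osc_tendsto_0[OF MW finite_tri _ PB' cont(2)]) auto
        show "(\<lambda>m. 1 / real (Suc m)) \<longlonglongrightarrow> 0" by (rule lim_1_over_n[THEN LIMSEQ_Suc])
      qed
      then show ?thesis by simp
    qed
    show "(\<lambda>n. \<integral>f. H f \<partial>distr M (cadlag_space ?I) (PY n)) \<longlonglongrightarrow> (\<integral>\<omega>. H (PW \<omega>) \<partial>MW)"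
      unfolding integral_distr[OF PY H]
    proof (rule tendstoI)
      fix e :: real assume e: "0 < e"
      \<comment> \<open>The mesh is fixed before \<open>n\<close> grows, since all convergence
        statements in \<open>n\<close> are for a fixed \<open>m\<close>.\<close>
      obtain m0 where "dist (r (Suc m0)) 0 < e / 2"
        using tendstoD[OF r, of "e / 2"] e eventually_happens by fastforce
      then obtain m where m: "0 < m" "r m < e / 2" by (intro that[of "Suc m0"]) (auto simp: dist_real_def)
      \<comment> \<open>The part of the error that depends on \<open>n\<close>. Its limit is the
        first summand of \<open>r m\<close>, so \<open>s n\<close> and the second summand together
        fall below \<open>e\<close>.\<close>
      define s where "s n = C * ((\<integral>\<omega>. min 1 (\<Sum>q\<in>?I. \<bar>PY n \<omega> 0 q\<bar>) \<partial>M) + 1 / b n + (\<integral>\<omega>. osc ?I m (real T) (PX n \<omega>) \<partial>M))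
          + \<bar>(\<integral>\<omega>. H (?V m (PX n \<omega>)) \<partial>M) - (\<integral>\<omega>. H (?V m (PB \<omega>)) \<partial>MB)\<bar>" for n
      have "s \<longlonglongrightarrow> C * (0 + 0 + (\<integral>\<omega>. osc ?I m (real T) (PB \<omega>) \<partial>MB)) + \<bar>(\<integral>\<omega>. H (?V m (PB \<omega>)) \<partial>MB) - (\<integral>\<omega>. H (?V m (PB \<omega>)) \<partial>MB)\<bar>"
        unfolding s_def by (intro tendsto_intros init b0 convO convH m)
      then have "\<forall>\<^sub>F n in sequentially. dist (s n) (C * (\<integral>\<omega>. osc ?I m (real T) (PB \<omega>) \<partial>MB)) < e / 2"
        using e by (intro tendstoD) auto
      with eventually_gt_at_top[of "0::nat"]
      show "\<forall>\<^sub>F n in sequentially. dist (\<integral>\<omega>. H (PY n \<omega>) \<partial>M) (\<integral>\<omega>. H (PW \<omega>) \<partial>MW) < e"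
      proof eventually_elim
        case (elim n)
        show ?case using eY[OF m(1) elim(1)] eW[OF m(1)] eq[OF m(1)] elim(2) m(2)
          unfolding s_def r_def dist_real_def by linarith
      qed
    qed
  qed
  then show ?thesis unfolding path_law_def PY_def[abs_def] PW_def[abs_def] .
qed

end
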